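(* Let $d\ge 1$ be an integer, let $N,\sigma,r,\delta>0$ and $\nu\ge 1$ be real with $\delta<N$, let $v:\mathbb{R}^d\to\mathbb{C}$ be integrable and satisfy $$Q_v(\lambda)\le N\exp(\sigma\lambda^{\nu})\quad\text{for all }\lambda\ge 0,$$ and let $w$ be a function on $B_r$ with $\|w-\mathcal{F}v\|_{L^\infty(B_r)}\le\delta$. Assume also that $v\in\mathcal{W}^m(\mathbb{R}^d)$ for some real $m>d$ and that $\|v\|_{\mathcal{W}^m(\mathbb{R}^d)}\le\gamma_1$. Then, for any $\alpha\in[0,1]$, with $\tau=1-\sqrt{1-(1-\alpha)\nu^{-1}}$, $$\left\|v-\mathcal{F}^{-1}\mathcal{C}^*_{\tau,\delta}w\right\|_{L^\infty(\mathbb{R}^d)}\le\frac{8c(d)}{d}\,N^{1-\alpha}r^d\,(L_\tau(\delta))^{d+1}\,\delta^{\alpha}+\frac{c(d)}{m-d}\,\gamma_1\,r^{-m+d}\,(L_\tau(\delta))^{-m+d}.$$ In particular, for any $\beta_1$ such that $0<\frac{\beta_1}{m-d}<1-\sqrt{1-\nu^{-1}}$, one has, with $\tau=\frac{\beta_1}{m-d}$, $$\left\|v-\mathcal{F}^{-1}\mathcal{C}^*_{\tau,\delta}w\right\|_{L^\infty(\mathbb{R}^d)}\le c_1\left(\ln(3+\delta^{-1})\right)^{-\beta_1},$$ where $c_1=c_1(N,\sigma,\nu,r,m,\gamma_1,d,\beta_1)$ is a positive constant (depending only on the listed parameters).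
   Context: Fourier transforms: $\mathcal{F}v(\xi)=\frac{1}{(2\pi)^d}\int_{\mathbb{R}^d}e^{i\xi x}v(x)\,dx$ and $\mathcal{F}^{-1}[u](x)=\int_{\mathbb{R}^d}u(\xi)e^{-i\xi x}\,d\xi$. $B_\rho=\{\xi\in\mathbb{R}^d:|\xi|<\rho\}$. For integrable $v$ and $\lambda\ge0$, $Q_v(\lambda)=\frac{1}{(2\pi)^d}\int_{\mathbb{R}^d}e^{\lambda|x|}|v(x)|\,dx$. Chebyshev polynomials: $T_k$, $k\in\mathbb{N}=\{0,1,\dots\}$, is the polynomial with $T_k(t)=\cos(k\arccos t)$ for $t\in[-1,1]$, extended as a polynomial to $|t|>1$. Extrapolation operator: for $r>0$, $R\ge r$, $n\in\mathbb{N}$ and $w\in L^\infty(B_r)$, $$[\mathcal{C}_{R,n}w](\xi)=\begin{cases}w(\xi),&\xi\in B_r,\\ \sum_{k=0}^{n-1}a_k\left(\frac{\xi}{|\xi|}\right)T_k\left(\frac{|\xi|}{r}\right),&\xi\in B_R\setminus B_r,\\ 0,&\xi\in\mathbb{R}^d\setminus B_R,\end{cases}$$ where the sum is $0$ for $n=0$ and, for (almost every) $\theta\in S^{d-1}$, $a_0(\theta)=\frac1\pi\int_{-r}^r\frac{w(t\theta)}{\sqrt{r^2-t^2}}\,dt$ and $a_k(\theta)=\frac2\pi\int_{-r}^r\frac{w(t\theta)T_k(t/r)}{\sqrt{r^2-t^2}}\,dt$ for $k\ge1$. Choice of parameters: for $\tau\in[0,1]$ and $0<\delta<N$, $$L_\tau(\delta)=\max\left\{1,\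 \frac12\left(\frac{(1-\tau)\ln\frac N\delta}{\sigma r^\nu}\right)^{\tau}\right\},\qquad R_\tau(\delta)=rL_\tau(\delta),$$ $n_\tau(\delta)=\left\lceil\frac{(2-\tau)\ln\frac N\delta}{\ln2+\frac{1}{\tau\nu}\ln(2L_\tau(\delta))}\right\rceil$ if $\tau>0$, $n_0(\delta)=0$, and $\mathcal{C}^*_{\tau,\delta}=\mathcal{C}_{R_\tau(\delta),n_\tau(\delta)}$. $c(d)=\int_{\partial B_1}1\,dx=\frac{d\pi^{d/2}}{\Gamma(\frac d2+1)}$. For $m\ge0$, $\mathcal{W}^m(\mathbb{R}^d)=\{u\in L^1(\mathbb{R}^d):(1+|\xi|^2)^{m/2}\mathcal{F}u\in L^\infty(\mathbb{R}^d)\}$ with norm $\|u\|_{\mathcal{W}^m(\mathbb{R}^d)}=\|(1+|\xi|^2)^{m/2}\mathcal{F}u\|_{L^\infty(\mathbb{R}^d)}$. *)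

theory Defs
  imports
    "HOL-Analysis.Analysis"
    "HOL-Probability.Essential_Supremum"
    "HOL-Computational_Algebra.Polynomial"
begin

text \<open>
  The space \<open>\<real>\<^sup>d\<close> is a Euclidean space \<open>'a\<close> with \<open>d = DIM('a)\<close>. Functions on \<open>\<real>\<^sup>d\<close> are
  considered with respect to Lebesgue (not just Borel) measurability.
\<close>

definition linfty_norm :: "'a::euclidean_space set \<Rightarrow> ('a \<Rightarrow> complex) \<Rightarrow> ereal" where
  "linfty_norm S f = esssup (lebesgue_on S) (\<lambda>x. ereal (norm (f x)))"

definition linfty :: "'a::euclidean_space set \<Rightarrow> ('a \<Rightarrow> complex) set" where
  "linfty S = {f \<in> borel_measurable (lebesgue_on S). linfty_norm S f < \<infinity>}"

definition fourier :: "('a::euclidean_space \<Rightarrow> complex) \<Rightarrow> 'a \<Rightarrow> complex" where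
  "fourier v \<xi> =
     of_real (1 / (2 * pi) ^ DIM('a)) * (\<integral>x. exp (\<i> * of_real (\<xi> \<bullet> x)) * v x \<partial>lebesgue)"

definition inv_fourier :: "('a::euclidean_space \<Rightarrow> complex) \<Rightarrow> 'a \<Rightarrow> complex" where
  "inv_fourier u x = (\<integral>\<xi>. u \<xi> * exp (- \<i> * of_real (\<xi> \<bullet> x)) \<partial>lebesgue)"

text \<open>The integral may be infinite, so \<open>Q\<^sub>v(\<lambda>)\<close> takes values in \<open>[0, \<infinity>]\<close>.\<close>

definition Q_fun :: "('a::euclidean_space \<Rightarrow> complex) \<Rightarrow> real \<Rightarrow> ennreal" where
  "Q_fun v l =
     ennreal (1 / (2 * pi) ^ DIM('a)) * (\<integral>\<^sup>+x. ennreal (exp (l * norm x) * norm (v x)) \<partial>lebesgue)"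

definition chebyshev_poly :: "nat \<Rightarrow> real poly" where
  "chebyshev_poly k = (THE p. \<forall>t\<in>{-1..1}. poly p t = cos (real k * arccos t))"

lemma chebyshev_poly_ex1: "\<exists>!p. \<forall>t\<in>{-1..1}. poly p t = cos (real k * arccos t)"
proof (rule ex_ex1I)
  show "\<exists>p. \<forall>t\<in>{-1..1}. poly p t = cos (real k * arccos t)"
  proof (induction k rule: induct_nat_012)
    case 0
    show ?case by (intro exI[of _ 1]) simp
  next
    case 1
    show ?case by (intro exI[of _ "[:0, 1:]"]) (simp add: cos_arccos)
  next
    case (ge2 k)
    obtain p q where p: "\<forall>t\<in>{-1..1}. poly p t = cos (real k * arccos t)"
      and q: "\<forall>t\<in>{-1..1}. poly q t = cos (real (Suc k) * arccos t)"
      using ge2 by blast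
    have "poly ([:0, 2:] * q - p) t = cos (real (Suc (Suc k)) * arccos t)" if t: "t \<in> {-1..1}" for t
    proof -
      define x where "x = arccos t"
      have c: "cos x = t" using t by (simp add: x_def cos_arccos)
      have "cos (real (Suc (Suc k)) * x) + cos (real k * x) = 2 * cos (real (Suc k) * x) * cos x"
        using cos_add[of "real (Suc k) * x" x] cos_diff[of "real (Suc k) * x" x]
        by (simp add: algebra_simps)
      with p q t c show ?thesis by (simp add: x_def algebra_simps)
    qed
    then show ?case by blast
  qed
next
  fix p q :: "real poly"
  assume p: "\<forall>t\<in>{-1..1}. poly p t = cos (real k * arccos t)"
    and q: "\<forall>t\<in>{-1..1}. poly q t = cos (real k * arccos t)"
  have "{-1..1} \<subseteq> {t. poly (p - q) t = 0}" using p q by auto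
  moreover have "infinite {-1..(1::real)}" by (simp add: infinite_Icc)
  ultimately have "infinite {t. poly (p - q) t = 0}" using finite_subset by blast
  then have "p - q = 0" using poly_roots_finite by blast
  then show "p = q" by simp
qed

lemma poly_chebyshev:
  "t \<in> {-1..1} \<Longrightarrow> poly (chebyshev_poly k) t = cos (real k * arccos t)"
  unfolding chebyshev_poly_def using theI'[OF chebyshev_poly_ex1[of k]] by blast

text \<open>
  Below, \<open>w\<close> is a function on the ball \<open>B\<^sub>r\<close>: its values outside are irrelevant. At \<open>t = -r\<close> and
  \<open>t = r\<close>, a null set, the integrands are \<open>0\<close> by the convention on division by zero.
\<close>

definition cheb_coeff :: "real \<Rightarrow> ('a::euclidean_space \<Rightarrow> complex) \<Rightarrow> nat \<Rightarrow> 'a \<Rightarrow> complex" where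
  "cheb_coeff r w k \<theta> =
     (if k = 0
      then of_real (1 / pi) *
        (\<integral>t. w (t *\<^sub>R \<theta>) / of_real (sqrt (r\<^sup>2 - t\<^sup>2)) \<partial>(lebesgue_on {-r..r}))
      else of_real (2 / pi) *
        (\<integral>t. w (t *\<^sub>R \<theta>) * of_real (poly (chebyshev_poly k) (t / r)) / of_real (sqrt (r\<^sup>2 - t\<^sup>2))
          \<partial>(lebesgue_on {-r..r})))"

definition extrapolation ::
    "real \<Rightarrow> real \<Rightarrow> nat \<Rightarrow> ('a::euclidean_space \<Rightarrow> complex) \<Rightarrow> 'a \<Rightarrow> complex" where
  "extrapolation r R n w \<xi> =
     (if \<xi> \<in> ball 0 r then w \<xi>
      else if \<xi> \<in> ball 0 R
        then \<Sum>k<n. cheb_coeff r w k (\<xi> /\<^sub>R norm \<xi>) * of_real (poly (chebyshev_poly k) (norm \<xi> / r))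
      else 0)"

definition L_par :: "real \<Rightarrow> real \<Rightarrow> real \<Rightarrow> real \<Rightarrow> real \<Rightarrow> real \<Rightarrow> real" where
  "L_par N \<sigma> r \<nu> \<tau> \<delta> =
     max 1 (1 / 2 * ((1 - \<tau>) * ln (N / \<delta>) / (\<sigma> * r powr \<nu>)) powr \<tau>)"

definition R_par :: "real \<Rightarrow> real \<Rightarrow> real \<Rightarrow> real \<Rightarrow> real \<Rightarrow> real \<Rightarrow> real" where
  "R_par N \<sigma> r \<nu> \<tau> \<delta> = r * L_par N \<sigma> r \<nu> \<tau> \<delta>"

definition n_par :: "real \<Rightarrow> real \<Rightarrow> real \<Rightarrow> real \<Rightarrow> real \<Rightarrow> real \<Rightarrow> nat" where
  "n_par N \<sigma> r \<nu> \<tau> \<delta> =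
     (if \<tau> > 0
      then nat \<lceil>(2 - \<tau>) * ln (N / \<delta>) / (ln 2 + 1 / (\<tau> * \<nu>) * ln (2 * L_par N \<sigma> r \<nu> \<tau> \<delta>))\<rceil>
      else 0)"

definition C_star ::
    "real \<Rightarrow> real \<Rightarrow> real \<Rightarrow> real \<Rightarrow> real \<Rightarrow> real \<Rightarrow> ('a::euclidean_space \<Rightarrow> complex) \<Rightarrow> 'a \<Rightarrow> complex" where
  "C_star N \<sigma> r \<nu> \<tau> \<delta> = extrapolation r (R_par N \<sigma> r \<nu> \<tau> \<delta>) (n_par N \<sigma> r \<nu> \<tau> \<delta>)"

text \<open>
  The surface area of the unit sphere of \<open>\<real>\<^sup>d\<close>, by its closed form, as the libraries have no
  surface measure; equivalently, it is \<open>d\<close> times the volume of the unit ball.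
\<close>

definition sphere_area :: "nat \<Rightarrow> real" where
  "sphere_area d = real d * pi powr (real d / 2) / Gamma (real d / 2 + 1)"

lemma sphere_area_eq_measure_ball:
  "sphere_area DIM('a) = real DIM('a) * measure lebesgue (ball (0::'a::euclidean_space) 1)"
  by (simp add: sphere_area_def content_ball unit_ball_vol_def)

definition W_norm :: "real \<Rightarrow> ('a::euclidean_space \<Rightarrow> complex) \<Rightarrow> ereal" where
  "W_norm m u = linfty_norm UNIV (\<lambda>\<xi>. of_real ((1 + (norm \<xi>)\<^sup>2) powr (m / 2)) * fourier u \<xi>)"

definition W_space :: "real \<Rightarrow> ('a::euclidean_space \<Rightarrow> complex) set" where
  "W_space m = {u. integrable lebesgue u \<and>
     (\<lambda>\<xi>. of_real ((1 + (norm \<xi>)\<^sup>2) powr (m / 2)) * fourier u \<xi>) \<in> linfty UNIV}"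

end

theory Submission
  imports Defs "HOL-Probability.Characteristic_Functions"
begin

text \<open>
Along a ray in direction \<open>\<theta>\<close>, the transform \<open>s \<mapsto> fourier v (r s \<theta>)\<close> is an average of plane waves
\<open>exp (\<i> a s)\<close> with \<open>a = r (\<theta> \<bullet> x)\<close>, weighted by \<open>v x\<close>. The hypothesis on \<open>Q_fun\<close> says that \<open>v\<close> decays faster
than any exponential, so everything about the extrapolation reduces to one plane wave. Its Chebyshev
expansion has the coefficients \<open>2 \<i>\<^sup>k J\<^sub>k(a)\<close> for \<open>k \<ge> 1\<close>, which are bounded by \<open>2 (\<bar>a\<bar> / 2)\<^sup>k / k!\<close>; truncating it after
\<open>n\<close> terms costs at most \<open>(2 s / \<rho>)\<^sup>n exp (\<bar>a\<bar> \<rho> / 2)\<close> at the point \<open>s \<ge> 1\<close>, for every \<open>\<rho> \<ge> 1\<close>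
(\<open>jacobi_anger_remainder\<close>). Instead of summing the tail, the proof differentiates the truncated
expansion in \<open>a\<close>: the recurrences of \<open>J\<^sub>k\<close> and \<open>T\<^sub>k\<close> make the defect of the differential equation
\<open>y' = \<i> s y\<close> telescope to two boundary terms.

Noise of size \<open>\<delta>\<close> in the data changes each coefficient by at most \<open>2 \<delta>\<close> (the first one by at
most \<open>\<delta>\<close>), and \<open>T\<^sub>k(s) \<le> (2 s)\<^sup>k / 2\<close> for \<open>k \<ge> 1\<close>, so it contributes
at most \<open>(2 s)\<^sup>n \<delta>\<close>. The parameters are such that, with a suitable \<open>\<rho>\<close>, noise and truncation balance:
 both are at most \<open>2 L N\<^sup>1\<^sup>-\<^sup>\<alpha> \<delta>\<^sup>\<alpha>\<close> (\<open>parameter_choice\<close>).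

It remains to return to \<open>v\<close>. As \<open>m > d\<close>, the transform of \<open>v\<close> is integrable, hence \<open>v\<close> is the inverse
transform of \<open>fourier v\<close> almost everywhere (\<open>fourier_inversion\<close>), and the error is at most the
\<open>L\<^sup>1\<close> norm of the difference of \<open>fourier v\<close> and its extrapolation. Inside the ball of radius
\<open>r L\<close> this is the volume times the bound above; outside, the extrapolation vanishes and \<open>fourier v\<close> is
at most \<open>\<gamma> \<bar>\<xi>\<bar>\<^sup>-\<^sup>m\<close>, whose integral is elementary (\<open>nn_integral_radial_tail\<close>). The logarithmic rate follows
because \<open>L\<close> grows like a power of \<open>ln (1 / \<delta>)\<close>, while \<open>\<delta>\<^sup>\<alpha>\<close> beats every power of \<open>L\<close> (\<open>log_rate\<close>).

Data are given only almost everywhere, but the coefficients are integrals along rays, which are null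
sets. Almost every ray nevertheless meets a given null set in a null set (\<open>AE_rays\<close>), so the data can be
replaced by a Borel function within \<open>\<delta>\<close> of \<open>fourier v\<close> everywhere.
\<close>

section \<open>Chebyshev polynomials\<close>

lemma poly_chebyshev_eqI:
  assumes "\<And>t. t \<in> {-1..1} \<Longrightarrow> poly p t = cos (real k * arccos t)"
  shows "chebyshev_poly k = p"
  using chebyshev_poly_ex1[of k] poly_chebyshev[of _ k] assms by blast

lemma chebyshev_0: "chebyshev_poly 0 = 1"
  by (rule poly_chebyshev_eqI) simp

lemma chebyshev_1: "chebyshev_poly (Suc 0) = [:0, 1:]"
  by (rule poly_chebyshev_eqI) (simp add: cos_arccos)

lemma chebyshev_cos: "poly (chebyshev_poly k) (cos x) = cos (real k * x)" if "x \<in> {0..pi}"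
  using that by (subst poly_chebyshev) (auto simp: arccos_cos)

lemma chebyshev_rec:
  "poly (chebyshev_poly (Suc (Suc k))) t
     = 2 * t * poly (chebyshev_poly (Suc k)) t - poly (chebyshev_poly k) t"
proof -
  have "chebyshev_poly (Suc (Suc k)) = [:0, 2:] * chebyshev_poly (Suc k) - chebyshev_poly k"
  proof (rule poly_chebyshev_eqI)
    fix t :: real assume t: "t \<in> {-1..1}"
    define x where "x = arccos t"
    have c: "cos x = t" and x: "x \<in> {0..pi}"
      using t by (auto simp: x_def arccos_lbound arccos_ubound)
    have "cos (real (Suc (Suc k)) * x) + cos (real k * x) = 2 * cos (real (Suc k) * x) * cos x"
      using cos_add[of "real (Suc k) * x" x] cos_diff[of "real (Suc k) * x" x]
      by (simp add: algebra_simps)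
    then show "poly ([:0, 2:] * chebyshev_poly (Suc k) - chebyshev_poly k) t
        = cos (real (Suc (Suc k)) * arccos t)"
      using chebyshev_cos[OF x, of k] chebyshev_cos[OF x, of "Suc k"] c t
      by (simp add: x_def [symmetric] algebra_simps)
  qed
  then show ?thesis by simp
qed

lemma abs_chebyshev_le_1: "\<bar>poly (chebyshev_poly k) t\<bar> \<le> 1" if "\<bar>t\<bar> \<le> 1"
  using that by (subst poly_chebyshev) auto

lemma chebyshev_mono_index:
  assumes "s \<ge> 1"
  shows "1 \<le> poly (chebyshev_poly k) s \<and> poly (chebyshev_poly k) s \<le> poly (chebyshev_poly (Suc k)) s"
proof (induction k)
  case 0
  then show ?case using assms by (simp add: chebyshev_0 chebyshev_1)
next
  case (Suc k)
  have "0 \<le> (s - 1) * poly (chebyshev_poly (Suc k)) s"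
    using Suc assms by (intro mult_nonneg_nonneg) auto
  then have "2 * poly (chebyshev_poly (Suc k)) s \<le> 2 * s * poly (chebyshev_poly (Suc k)) s"
    by (simp add: algebra_simps)
  then show ?case using Suc chebyshev_rec[of k s] by linarith
qed

text \<open>
For \<open>s \<ge> 1\<close> the polynomials are positive, so dropping the subtracted term of the recurrence gives this
bound. The factor \<open>1 / 2\<close> is what compensates the factor \<open>2\<close> in the coefficients of positive index.
\<close>
lemma chebyshev_Suc_le:
  assumes "s \<ge> 1"
  shows "poly (chebyshev_poly (Suc k)) s \<le> (2 * s) ^ Suc k / 2"
proof (induction k)
  case (Suc k)
  have "poly (chebyshev_poly (Suc (Suc k))) s \<le> 2 * s * poly (chebyshev_poly (Suc k)) s"
    using chebyshev_mono_index[OF assms, of k] chebyshev_rec[of k s] by linarith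
  also have "\<dots> \<le> 2 * s * ((2 * s) ^ Suc k / 2)"
    using Suc assms by (intro mult_left_mono) auto
  also have "\<dots> = (2 * s) ^ Suc (Suc k) / 2" by simp
  finally show ?case .
qed (simp add: chebyshev_1)

lemma chebyshev_le:
  assumes "s \<ge> 1"
  shows "poly (chebyshev_poly k) s \<le> (2 * s) ^ k"
proof (cases k)
  case (Suc j)
  have "0 \<le> (2 * s) ^ Suc j" using assms by simp
  then show ?thesis using chebyshev_Suc_le[OF assms, of j] unfolding Suc by linarith
qed (simp add: chebyshev_0)

section \<open>Chebyshev expansion of a plane wave\<close>

text \<open>
This is \<open>\<i>\<^sup>k J\<^sub>k(a)\<close> with the Bessel function \<open>J\<^sub>k\<close>; up to the factor \<open>cheb_mult k\<close> below, it is the \<open>k\<close>-th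
Chebyshev coefficient of \<open>s \<mapsto> exp (\<i> a s)\<close> on \<open>[-1, 1]\<close>.
\<close>
definition bessel :: "nat \<Rightarrow> real \<Rightarrow> complex" where
  "bessel k a = integral {0..pi} (\<lambda>\<phi>. exp (\<i> * of_real (a * cos \<phi>)) * of_real (cos (k * \<phi>))) /\<^sub>R pi"

lemma bessel_integrable:
  "(\<lambda>\<phi>. exp (\<i> * of_real (a * cos \<phi>)) * of_real (f \<phi>)) integrable_on {0..pi}"
  if "continuous_on {0..pi} f" for f :: "real \<Rightarrow> real"
  by (intro integrable_continuous_interval continuous_intros that)

lemma bessel_cnj: "bessel k (- a) = cnj (bessel k a)"
  unfolding bessel_def by (simp add: integral_cnj exp_cnj)

lemma bessel_deriv_integral:
  "(bessel k has_vector_derivative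
     \<i> * integral {0..pi} (\<lambda>\<phi>. exp (\<i> * of_real (a * cos \<phi>)) * of_real (cos \<phi> * cos (k * \<phi>))) /\<^sub>R pi) (at a)"
proof -
  have "((\<lambda>a. integral (cbox 0 pi) (\<lambda>\<phi>. exp (\<i> * of_real (a * cos \<phi>)) * of_real (cos (k * \<phi>))))
      has_vector_derivative
        integral (cbox 0 pi) (\<lambda>\<phi>. \<i> * (exp (\<i> * of_real (a * cos \<phi>)) * of_real (cos \<phi> * cos (k * \<phi>)))))
      (at a within UNIV)"
  proof (rule leibniz_rule_vector_derivative)
    fix a \<phi> :: real
    show "((\<lambda>a. exp (\<i> * of_real (a * cos \<phi>)) * of_real (cos (k * \<phi>))) has_vector_derivative
       \<i> * (exp (\<i> * of_real (a * cos \<phi>)) * of_real (cos \<phi> * cos (k * \<phi>)))) (at a within UNIV)"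
    proof -
      have "((\<lambda>z. exp (\<i> * (z * of_real (cos \<phi>))) * of_real (cos (k * \<phi>))) has_field_derivative
         \<i> * (exp (\<i> * of_real (a * cos \<phi>)) * of_real (cos \<phi> * cos (k * \<phi>)))) (at (of_real a))"
        by (auto intro!: derivative_eq_intros simp: algebra_simps)
      from has_vector_derivative_real_field[OF this, of UNIV] show ?thesis by simp
    qed
  next
    fix a :: real
    show "(\<lambda>\<phi>. exp (\<i> * of_real (a * cos \<phi>)) * of_real (cos (k * \<phi>))) integrable_on cbox 0 pi"
      by (simp only: cbox_interval) (intro bessel_integrable continuous_intros)
  next
    show "continuous_on (UNIV \<times> cbox 0 pi)
      (\<lambda>(a, \<phi>). \<i> * (exp (\<i> * of_real (a * cos \<phi>)) * of_real (cos \<phi> * cos (k * \<phi>))))"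
      by (auto simp: split_beta intro!: continuous_intros)
  qed auto
  then have "((\<lambda>a. integral {0..pi} (\<lambda>\<phi>. exp (\<i> * of_real (a * cos \<phi>)) * of_real (cos (k * \<phi>))) /\<^sub>R pi)
      has_vector_derivative
       (integral {0..pi} (\<lambda>\<phi>. \<i> * (exp (\<i> * of_real (a * cos \<phi>)) * of_real (cos \<phi> * cos (k * \<phi>)))) /\<^sub>R pi)) (at a)"
    by (auto intro!: derivative_eq_intros simp: cbox_interval)
  then show ?thesis
    unfolding bessel_def[abs_def] by (simp add: scaleR_conv_of_real)
qed

lemma bessel_0_deriv: "(bessel 0 has_vector_derivative \<i> * bessel (Suc 0) a) (at a)"
  using bessel_deriv_integral[of 0 a] by (simp add: bessel_def scaleR_conv_of_real mult.left_commute)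

lemma bessel_Suc_deriv:
  "(bessel (Suc k) has_vector_derivative \<i> / 2 * (bessel k a + bessel (Suc (Suc k)) a)) (at a)"
proof -
  let ?e = "\<lambda>\<phi>. exp (\<i> * of_real (a * cos \<phi>))"
  have *: "2 * (cos \<phi> * cos (real (Suc k) * \<phi>)) = cos (real k * \<phi>) + cos (real (Suc (Suc k)) * \<phi>)" for \<phi> :: real
    using cos_add[of "real (Suc k) * \<phi>" \<phi>] cos_diff[of "real (Suc k) * \<phi>" \<phi>]
    by (simp add: algebra_simps)
  have "2 * integral {0..pi} (\<lambda>\<phi>. ?e \<phi> * of_real (cos \<phi> * cos (real (Suc k) * \<phi>)))
      = integral {0..pi} (\<lambda>\<phi>. ?e \<phi> * of_real (cos (real k * \<phi>)) + ?e \<phi> * of_real (cos (real (Suc (Suc k)) * \<phi>)))"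
    unfolding integral_mult_right[symmetric]
  proof (intro integral_cong)
    fix \<phi> :: real
    have "complex_of_real (2 * (cos \<phi> * cos (real (Suc k) * \<phi>)))
        = of_real (cos (real k * \<phi>)) + of_real (cos (real (Suc (Suc k)) * \<phi>))"
      unfolding * by simp
    then show "2 * (?e \<phi> * of_real (cos \<phi> * cos (real (Suc k) * \<phi>)))
        = ?e \<phi> * of_real (cos (real k * \<phi>)) + ?e \<phi> * of_real (cos (real (Suc (Suc k)) * \<phi>))"
      by (simp only: distrib_left [symmetric] of_real_mult of_real_numeral mult.left_commute[of 2])
  qed
  also have "\<dots> = integral {0..pi} (\<lambda>\<phi>. ?e \<phi> * of_real (cos (real k * \<phi>)))
      + integral {0..pi} (\<lambda>\<phi>. ?e \<phi> * of_real (cos (real (Suc (Suc k)) * \<phi>)))"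
    by (intro integral_add bessel_integrable continuous_intros)
  finally have "\<i> * integral {0..pi} (\<lambda>\<phi>. ?e \<phi> * of_real (cos \<phi> * cos (real (Suc k) * \<phi>))) /\<^sub>R pi
      = \<i> / 2 * (bessel k a + bessel (Suc (Suc k)) a)"
    unfolding bessel_def by (simp add: scaleR_conv_of_real field_simps)
  then show ?thesis using bessel_deriv_integral[of "Suc k" a] by (simp only:)
qed

text \<open>
Integration by parts: the function \<open>exp (\<i> a cos \<phi>) sin ((k + 1) \<phi>)\<close> vanishes at both ends of
\<open>[0, \<pi>]\<close>, so the integral of its derivative is zero.
\<close>
lemma bessel_three_term:
  "of_nat (Suc k) * bessel (Suc k) a = \<i> * of_real a / 2 * (bessel k a - bessel (Suc (Suc k)) a)"
proof -
  let ?e = "\<lambda>\<phi>. exp (\<i> * of_real (a * cos \<phi>))"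
  have "((\<lambda>\<phi>. ?e \<phi> * of_real (sin (real (Suc k) * \<phi>))) has_vector_derivative
       of_nat (Suc k) * (?e \<phi> * of_real (cos (real (Suc k) * \<phi>)))
       - \<i> * of_real a * (?e \<phi> * of_real (sin \<phi> * sin (real (Suc k) * \<phi>)))) (at \<phi> within {0..pi})" for \<phi>
  proof -
    have "((\<lambda>z. exp (\<i> * (of_real a * cos z)) * sin (of_nat (Suc k) * z)) has_field_derivative
         of_nat (Suc k) * (?e \<phi> * of_real (cos (real (Suc k) * \<phi>)))
       - \<i> * of_real a * (?e \<phi> * of_real (sin \<phi> * sin (real (Suc k) * \<phi>)))) (at (of_real \<phi>))"
      by (auto intro!: derivative_eq_intros simp: algebra_simps simp flip: cos_of_real sin_of_real)
    from has_vector_derivative_real_field[OF this, of "{0..pi}"] show ?thesis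
      by (simp add: cos_of_real[symmetric] sin_of_real[symmetric] del: of_nat_Suc)
  qed
  then have "((\<lambda>\<phi>. of_nat (Suc k) * (?e \<phi> * of_real (cos (real (Suc k) * \<phi>)))
       - \<i> * of_real a * (?e \<phi> * of_real (sin \<phi> * sin (real (Suc k) * \<phi>)))) has_integral
       (?e pi * of_real (sin (real (Suc k) * pi)) - ?e 0 * of_real (sin (real (Suc k) * 0)))) {0..pi}"
    by (intro fundamental_theorem_of_calculus) auto
  then have "((\<lambda>\<phi>. of_nat (Suc k) * (?e \<phi> * of_real (cos (real (Suc k) * \<phi>)))
       - \<i> * of_real a * (?e \<phi> * of_real (sin \<phi> * sin (real (Suc k) * \<phi>)))) has_integral 0) {0..pi}"
    using sin_npi[of "Suc k"] by (simp del: of_nat_Suc sin_npi)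
  moreover have "of_nat (Suc k) * (?e \<phi> * of_real (cos (real (Suc k) * \<phi>)))
       - \<i> * of_real a * (?e \<phi> * of_real (sin \<phi> * sin (real (Suc k) * \<phi>)))
    = of_nat (Suc k) * (?e \<phi> * of_real (cos (real (Suc k) * \<phi>)))
       - \<i> * of_real a / 2 * (?e \<phi> * of_real (cos (real k * \<phi>)) - ?e \<phi> * of_real (cos (real (Suc (Suc k)) * \<phi>)))" for \<phi>
  proof -
    have "2 * (sin \<phi> * sin (real (Suc k) * \<phi>)) = cos (real k * \<phi>) - cos (real (Suc (Suc k)) * \<phi>)"
      using cos_add[of "real (Suc k) * \<phi>" \<phi>] cos_diff[of "real (Suc k) * \<phi>" \<phi>]
      by (simp add: algebra_simps)
    then have "sin \<phi> * sin (real (Suc k) * \<phi>) = (cos (real k * \<phi>) - cos (real (Suc (Suc k)) * \<phi>)) / 2" by simp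
    then show ?thesis by (simp only: of_real_diff of_real_divide) (simp add: algebra_simps diff_divide_distrib)
  qed
  ultimately have zero: "((\<lambda>\<phi>. of_nat (Suc k) * (?e \<phi> * of_real (cos (real (Suc k) * \<phi>)))
       - \<i> * of_real a / 2 * (?e \<phi> * of_real (cos (real k * \<phi>)) - ?e \<phi> * of_real (cos (real (Suc (Suc k)) * \<phi>)))) has_integral 0) {0..pi}"
    by (simp only:)
  have int: "((\<lambda>\<phi>. ?e \<phi> * of_real (cos (real j * \<phi>))) has_integral (of_real pi * bessel j a)) {0..pi}" for j
  proof -
    have "(\<lambda>\<phi>. ?e \<phi> * of_real (cos (real j * \<phi>))) integrable_on {0..pi}"
      by (intro bessel_integrable continuous_intros)
    then show ?thesis by (simp add: bessel_def scaleR_conv_of_real has_integral_integral mult.assoc[symmetric])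
  qed
  from int have "((\<lambda>\<phi>. of_nat (Suc k) * (?e \<phi> * of_real (cos (real (Suc k) * \<phi>)))
       - \<i> * of_real a / 2 * (?e \<phi> * of_real (cos (real k * \<phi>)) - ?e \<phi> * of_real (cos (real (Suc (Suc k)) * \<phi>)))) has_integral
      of_nat (Suc k) * (of_real pi * bessel (Suc k) a)
      - \<i> * of_real a / 2 * (of_real pi * bessel k a - of_real pi * bessel (Suc (Suc k)) a)) {0..pi}"
    by (intro has_integral_diff has_integral_mult_right)
  from has_integral_unique[OF this zero] have "of_nat (Suc k) * (of_real pi * bessel (Suc k) a)
      - \<i> * of_real a / 2 * (of_real pi * bessel k a - of_real pi * bessel (Suc (Suc k)) a) = 0"
    .
  then have "of_real pi * (of_nat (Suc k) * bessel (Suc k) a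
      - \<i> * of_real a / 2 * (bessel k a - bessel (Suc (Suc k)) a)) = 0"
    by (simp add: algebra_simps)
  then show ?thesis by (simp only: mult_eq_0_iff of_real_eq_0_iff pi_neq_zero) simp
qed

lemma continuous_bessel: "continuous_on UNIV (bessel k)"
  by (auto intro!: continuous_at_imp_continuous_on has_vector_derivative_continuous bessel_deriv_integral)

lemma bessel_0_0: "bessel 0 0 = 1"
  by (simp add: bessel_def)

lemma bessel_Suc_0: "bessel (Suc k) 0 = 0"
  using bessel_three_term[of k 0] by (simp del: of_nat_Suc)

lemma norm_bessel_le_1: "norm (bessel k a) \<le> 1"
proof -
  have "norm (integral {0..pi} (\<lambda>\<phi>. exp (\<i> * of_real (a * cos \<phi>)) * of_real (cos (real k * \<phi>))))
     \<le> integral {0..pi} (\<lambda>\<phi>. 1)"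
    by (intro integral_norm_bound_integral bessel_integrable continuous_intros)
       (auto simp: norm_mult intro!: integrable_continuous_interval)
  then show ?thesis by (simp add: bessel_def divide_simps)
qed

text \<open>
The two recurrences combine to \<open>(a\<^sup>k\<^sup>+\<^sup>1 b\<^sub>k\<^sub>+\<^sub>1(a))' = \<i> a\<^sup>k\<^sup>+\<^sup>1 b\<^sub>k(a)\<close> for \<open>b\<^sub>k = bessel k\<close>, and the bound for
\<open>k\<close> integrates to the bound for \<open>k + 1\<close>.
\<close>
lemma norm_bessel_le_nonneg:
  assumes "a \<ge> 0"
  shows "norm (bessel k a) \<le> (a / 2) ^ k / fact k"
  using assms
proof (induction k arbitrary: a)
  case 0
  then show ?case using norm_bessel_le_1 by simp
next
  case (Suc k)
  show ?case
  proof (cases "a = 0")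
    case True
    then show ?thesis by (simp add: bessel_Suc_0)
  next
    case False
    with Suc.prems have a: "a > 0" by simp
    define G where "G x = of_real (x ^ Suc k) * bessel (Suc k) x" for x :: real
    define \<Phi> where "\<Phi> x = x ^ (2 * Suc k) / (2 ^ Suc k * fact (Suc k))" for x :: real
    have G: "(G has_vector_derivative \<i> * of_real (x ^ Suc k) * bessel k x) (at x)" for x
    proof -
      have p: "((\<lambda>x. complex_of_real (x ^ Suc k)) has_vector_derivative of_real (real (Suc k) * x ^ k)) (at x)"
        using DERIV_pow[of "Suc k" x UNIV]
        by (intro has_vector_derivative_of_real)
          (simp add: has_real_derivative_iff_has_vector_derivative del: power_Suc)
      have "(G has_vector_derivative of_real (x ^ Suc k) * (\<i> / 2 * (bessel k x + bessel (Suc (Suc k)) x))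
          + of_real (real (Suc k) * x ^ k) * bessel (Suc k) x) (at x)"
        unfolding G_def[abs_def] by (intro has_vector_derivative_mult p bessel_Suc_deriv)
      moreover have "of_real (real (Suc k) * x ^ k) * bessel (Suc k) x
          = of_real (x ^ k) * (\<i> * of_real x / 2 * (bessel k x - bessel (Suc (Suc k)) x))"
        unfolding bessel_three_term[symmetric] by (simp add: algebra_simps)
      then have "of_real (x ^ Suc k) * (\<i> / 2 * (bessel k x + bessel (Suc (Suc k)) x))
          + of_real (real (Suc k) * x ^ k) * bessel (Suc k) x = \<i> * of_real (x ^ Suc k) * bessel k x"
        by (simp add: field_simps)
      ultimately show ?thesis by (simp only:)
    qed
    have \<Phi>: "(\<Phi> has_vector_derivative x ^ Suc k * ((x / 2) ^ k / fact k)) (at x)" for x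
    proof -
      have "(\<Phi> has_real_derivative real (2 * Suc k) * x ^ (2 * Suc k - 1) / (2 ^ Suc k * fact (Suc k))) (at x)"
        unfolding \<Phi>_def[abs_def] by (auto intro!: derivative_eq_intros simp del: power_Suc fact_Suc)
      also have "real (2 * Suc k) * x ^ (2 * Suc k - 1) / (2 ^ Suc k * fact (Suc k))
          = x ^ Suc k * ((x / 2) ^ k / fact k)"
      proof -
        have "x ^ (2 * Suc k - 1) = x ^ Suc k * x ^ k"
          by (simp add: power_add[symmetric] mult_2)
        moreover have "2 ^ Suc k * fact (Suc k) = real (2 * Suc k) * (2 ^ k * fact k)"
          by (simp add: algebra_simps)
        ultimately have "real (2 * Suc k) * x ^ (2 * Suc k - 1) / (2 ^ Suc k * fact (Suc k))
            = x ^ Suc k * x ^ k / (2 ^ k * fact k)"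
          by (simp only: mult_divide_mult_cancel_left_if) simp
        then show ?thesis by (simp add: power_divide)
      qed
      finally show ?thesis by (simp add: has_real_derivative_iff_has_vector_derivative)
    qed
    have "norm (G a - G 0) \<le> \<Phi> a - \<Phi> 0"
    proof (rule differentiable_bound_general[OF a])
      show "continuous_on {0..a} G" "continuous_on {0..a} \<Phi>"
        using G \<Phi> by (auto intro!: continuous_at_imp_continuous_on has_vector_derivative_continuous)
      fix x assume x: "0 < x" "x < a"
      show "norm (\<i> * of_real (x ^ Suc k) * bessel k x) \<le> x ^ Suc k * ((x / 2) ^ k / fact k)"
        using mult_left_mono[OF Suc.IH[of x], of "x ^ Suc k"] x by (simp add: norm_mult norm_power del: power_Suc)
    qed (use G \<Phi> in auto)
    moreover have "norm (G a - G 0) = a ^ Suc k * norm (bessel (Suc k) a)"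
      using a by (simp add: G_def norm_mult norm_power)
    moreover have "\<Phi> a - \<Phi> 0 = a ^ Suc k * ((a / 2) ^ Suc k / fact (Suc k))"
    proof -
      have "a ^ (2 * Suc k) = a ^ Suc k * a ^ Suc k" by (simp only: mult_2 power_add)
      then show ?thesis by (simp only: \<Phi>_def power_divide) simp
    qed
    ultimately have "a ^ Suc k * norm (bessel (Suc k) a) \<le> a ^ Suc k * ((a / 2) ^ Suc k / fact (Suc k))"
      by (simp only:)
    moreover have "0 < a ^ Suc k" using a by (rule zero_less_power)
    ultimately show ?thesis by (simp only: mult_le_cancel_left_pos)
  qed
qed

text \<open>
In \<open>L\<^sup>2\<close> with the weight \<open>1 / sqrt (1 - s\<^sup>2)\<close> the polynomial \<open>T\<^sub>0\<close> has squared norm \<open>\<pi>\<close> and all others have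
\<open>\<pi> / 2\<close>, whence the factor \<open>2\<close> in the coefficients of positive index.
\<close>
definition cheb_mult :: "nat \<Rightarrow> real" where "cheb_mult k = (if k = 0 then 1 else 2)"

text \<open>
The partial sum of the Jacobi-Anger expansion \<open>exp (\<i> a s) = J\<^sub>0(a) + 2 \<Sum> \<i>\<^sup>k J\<^sub>k(a) T\<^sub>k(s)\<close>, as a function
of \<open>a\<close> for fixed \<open>s\<close>.
\<close>
definition jacobi_anger :: "nat \<Rightarrow> real \<Rightarrow> real \<Rightarrow> complex" where
  "jacobi_anger n s a = (\<Sum>k<n. of_real (cheb_mult k) * bessel k a * of_real (poly (chebyshev_poly k) s))"

text \<open>
The full series satisfies \<open>y' = \<i> s y\<close>. For a partial sum, the recurrences in \<open>k\<close> of the coefficients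
and of the polynomials cancel everywhere except at the last index.
\<close>
lemma jacobi_anger_deriv:
  "(jacobi_anger (Suc m) s has_vector_derivative \<i> * of_real s * jacobi_anger (Suc m) s a
      + \<i> * (bessel (Suc m) a * of_real (poly (chebyshev_poly m) s)
             - bessel m a * of_real (poly (chebyshev_poly (Suc m)) s))) (at a)"
proof (induction m)
  case 0
  have "jacobi_anger (Suc 0) s = bessel 0"
    by (simp add: jacobi_anger_def fun_eq_iff cheb_mult_def chebyshev_0)
  then show ?case
    using bessel_0_deriv[of a] by (simp add: chebyshev_0 chebyshev_1 algebra_simps)
next
  case (Suc m)
  let ?T = "\<lambda>k. complex_of_real (poly (chebyshev_poly k) s)"
  have eq: "jacobi_anger (Suc (Suc m)) s = (\<lambda>a. jacobi_anger (Suc m) s a + 2 * ?T (Suc m) * bessel (Suc m) a)"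
    by (simp add: jacobi_anger_def fun_eq_iff cheb_mult_def)
  have T: "?T (Suc (Suc m)) = 2 * of_real s * ?T (Suc m) - ?T m"
    unfolding chebyshev_rec by simp
  have "((\<lambda>a. jacobi_anger (Suc m) s a + 2 * ?T (Suc m) * bessel (Suc m) a) has_vector_derivative
      \<i> * of_real s * jacobi_anger (Suc m) s a + \<i> * (bessel (Suc m) a * ?T m - bessel m a * ?T (Suc m))
      + 2 * ?T (Suc m) * (\<i> / 2 * (bessel m a + bessel (Suc (Suc m)) a))) (at a)"
    by (intro has_vector_derivative_add Suc has_vector_derivative_mult_right bessel_Suc_deriv)
  then show ?case unfolding eq T by (simp add: algebra_simps)
qed

text \<open>
Multiplication by \<open>exp (- \<i> a s)\<close>, of modulus one, removes the term \<open>\<i> s y\<close> from the differential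
equation, so that the remainder is bounded by the integral of the boundary terms from \<open>0\<close>,
where the partial sum is exact, to \<open>a\<close>.
\<close>
lemma jacobi_anger_remainder_nonneg:
  assumes "s \<ge> 1" "a \<ge> 0"
  shows "norm (exp (\<i> * of_real (a * s)) - jacobi_anger (Suc m) s a)
    \<le> 2 * (a / 2) ^ Suc (Suc m) / fact (Suc (Suc m)) * (2 * s) ^ m + (a / 2) ^ Suc m / fact (Suc m) * (2 * s) ^ Suc m"
proof (cases "a = 0")
  case True
  have "jacobi_anger (Suc m) s 0 = 1"
    by (induction m) (simp_all add: jacobi_anger_def cheb_mult_def chebyshev_0 bessel_0_0 bessel_Suc_0)
  then show ?thesis using True by simp
next
  case False
  with assms have a: "a > 0" by simp
  let ?T = "\<lambda>k. complex_of_real (poly (chebyshev_poly k) s)"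
  define B where "B x = \<i> * (bessel (Suc m) x * ?T m - bessel m x * ?T (Suc m))" for x
  define H where "H x = exp (- \<i> * of_real s * of_real x) * jacobi_anger (Suc m) s x" for x
  define \<Phi> where "\<Phi> x = 2 * (x / 2) ^ Suc (Suc m) / fact (Suc (Suc m)) * (2 * s) ^ m
      + (x / 2) ^ Suc m / fact (Suc m) * (2 * s) ^ Suc m" for x
  define \<Phi>' where "\<Phi>' x = (x / 2) ^ Suc m / fact (Suc m) * (2 * s) ^ m
      + (x / 2) ^ m / fact m * ((2 * s) ^ Suc m / 2)" for x
  have H: "(H has_vector_derivative exp (- \<i> * of_real s * of_real x) * B x) (at x)" for x
  proof -
    have "((\<lambda>z. exp (- \<i> * of_real s * z)) has_field_derivative
        - \<i> * of_real s * exp (- \<i> * of_real s * of_real x)) (at (of_real x))"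
      by (auto intro!: derivative_eq_intros)
    from has_vector_derivative_real_field[OF this, of UNIV]
    have e: "((\<lambda>x. exp (- \<i> * of_real s * of_real x)) has_vector_derivative
        - \<i> * of_real s * exp (- \<i> * of_real s * of_real x)) (at x)" by simp
    show ?thesis
      unfolding H_def[abs_def]
      by (rule has_vector_derivative_eq_rhs[OF has_vector_derivative_mult[OF e jacobi_anger_deriv]])
         (simp add: B_def algebra_simps)
  qed
  have \<Phi>: "(\<Phi> has_vector_derivative \<Phi>' x) (at x)" for x
  proof -
    have *: "((\<lambda>x. (x / 2) ^ Suc j / fact (Suc j)) has_real_derivative (x / 2) ^ j / fact j / 2) (at x)" for j and x :: real
      by (auto intro!: derivative_eq_intros simp del: power_Suc of_nat_Suc)
    have "(\<Phi> has_real_derivative 2 * ((x / 2) ^ Suc m / fact (Suc m) / 2) * (2 * s) ^ m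
      + (x / 2) ^ m / fact m / 2 * (2 * s) ^ Suc m) (at x)"
      unfolding \<Phi>_def[abs_def] times_divide_eq_right[symmetric]
      by (intro DERIV_add DERIV_cmult_right DERIV_cmult *)
    then show ?thesis by (simp add: \<Phi>'_def has_real_derivative_iff_has_vector_derivative mult.commute)
  qed
  have "norm (H a - H 0) \<le> \<Phi> a - \<Phi> 0"
  proof (rule differentiable_bound_general[OF a])
    show "continuous_on {0..a} H" "continuous_on {0..a} \<Phi>"
      using H \<Phi> by (auto intro!: continuous_at_imp_continuous_on has_vector_derivative_continuous)
    fix x assume x: "0 < x" "x < a"
    have T: "norm (?T k) \<le> (2 * s) ^ k" for k
      using chebyshev_le[OF assms(1), of k] chebyshev_mono_index[OF assms(1), of k] by simp
    have T': "norm (?T (Suc m)) \<le> (2 * s) ^ Suc m / 2"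
      using chebyshev_Suc_le[OF assms(1), of m] chebyshev_mono_index[OF assms(1), of "Suc m"] by simp
    have b: "norm (bessel k x) \<le> (x / 2) ^ k / fact k" for k
      using norm_bessel_le_nonneg[of x k] x by simp
    have "norm (exp (- \<i> * of_real s * of_real x) * B x) = norm (B x)"
      by (simp add: norm_mult)
    also have "\<dots> \<le> norm (bessel (Suc m) x * ?T m) + norm (bessel m x * ?T (Suc m))"
      unfolding B_def norm_mult[of \<i>] by (simp add: norm_triangle_ineq4)
    also have "\<dots> \<le> \<Phi>' x"
      unfolding \<Phi>'_def norm_mult using x T T' b assms
      by (intro add_mono mult_mono) (auto intro!: divide_nonneg_nonneg zero_le_power simp del: power_Suc fact_Suc)
    finally show "norm (exp (- \<i> * of_real s * of_real x) * B x) \<le> \<Phi>' x" .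
  qed (use H \<Phi> in auto)
  moreover have "H 0 = 1"
  proof -
    have "jacobi_anger (Suc m) s 0 = 1"
      by (induction m) (simp_all add: jacobi_anger_def cheb_mult_def chebyshev_0 bessel_0_0 bessel_Suc_0)
    then show ?thesis by (simp add: H_def)
  qed
  moreover have "\<Phi> 0 = 0" by (simp add: \<Phi>_def)
  moreover have "exp (\<i> * of_real (a * s)) - jacobi_anger (Suc m) s a = - exp (\<i> * of_real (a * s)) * (H a - 1)"
  proof -
    have "exp (\<i> * of_real (a * s)) * exp (- \<i> * of_real s * of_real a) = 1"
      by (simp add: mult_exp_exp algebra_simps)
    then have "exp (\<i> * of_real (a * s)) * H a = jacobi_anger (Suc m) s a"
      unfolding H_def by (simp only: mult.assoc[symmetric]) simp
    then show ?thesis by (simp add: algebra_simps)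
  qed
  ultimately show ?thesis by (simp add: norm_mult \<Phi>_def)
qed

text \<open>
The parameter \<open>\<rho>\<close> trades the decay in \<open>n\<close> against exponential growth in \<open>a\<close>. It plays the role of the
parameter of a Bernstein ellipse: the two terms of the previous bound are at most
\<open>(2 s / \<rho>)\<^sup>n\<close> times two terms of the exponential series of \<open>\<bar>a\<bar> \<rho> / 2\<close>.
\<close>
lemma jacobi_anger_remainder:
  assumes "s \<ge> 1" "\<rho> \<ge> 1" "n > 0"
  shows "norm (exp (\<i> * of_real (a * s)) - jacobi_anger n s a) \<le> (2 * s / \<rho>) ^ n * exp (\<bar>a\<bar> * \<rho> / 2)"
proof -
  obtain m where n: "n = Suc m" using assms(3) by (cases n) auto
  define b z where "b = \<bar>a\<bar>" and "z = \<bar>a\<bar> * \<rho> / 2"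
  have z: "z \<ge> 0" "b \<ge> 0" using assms by (auto simp: z_def b_def)
  have bz: "b / 2 = z / \<rho>" using assms by (simp add: z_def b_def)
  have "norm (exp (\<i> * of_real (a * s)) - jacobi_anger n s a) = norm (exp (\<i> * of_real (b * s)) - jacobi_anger n s b)"
  \<comment> \<open>Replacing \<open>a\<close> by \<open>- a\<close> conjugates both the exponential and the partial sum.\<close>
  proof (cases "a \<ge> 0")
    case False
    have "exp (\<i> * of_real (- a * s)) - jacobi_anger n s (- a) = cnj (exp (\<i> * of_real (a * s)) - jacobi_anger n s a)"
      by (simp add: jacobi_anger_def bessel_cnj exp_cnj)
    then show ?thesis using False by (simp add: b_def del: complex_cnj_diff)
  qed (simp add: b_def)
  also have "\<dots> \<le> 2 * (b / 2) ^ Suc n / fact (Suc n) * (2 * s) ^ m + (b / 2) ^ n / fact n * (2 * s) ^ n"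
    using jacobi_anger_remainder_nonneg[OF assms(1) z(2), of m] by (simp add: n)
  also have "\<dots> = (2 * s / \<rho>) ^ n * (1 / (s * \<rho>) * (z ^ Suc n / fact (Suc n)) + z ^ n / fact n)"
    using assms unfolding bz n by (simp add: power_divide power_mult_distrib field_simps del: fact_Suc)
  also have "\<dots> \<le> (2 * s / \<rho>) ^ n * (1 * (z ^ Suc n / fact (Suc n)) + z ^ n / fact n)"
  proof -
    have "1 / (s * \<rho>) \<le> 1" using mult_mono[of 1 s 1 \<rho>] assms by simp
    then show ?thesis using z assms by (intro mult_left_mono add_right_mono mult_right_mono) auto
  qed
  also have "1 * (z ^ Suc n / fact (Suc n)) + z ^ n / fact n = (\<Sum>k\<in>{n, Suc n}. z ^ k /\<^sub>R fact k)"
    by (simp add: field_simps del: fact_Suc)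
  also have "\<dots> \<le> exp z"
    unfolding exp_def using z by (intro sum_le_suminf summable_exp_generic) auto
  finally show ?thesis using assms by (simp add: z_def mult_left_mono)
qed

section \<open>Fourier inversion\<close>

lemma gaussian_fourier_real:
  "(\<integral>x. exp (\<i> * of_real (t * x)) * of_real (exp (- x\<^sup>2 / 2)) \<partial>lborel) = of_real (sqrt (2 * pi) * exp (- t\<^sup>2 / 2))"
proof -
  have "of_real (exp (- t\<^sup>2 / 2)) = char std_normal_distribution t"
    by (simp add: char_std_normal_distribution)
  also have "\<dots> = (\<integral>x. std_normal_density x *\<^sub>R exp (\<i> * of_real (t * x)) \<partial>lborel)"
    unfolding char_def by (subst integral_density) auto
  also have "\<dots> = (\<integral>x. (exp (\<i> * of_real (t * x)) * of_real (exp (- x\<^sup>2 / 2))) / of_real (sqrt (2 * pi)) \<partial>lborel)"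
    by (intro Bochner_Integration.integral_cong) (auto simp: std_normal_density_def scaleR_conv_of_real)
  finally show ?thesis by (simp add: field_simps)
qed

text \<open>
Lebesgue measure is the image of a product measure under the coordinate map, so integrals of products
of functions of the coordinates factorise.
\<close>
lemma lborel_prod_integral:
  fixes f :: "'a::euclidean_space \<Rightarrow> real \<Rightarrow> complex"
  assumes [measurable]: "\<And>b. f b \<in> borel_measurable borel"
    and "\<And>b. b \<in> Basis \<Longrightarrow> integrable lborel (f b)"
  shows "(\<integral>x. (\<Prod>b\<in>Basis. f b (x \<bullet> b)) \<partial>(lborel :: 'a measure)) = (\<Prod>b\<in>Basis. \<integral>t. f b t \<partial>lborel)"
proof -
  interpret product_sigma_finite "\<lambda>_::'a. lborel :: real measure" ..
  have "(\<integral>x. (\<Prod>b\<in>Basis. f b (x \<bullet> b)) \<partial>(lborel :: 'a measure))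
     = (\<integral>x. (\<Prod>b\<in>Basis. f b ((\<Sum>c\<in>Basis. x c *\<^sub>R c) \<bullet> b)) \<partial>(\<Pi>\<^sub>M b\<in>(Basis::'a set). lborel))"
    by (subst lborel_def, subst integral_distr) (auto simp: lborel_eq_real)
  also have "\<dots> = (\<integral>x. (\<Prod>b\<in>Basis. f b (x b)) \<partial>(\<Pi>\<^sub>M b\<in>(Basis::'a set). lborel))"
    by (intro Bochner_Integration.integral_cong prod.cong refl) (simp add: inner_sum_left_Basis)
  also have "\<dots> = (\<Prod>b\<in>Basis. \<integral>t. f b t \<partial>lborel)"
    by (rule product_integral_prod) (use assms in auto)
  finally show ?thesis .
qed

definition gaussian :: "'a::euclidean_space \<Rightarrow> real" where
  "gaussian z = exp (- (norm z)\<^sup>2 / 2) / sqrt (2 * pi) ^ DIM('a)"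

lemma gaussian_measurable [measurable]: "gaussian \<in> borel_measurable borel"
  unfolding gaussian_def[abs_def] by measurable

lemma gaussian_nonneg: "gaussian z \<ge> 0"
  by (simp add: gaussian_def)

lemma gaussian_fourier:
  fixes \<xi> :: "'a::euclidean_space"
  shows "(\<integral>z. exp (\<i> * of_real (\<xi> \<bullet> z)) * of_real (gaussian z) \<partial>lborel) = of_real (exp (- (norm \<xi>)\<^sup>2 / 2))"
proof -
  let ?f = "\<lambda>b t. exp (\<i> * of_real ((\<xi> \<bullet> b) * t)) * complex_of_real (exp (- t\<^sup>2 / 2))"
  have int: "integrable lborel (?f b)" for b :: 'a
  proof (rule ccontr)
    assume "\<not> integrable lborel (?f b)"
    then have "integral\<^sup>L lborel (?f b) = 0" by (rule not_integrable_integral_eq)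
    then show False using gaussian_fourier_real[of "\<xi> \<bullet> b"] by simp
  qed
  have eq: "exp (\<i> * of_real (\<xi> \<bullet> z)) * of_real (exp (- (norm z)\<^sup>2 / 2)) = (\<Prod>b\<in>Basis. ?f b (z \<bullet> b))" for z
  proof -
    have "(norm z)\<^sup>2 = (\<Sum>b\<in>Basis. (z \<bullet> b)\<^sup>2)"
      unfolding power2_norm_eq_inner by (subst euclidean_inner) (simp add: power2_eq_square)
    then have "- (norm z)\<^sup>2 / 2 = (\<Sum>b\<in>Basis. - (z \<bullet> b)\<^sup>2 / 2)"
      by (simp add: sum_negf sum_divide_distrib)
    moreover have "\<i> * complex_of_real (\<xi> \<bullet> z) = (\<Sum>b\<in>Basis. \<i> * of_real ((\<xi> \<bullet> b) * (z \<bullet> b)))"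
      by (simp add: euclidean_inner[of \<xi> z] sum_distrib_left)
    ultimately show ?thesis
      by (simp only: exp_sum finite_Basis of_real_prod prod.distrib)
  qed
  have "(\<integral>z. exp (\<i> * of_real (\<xi> \<bullet> z)) * of_real (exp (- (norm z)\<^sup>2 / 2)) \<partial>lborel)
      = (\<Prod>b\<in>Basis. of_real (sqrt (2 * pi) * exp (- (\<xi> \<bullet> b)\<^sup>2 / 2)))"
    unfolding eq using int by (subst lborel_prod_integral) (auto simp: gaussian_fourier_real[simplified])
  also have "\<dots> = of_real (sqrt (2 * pi) ^ DIM('a) * exp (\<Sum>b\<in>Basis. - (\<xi> \<bullet> b)\<^sup>2 / 2))"
    by (simp only: exp_sum finite_Basis of_real_prod prod.distrib of_real_mult) simp
  also have "(\<Sum>b\<in>Basis. - (\<xi> \<bullet> b)\<^sup>2 / 2) = - (norm \<xi>)\<^sup>2 / 2"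
    unfolding power2_norm_eq_inner
    by (subst (2) euclidean_inner) (simp add: power2_eq_square sum_negf sum_divide_distrib)
  finally show ?thesis
    unfolding gaussian_def by (simp add: field_simps)
qed

text \<open>
The integral of a function that is not integrable is \<open>0\<close> by convention; as the value at frequency \<open>0\<close> is
\<open>1\<close>, integrability comes for free.
\<close>
lemma gaussian_integrable: "integrable lborel (gaussian :: 'a::euclidean_space \<Rightarrow> real)"
proof -
  have "integrable lborel (\<lambda>z::'a. exp (\<i> * of_real (0 \<bullet> z)) * of_real (gaussian z) :: complex)"
  proof (rule ccontr)
    assume "\<not> integrable lborel (\<lambda>z::'a. exp (\<i> * of_real (0 \<bullet> z)) * of_real (gaussian z) :: complex)"
    from not_integrable_integral_eq[OF this] show False using gaussian_fourier[of "0::'a"] by simp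
  qed
  then show ?thesis by (simp add: complex_of_real_integrable_eq)
qed

lemma gaussian_integral: "(\<integral>z. gaussian z \<partial>(lborel :: 'a::euclidean_space measure)) = 1"
proof -
  have "complex_of_real (\<integral>z. gaussian z \<partial>(lborel :: 'a measure)) = 1"
    using gaussian_fourier[of "0::'a"] by simp
  then show ?thesis by (simp only: of_real_eq_1_iff)
qed

lemma lborel_integral_affine:
  fixes f :: "'a::euclidean_space \<Rightarrow> 'b::{banach, second_countable_topology}"
  assumes [measurable]: "f \<in> borel_measurable borel" and c: "c \<noteq> 0"
  shows "(\<integral>x. f x \<partial>lborel) = \<bar>c\<bar> ^ DIM('a) *\<^sub>R (\<integral>x. f (t + c *\<^sub>R x) \<partial>lborel)"
  by (subst lborel_affine[OF c, of t]) (simp add: integral_density integral_distr)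

lemma integrable_pair_dominated:
  fixes f :: "'a::euclidean_space \<times> 'b::euclidean_space \<Rightarrow> complex"
  assumes [measurable]: "f \<in> borel_measurable (lborel \<Otimes>\<^sub>M lborel)"
    and A: "integrable lborel (A :: 'a \<Rightarrow> real)" and B: "integrable lborel (B :: 'b \<Rightarrow> real)"
    and le: "\<And>x y. norm (f (x, y)) \<le> A x * B y"
  shows "integrable (lborel \<Otimes>\<^sub>M lborel) f"
proof -
  have [measurable]: "A \<in> borel_measurable borel" "B \<in> borel_measurable borel" using A B by auto
  have "integrable (lborel \<Otimes>\<^sub>M lborel) (\<lambda>(x, y). A x * B y)"
    using A B by (intro lborel_pair.Fubini_integrable) (auto simp: abs_mult)
  then show ?thesis
  proof (rule Bochner_Integration.integrable_bound)
    show "AE p in lborel \<Otimes>\<^sub>M lborel. norm (f p) \<le> norm (case p of (x, y) \<Rightarrow> A x * B y)"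
      by (intro AE_I2) (use le in \<open>auto split: prod.split intro: order_trans[OF _ abs_ge_self]\<close>)
  qed simp
qed

lemma lborel_Fubini_dominated:
  fixes f :: "'a::euclidean_space \<Rightarrow> 'b::euclidean_space \<Rightarrow> complex"
  assumes "case_prod f \<in> borel_measurable (lborel \<Otimes>\<^sub>M lborel)"
    and "integrable lborel (A :: 'a \<Rightarrow> real)" and "integrable lborel (B :: 'b \<Rightarrow> real)"
    and "\<And>x y. norm (f x y) \<le> A x * B y"
  shows "(\<integral>y. (\<integral>x. f x y \<partial>lborel) \<partial>lborel) = (\<integral>x. (\<integral>y. f x y \<partial>lborel) \<partial>lborel)"
  by (rule lborel_pair.Fubini_integral, rule integrable_pair_dominated[where A=A and B=B]) (use assms in auto)

lemma fourier_eq_lborel: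
  fixes v :: "'a::euclidean_space \<Rightarrow> complex"
  assumes [measurable]: "v \<in> borel_measurable borel"
  shows "fourier v \<xi> = of_real (1 / (2 * pi) ^ DIM('a)) * (\<integral>x. exp (\<i> * of_real (\<xi> \<bullet> x)) * v x \<partial>lborel)"
  unfolding fourier_def by (subst integral_completion) auto

lemma inv_fourier_eq_lborel:
  fixes u :: "'a::euclidean_space \<Rightarrow> complex"
  assumes [measurable]: "u \<in> borel_measurable borel"
  shows "inv_fourier u x = (\<integral>\<xi>. u \<xi> * exp (- \<i> * of_real (\<xi> \<bullet> x)) \<partial>lborel)"
  unfolding inv_fourier_def by (subst integral_completion) auto

lemma norm_exp_i_real [simp]: "norm (exp (\<i> * complex_of_real x)) = 1" "norm (exp (- (\<i> * complex_of_real x))) = 1"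
  by (simp_all add: norm_exp_eq_Re)

lemma inv_fourier_bound:
  fixes u :: "'a::euclidean_space \<Rightarrow> complex"
  assumes "integrable lborel u"
  shows "norm (inv_fourier u x) \<le> (\<integral>\<xi>. norm (u \<xi>) \<partial>lborel)"
proof -
  have [measurable]: "u \<in> borel_measurable borel" using assms by auto
  have "norm (\<integral>\<xi>. u \<xi> * exp (- \<i> * of_real (\<xi> \<bullet> x)) \<partial>lborel) \<le> (\<integral>\<xi>. norm (u \<xi> * exp (- \<i> * of_real (\<xi> \<bullet> x))) \<partial>lborel)"
    by (rule integral_norm_bound)
  then show ?thesis by (simp add: inv_fourier_eq_lborel norm_mult)
qed

lemma continuous_inv_fourier:
  fixes u :: "'a::euclidean_space \<Rightarrow> complex"
  assumes "integrable lborel u"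
  shows "continuous_on UNIV (inv_fourier u)"
proof -
  have [measurable]: "u \<in> borel_measurable borel" using assms by auto
  have "continuous_on UNIV (\<lambda>x. \<integral>\<xi>. u \<xi> * exp (- \<i> * of_real (\<xi> \<bullet> x)) \<partial>lborel)"
    unfolding continuous_on_sequentially comp_def
  proof (intro allI impI ballI, elim conjE)
    fix X :: "nat \<Rightarrow> 'a" and x :: 'a assume X: "X \<longlonglongrightarrow> x"
    show "(\<lambda>n. \<integral>\<xi>. u \<xi> * exp (- \<i> * of_real (\<xi> \<bullet> X n)) \<partial>lborel) \<longlonglongrightarrow> (\<integral>\<xi>. u \<xi> * exp (- \<i> * of_real (\<xi> \<bullet> x)) \<partial>lborel)"
      by (rule integral_dominated_convergence[where w="\<lambda>\<xi>. norm (u \<xi>)"])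
         (use assms in \<open>auto simp: norm_mult intro!: AE_I2 tendsto_intros X\<close>)
  qed
  then show ?thesis by (simp add: inv_fourier_eq_lborel fun_eq_iff)
qed

lemma continuous_fourier:
  fixes v :: "'a::euclidean_space \<Rightarrow> complex"
  assumes "integrable lborel v"
  shows "continuous_on UNIV (fourier v)"
proof -
  have [measurable]: "v \<in> borel_measurable borel" using assms by auto
  have "fourier v = (\<lambda>\<xi>. of_real (1 / (2 * pi) ^ DIM('a)) * inv_fourier v (- \<xi>))"
    by (simp add: fun_eq_iff fourier_eq_lborel inv_fourier_eq_lborel inner_commute mult.commute)
  moreover have "continuous_on UNIV (\<lambda>\<xi>. inv_fourier v (- \<xi>))"
    by (rule continuous_on_compose2[OF continuous_inv_fourier[OF assms]]) (auto intro!: continuous_intros)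
  ultimately show ?thesis by (simp only: continuous_on_mult_left)
qed

text \<open>
The Gaussian density of variance \<open>h\<^sup>2\<close>, intended for \<open>h > 0\<close>.
\<close>
definition heat_kernel :: "real \<Rightarrow> 'a::euclidean_space \<Rightarrow> real" where
  "heat_kernel h x = gaussian (x /\<^sub>R h) / h ^ DIM('a)"

lemma heat_kernel_measurable [measurable]: "heat_kernel h \<in> borel_measurable borel"
  unfolding heat_kernel_def[abs_def] by measurable

lemma heat_kernel_fourier:
  fixes x :: "'a::euclidean_space"
  assumes h: "h > 0"
  shows "(\<integral>\<xi>. exp (\<i> * of_real (\<xi> \<bullet> x)) * of_real (exp (- (h * norm \<xi>)\<^sup>2 / 2)) \<partial>lborel)
    = of_real ((2 * pi) ^ DIM('a) * heat_kernel h x)"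
proof -
  have "(\<integral>\<xi>. exp (\<i> * of_real (\<xi> \<bullet> x)) * of_real (exp (- (h * norm \<xi>)\<^sup>2 / 2)) \<partial>lborel)
     = \<bar>inverse h\<bar> ^ DIM('a) *\<^sub>R (\<integral>\<xi>. exp (\<i> * of_real ((0 + inverse h *\<^sub>R \<xi>) \<bullet> x)) * of_real (exp (- (h * norm (0 + inverse h *\<^sub>R \<xi>))\<^sup>2 / 2)) \<partial>lborel)"
    using h by (intro lborel_integral_affine) auto
  also have "\<dots> = \<bar>inverse h\<bar> ^ DIM('a) *\<^sub>R (\<integral>\<xi>. of_real (sqrt (2 * pi) ^ DIM('a)) *
      (exp (\<i> * of_real ((x /\<^sub>R h) \<bullet> \<xi>)) * of_real (gaussian \<xi>)) \<partial>lborel)"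
    using h by (intro arg_cong2[where f=scaleR] Bochner_Integration.integral_cong)
      (auto simp: gaussian_def inner_commute)
  also have "\<dots> = of_real (\<bar>inverse h\<bar> ^ DIM('a) * sqrt (2 * pi) ^ DIM('a) * exp (- (norm (x /\<^sub>R h))\<^sup>2 / 2))"
    by (simp only: integral_mult_right_zero gaussian_fourier scaleR_conv_of_real of_real_mult mult.assoc)
  also have "\<bar>inverse h\<bar> ^ DIM('a) * sqrt (2 * pi) ^ DIM('a) * exp (- (norm (x /\<^sub>R h))\<^sup>2 / 2)
      = (2 * pi) ^ DIM('a) * heat_kernel h x"
  proof -
    have "(2 * pi) ^ DIM('a) = sqrt (2 * pi) ^ DIM('a) * sqrt (2 * pi) ^ DIM('a)"
      by (simp only: power_mult_distrib[symmetric] real_sqrt_mult_self) simp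
    moreover have "inverse H * q * e = q * q * (e / q / H)" if "q > 0" "H > 0" for q H e :: real
      using that by (simp add: field_simps)
    from this[of "sqrt (2 * pi) ^ DIM('a)" "h ^ DIM('a)"]
    have "\<bar>inverse h\<bar> ^ DIM('a) * sqrt (2 * pi) ^ DIM('a) * e
        = sqrt (2 * pi) ^ DIM('a) * sqrt (2 * pi) ^ DIM('a) * (e / sqrt (2 * pi) ^ DIM('a) / h ^ DIM('a))" for e
      using h by (simp add: power_inverse)
    ultimately show ?thesis by (simp only: heat_kernel_def gaussian_def)
  qed
  finally show ?thesis .
qed

text \<open>
Inversion holds exactly after averaging with a Gaussian. On the left, integrating first over \<open>z\<close> inserts
the factor \<open>exp (- (h \<bar>\<xi>\<bar>)\<^sup>2 / 2)\<close> into the inverse transform; this factor makes the double integral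
that arises from the definition of \<open>fourier v\<close> absolutely convergent, and exchanging the order
recovers the heat kernel.
\<close>
lemma fourier_inversion_smoothed:
  fixes v :: "'a::euclidean_space \<Rightarrow> complex"
  assumes v: "integrable lborel v" and u: "integrable lborel (fourier v)" and h: "h > 0"
  shows "(\<integral>z. inv_fourier (fourier v) (a + h *\<^sub>R z) * of_real (gaussian z) \<partial>lborel)
       = (\<integral>x. v x * of_real (heat_kernel h (x - a)) \<partial>lborel)"
proof -
  have [measurable]: "v \<in> borel_measurable borel" "fourier v \<in> borel_measurable borel" using u v by auto
  let ?u = "fourier v"
  let ?E = "\<lambda>\<xi>. complex_of_real (exp (- (h * norm \<xi>)\<^sup>2 / 2))"
  let ?c = "complex_of_real (1 / (2 * pi) ^ DIM('a))"
  have "(\<integral>z. inv_fourier ?u (a + h *\<^sub>R z) * of_real (gaussian z) \<partial>lborel)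
     = (\<integral>z. (\<integral>\<xi>. ?u \<xi> * exp (- \<i> * of_real (\<xi> \<bullet> (a + h *\<^sub>R z))) * of_real (gaussian z) \<partial>lborel) \<partial>lborel)"
    by (simp add: inv_fourier_eq_lborel)
  also have "\<dots> = (\<integral>\<xi>. (\<integral>z. ?u \<xi> * exp (- \<i> * of_real (\<xi> \<bullet> (a + h *\<^sub>R z))) * of_real (gaussian z) \<partial>lborel) \<partial>lborel)"
    by (rule lborel_Fubini_dominated[where A="\<lambda>\<xi>. norm (?u \<xi>)" and B=gaussian])
       (use u gaussian_integrable in \<open>auto simp: norm_mult gaussian_nonneg\<close>)
  also have "\<dots> = (\<integral>\<xi>. ?u \<xi> * exp (- \<i> * of_real (\<xi> \<bullet> a)) * ?E \<xi> \<partial>lborel)"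
  proof (intro Bochner_Integration.integral_cong refl)
    fix \<xi> :: 'a
    have e: "exp (- \<i> * of_real (\<xi> \<bullet> (a + h *\<^sub>R z)))
        = exp (- \<i> * of_real (\<xi> \<bullet> a)) * exp (\<i> * of_real ((- h *\<^sub>R \<xi>) \<bullet> z))" for z
      unfolding exp_add[symmetric] by (simp add: inner_add_right algebra_simps)
    have "(\<integral>z. ?u \<xi> * exp (- \<i> * of_real (\<xi> \<bullet> (a + h *\<^sub>R z))) * of_real (gaussian z) \<partial>lborel)
      = (\<integral>z. (?u \<xi> * exp (- \<i> * of_real (\<xi> \<bullet> a))) * (exp (\<i> * of_real ((- h *\<^sub>R \<xi>) \<bullet> z)) * of_real (gaussian z)) \<partial>lborel)"
      unfolding e by (intro Bochner_Integration.integral_cong refl) (simp only: mult.assoc)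
    also have "\<dots> = ?u \<xi> * exp (- \<i> * of_real (\<xi> \<bullet> a)) * ?E \<xi>"
      unfolding integral_mult_right_zero gaussian_fourier using h by simp
    finally show "(\<integral>z. ?u \<xi> * exp (- \<i> * of_real (\<xi> \<bullet> (a + h *\<^sub>R z))) * of_real (gaussian z) \<partial>lborel)
       = ?u \<xi> * exp (- \<i> * of_real (\<xi> \<bullet> a)) * ?E \<xi>" .
  qed
  also have "\<dots> = (\<integral>\<xi>. (\<integral>x. ?c * (v x * (exp (\<i> * of_real (\<xi> \<bullet> (x - a))) * ?E \<xi>)) \<partial>lborel) \<partial>lborel)"
  proof (intro Bochner_Integration.integral_cong refl)
    fix \<xi> :: 'a
    have e: "exp (\<i> * of_real (\<xi> \<bullet> (x - a))) = exp (- \<i> * of_real (\<xi> \<bullet> a)) * exp (\<i> * of_real (\<xi> \<bullet> x))" for x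
      unfolding exp_add[symmetric] by (simp add: inner_diff_right algebra_simps)
    have "(\<integral>x. ?c * (v x * (exp (\<i> * of_real (\<xi> \<bullet> (x - a))) * ?E \<xi>)) \<partial>lborel)
      = (\<integral>x. (?c * exp (- \<i> * of_real (\<xi> \<bullet> a)) * ?E \<xi>) * (exp (\<i> * of_real (\<xi> \<bullet> x)) * v x) \<partial>lborel)"
      unfolding e by (intro Bochner_Integration.integral_cong refl) (simp only: mult_ac)
    also have "\<dots> = ?u \<xi> * exp (- \<i> * of_real (\<xi> \<bullet> a)) * ?E \<xi>"
      unfolding integral_mult_right_zero by (simp add: fourier_eq_lborel)
    finally show "?u \<xi> * exp (- \<i> * of_real (\<xi> \<bullet> a)) * ?E \<xi>
      = (\<integral>x. ?c * (v x * (exp (\<i> * of_real (\<xi> \<bullet> (x - a))) * ?E \<xi>)) \<partial>lborel)" ..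
  qed
  also have "\<dots> = (\<integral>x. (\<integral>\<xi>. ?c * (v x * (exp (\<i> * of_real (\<xi> \<bullet> (x - a))) * ?E \<xi>)) \<partial>lborel) \<partial>lborel)"
  proof (rule lborel_Fubini_dominated[where A="\<lambda>x. norm ?c * norm (v x)" and B="\<lambda>\<xi>. exp (- (h * norm \<xi>)\<^sup>2 / 2)"])
    have "integrable lborel (\<lambda>\<xi>::'a. exp (\<i> * of_real (\<xi> \<bullet> 0)) * ?E \<xi>)"
    proof (rule ccontr)
      assume "\<not> integrable lborel (\<lambda>\<xi>::'a. exp (\<i> * of_real (\<xi> \<bullet> 0)) * ?E \<xi>)"
      from not_integrable_integral_eq[OF this] show False
        using heat_kernel_fourier[OF h, of "0::'a"] h by (simp add: heat_kernel_def gaussian_def)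
    qed
    then show "integrable lborel (\<lambda>\<xi>::'a. exp (- (h * norm \<xi>)\<^sup>2 / 2))"
      by (simp add: complex_of_real_integrable_eq)
  qed (use v in \<open>auto simp: norm_mult norm_divide norm_power\<close>)
  also have "\<dots> = (\<integral>x. v x * of_real (heat_kernel h (x - a)) \<partial>lborel)"
    by (intro Bochner_Integration.integral_cong refl)
       (simp only: integral_mult_right_zero heat_kernel_fourier[OF h], simp)
  finally show ?thesis .
qed

lemma heat_kernel_smooth:
  fixes f :: "'a::euclidean_space \<Rightarrow> complex"
  assumes [measurable]: "f \<in> borel_measurable borel" and h: "h > 0"
  shows "(\<integral>a. f a * of_real (heat_kernel h (x - a)) \<partial>lborel) = (\<integral>z. f (x - h *\<^sub>R z) * of_real (gaussian z) \<partial>lborel)"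
proof -
  have "(\<integral>a. f a * of_real (heat_kernel h (x - a)) \<partial>lborel)
     = \<bar>- h\<bar> ^ DIM('a) *\<^sub>R (\<integral>z. f (x + (- h) *\<^sub>R z) * of_real (heat_kernel h (x - (x + (- h) *\<^sub>R z))) \<partial>lborel)"
    using h by (intro lborel_integral_affine) auto
  also have "\<dots> = (\<integral>z. f (x - h *\<^sub>R z) * of_real (gaussian z) \<partial>lborel)"
    using h unfolding integral_scaleR_right[symmetric]
    by (intro Bochner_Integration.integral_cong) (auto simp: heat_kernel_def scaleR_conv_of_real)
  finally show ?thesis .
qed

text \<open>
Boxes form a generator of the Borel sets that is stable under intersection, and the sets on which a
fixed integrable function has integral \<open>0\<close> form a Dynkin system if its total integral vanishes.
The localisation to the boxes \<open>K n\<close> makes \<open>f\<close> integrable.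
\<close>
lemma AE_eq_0_if_box_integrals_0:
  fixes f :: "'a::euclidean_space \<Rightarrow> real"
  assumes int: "\<And>a b. set_integrable lborel (box a b) f"
    and zero: "\<And>a b. (LINT x:box a b|lborel. f x) = 0"
  shows "AE x in lborel. f x = 0"
proof -
  define K :: "nat \<Rightarrow> 'a set" where "K n = box (- real n *\<^sub>R One) (real n *\<^sub>R One)" for n
  define p where "p n x = indicator (K n) x *\<^sub>R f x" for n x
  have p: "integrable lborel (p n)" for n
    using int unfolding p_def K_def set_integrable_def by blast
  have K0: "(LINT x|lborel. p n x) = 0" for n
    using zero unfolding p_def K_def set_lebesgue_integral_def by blast
  have pA: "set_integrable lborel A (p n)" if "A \<in> sets borel" for A n
    using p that unfolding set_integrable_def by (intro integrable_mult_indicator) auto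
  have *: "(LINT x:A|lborel. p n x) = 0" if "A \<in> sets borel" for A n
  proof -
    let ?G = "range (\<lambda>(a, b). box a b :: 'a set)"
    have sets: "sigma_sets UNIV ?G = sets borel"
      by (simp add: borel_eq_box)
    have "Int_stable ?G"
      by (auto simp: Int_stable_def box_Int_box)
    moreover have "?G \<subseteq> Pow UNIV" by simp
    moreover have "A \<in> sigma_sets UNIV ?G" using that unfolding sets .
    ultimately show ?thesis
    proof (induction A rule: sigma_sets_induct_disjoint)
      case (basic A)
      then obtain a b where A: "A = box a b" by auto
      obtain c d where cd: "box a b \<inter> K n = box c d"
        unfolding K_def box_Int_box by blast
      have "(LINT x:A|lborel. p n x) = (LINT x:box c d|lborel. f x)"
        unfolding set_lebesgue_integral_def A cd[symmetric]
        by (intro Bochner_Integration.integral_cong) (auto simp: p_def indicator_def)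
      then show ?case using zero by simp
    next
      case empty
      then show ?case by (simp add: set_lebesgue_integral_def)
    next
      case (compl A)
      then have A: "A \<in> sets borel" unfolding sets by simp
      have "(LINT x:UNIV - A|lborel. p n x) = (LINT x|lborel. p n x - indicator A x *\<^sub>R p n x)"
        unfolding set_lebesgue_integral_def by (intro Bochner_Integration.integral_cong) (auto simp: indicator_def)
      also have "\<dots> = (LINT x|lborel. p n x) - (LINT x:A|lborel. p n x)"
        unfolding set_lebesgue_integral_def
        using pA[OF A, of n] p[of n] by (intro Bochner_Integration.integral_diff) (auto simp: set_integrable_def)
      finally show ?case using compl K0 by simp
    next
      case (union A)
      then have A: "A i \<in> sets borel" for i unfolding sets by blast
      then have "(LINT x:(\<Union>i. A i)|lborel. p n x) = (\<Sum>i. (LINT x:(A i)|lborel. p n x))"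
        using union(1) by (intro lebesgue_integral_countable_add pA) (auto simp: disjoint_family_on_def)
      then show ?case using union by simp
    qed
  qed
  have "AE x in lborel. p n x = 0" for n
    by (rule density_unique_real[OF p, of "\<lambda>_. 0"]) (use * in \<open>auto simp: set_lebesgue_integral_def\<close>)
  then have "AE x in lborel. \<forall>n. p n x = 0" by (simp add: AE_all_countable)
  then show ?thesis
  proof (rule AE_mp, intro AE_I2 impI)
    fix x :: 'a assume x: "\<forall>n. p n x = 0"
    obtain n where n: "norm x < real n" using reals_Archimedean2 by blast
    have "- real n < x \<bullet> b \<and> x \<bullet> b < real n" if "b \<in> Basis" for b
      using Basis_le_norm[OF that, of x] n by linarith
    then have "x \<in> K n" by (auto simp: K_def mem_box)
    then show "f x = 0" using x[rule_format, of n] by (simp add: p_def)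
  qed
qed

lemma AE_not_in_box_frontier: "AE x in lborel. x \<notin> cbox a b - box a (b::'a::euclidean_space)"
proof -
  have "cbox a b - box a b \<in> null_sets lebesgue"
    using negligible_frontier_interval[of a b] by (simp add: negligible_iff_null_sets)
  then have "AE x in lebesgue. x \<notin> cbox a b - box a b" by (rule AE_not_in)
  then show ?thesis by (simp add: AE_completion_iff)
qed

text \<open>
The function \<open>v\<close> and the inverse transform \<open>g\<close> of \<open>fourier v\<close> have the same Gaussian means at every scale \<open>h\<close>.
Integrating these over a box \<open>B\<close> and letting \<open>h\<close> tend to \<open>0\<close> shows that \<open>v\<close> and \<open>g\<close> have the same
integral over \<open>B\<close>. For \<open>g\<close>, the means converge pointwise because \<open>g\<close> is continuous and bounded. For \<open>v\<close>,
which need not be continuous, the mean is moved to the indicator of \<open>B\<close>, which it reproduces in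
the limit off the boundary of \<open>B\<close>.
\<close>
lemma fourier_inversion:
  fixes v :: "'a::euclidean_space \<Rightarrow> complex"
  assumes v: "integrable lborel v" and u: "integrable lborel (fourier v)"
  shows "AE x in lborel. v x = inv_fourier (fourier v) x"
proof -
  define g where "g = inv_fourier (fourier v)"
  define C where "C = (\<integral>\<xi>. norm (fourier v \<xi>) \<partial>lborel)"
  have cont: "continuous_on UNIV g" unfolding g_def by (rule continuous_inv_fourier[OF u])
  have gC: "norm (g x) \<le> C" for x unfolding g_def C_def by (rule inv_fourier_bound[OF u])
  have C: "C \<ge> 0" using order_trans[OF norm_ge_zero gC] .
  have [measurable]: "v \<in> borel_measurable borel" using v by auto
  have [measurable]: "g \<in> borel_measurable borel" using cont by (rule borel_measurable_continuous_onI)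
  define h :: "nat \<Rightarrow> real" where "h n = 1 / (real n + 1)" for n
  have h0: "h n > 0" for n by (simp add: h_def)
  have h: "h \<longlonglongrightarrow> 0" unfolding h_def using LIMSEQ_inverse_real_of_nat by (simp add: inverse_eq_divide add.commute)
  have Gc: "integrable lborel (\<lambda>z::'a. complex_of_real (gaussian z))"
    using gaussian_integrable by (rule integrable_of_real)
  have Gc1: "(\<integral>z. complex_of_real (gaussian z) \<partial>(lborel::'a measure)) = 1"
    using gaussian_integral by simp
  have box: "(\<integral>x. indicator (box a b) x * g x \<partial>lborel) = (\<integral>x. indicator (box a b) x * v x \<partial>lborel)" for a b :: 'a
  proof -
    define I where "I n = (\<integral>a'. indicator (box a b) a' * (\<integral>z. g (a' + h n *\<^sub>R z) * of_real (gaussian z) \<partial>lborel) \<partial>lborel)" for n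
    have Bint: "integrable lborel (indicator (box a b) :: 'a \<Rightarrow> real)"
      using emeasure_lborel_box_finite[of a b] by (intro integrable_real_indicator) auto
    have [measurable]: "box a b \<in> sets borel" by simp
    have lim_I: "I \<longlonglongrightarrow> (\<integral>x. indicator (box a b) x * g x \<partial>lborel)"
      unfolding I_def
    proof (rule integral_dominated_convergence[where w="\<lambda>x. indicator (box a b) x * C"])
      show "integrable lborel (\<lambda>x. indicator (box a b) x * C)"
        using Bint by simp
      show "AE x in lborel. (\<lambda>n. indicator (box a b) x * (\<integral>z. g (x + h n *\<^sub>R z) * of_real (gaussian z) \<partial>lborel)) \<longlonglongrightarrow> indicator (box a b) x * g x"
      proof (intro AE_I2 tendsto_intros)
        fix x :: 'a
        have "(\<lambda>n. \<integral>z. g (x + h n *\<^sub>R z) * of_real (gaussian z) \<partial>lborel) \<longlonglongrightarrow> (\<integral>z. g x * of_real (gaussian z) \<partial>(lborel :: 'a measure))"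
        proof (rule integral_dominated_convergence[where w="\<lambda>z::'a. C * gaussian z"])
          show "integrable lborel (\<lambda>z::'a. C * gaussian z)" by (intro integrable_mult_right gaussian_integrable)
          show "AE z in lborel. (\<lambda>n. g (x + h n *\<^sub>R z) * of_real (gaussian z)) \<longlonglongrightarrow> g x * of_real (gaussian z)"
          proof (intro AE_I2 tendsto_intros)
            fix z :: 'a
            have "(\<lambda>n. x + h n *\<^sub>R z) \<longlonglongrightarrow> x + 0 *\<^sub>R z" by (intro tendsto_intros h)
            moreover have "isCont g x" using cont by (simp add: continuous_on_eq_continuous_at)
            ultimately show "(\<lambda>n. g (x + h n *\<^sub>R z)) \<longlonglongrightarrow> g x" by (auto intro: isCont_tendsto_compose)
          qed
          show "AE z in lborel. norm (g (x + h n *\<^sub>R z) * of_real (gaussian z)) \<le> C * gaussian z" for n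
            by (intro AE_I2) (auto simp: norm_mult gaussian_nonneg intro!: mult_right_mono gC)
        qed measurable
        then show "(\<lambda>n. \<integral>z. g (x + h n *\<^sub>R z) * of_real (gaussian z) \<partial>lborel) \<longlonglongrightarrow> g x"
          unfolding integral_mult_right_zero Gc1 by simp
      qed
      show "AE x in lborel. norm (indicator (box a b) x * (\<integral>z. g (x + h n *\<^sub>R z) * of_real (gaussian z) \<partial>lborel))
         \<le> indicator (box a b) x * C" for n
      proof (intro AE_I2)
        fix x :: 'a
        have "norm (\<integral>z. g (x + h n *\<^sub>R z) * of_real (gaussian z) \<partial>lborel) \<le> (\<integral>z. C * gaussian z \<partial>(lborel :: 'a measure))"
        proof (rule Bochner_Integration.integral_norm_bound_integral)
          show le: "norm (g (x + h n *\<^sub>R z) * complex_of_real (gaussian z)) \<le> C * gaussian z" for z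
            by (auto simp: norm_mult gaussian_nonneg intro!: mult_right_mono gC)
          show Ci: "integrable lborel (\<lambda>z::'a. C * gaussian z)"
            by (intro integrable_mult_right gaussian_integrable)
          show "integrable lborel (\<lambda>z. g (x + h n *\<^sub>R z) * complex_of_real (gaussian z))"
            by (rule Bochner_Integration.integrable_bound[OF Ci])
               (use le order_trans[OF _ abs_ge_self] in \<open>auto simp del: norm_mult\<close>)
        qed
        also have "\<dots> = C" by (simp only: integral_mult_right_zero gaussian_integral mult_1_right)
        finally show "norm (indicator (box a b) x * (\<integral>z. g (x + h n *\<^sub>R z) * of_real (gaussian z) \<partial>lborel))
         \<le> indicator (box a b) x * C" by (auto simp: indicator_def)
      qed
    qed measurable
    \<comment> \<open>The heat kernel is passed from \<open>v\<close> to the indicator function of the box.\<close>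
    have I_eq: "I n = (\<integral>x. v x * (\<integral>z. indicator (box a b) (x - h n *\<^sub>R z) * of_real (gaussian z) \<partial>lborel) \<partial>lborel)" for n
    proof -
      have "I n = (\<integral>a'. (\<integral>x. indicator (box a b) a' * (v x * of_real (heat_kernel (h n) (x - a'))) \<partial>lborel) \<partial>lborel)"
        unfolding I_def g_def fourier_inversion_smoothed[OF v u h0] by simp
      also have "\<dots> = (\<integral>x. (\<integral>a'. indicator (box a b) a' * (v x * of_real (heat_kernel (h n) (x - a'))) \<partial>lborel) \<partial>lborel)"
      proof (rule lborel_Fubini_dominated[where A="\<lambda>x. norm (v x)" and B="\<lambda>a'. indicator (box a b) a' * (1 / sqrt (2 * pi) ^ DIM('a) / h n ^ DIM('a))"])
        fix x a' :: 'a
        have "heat_kernel (h n) (x - a') \<le> 1 / sqrt (2 * pi) ^ DIM('a) / h n ^ DIM('a)"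
          unfolding heat_kernel_def gaussian_def using h0[of n] by (intro divide_right_mono) auto
        moreover have "heat_kernel (h n) (x - a') \<ge> 0"
          using h0[of n] by (simp add: heat_kernel_def gaussian_nonneg)
        ultimately show "norm (indicator (box a b) a' * (v x * of_real (heat_kernel (h n) (x - a'))))
           \<le> norm (v x) * (indicator (box a b) a' * (1 / sqrt (2 * pi) ^ DIM('a) / h n ^ DIM('a)))"
          by (auto simp: indicator_def norm_mult simp del: times_divide_eq_right intro!: mult_left_mono)
      qed (use v Bint in auto)
      also have "\<dots> = (\<integral>x. v x * (\<integral>a'. indicator (box a b) a' * of_real (heat_kernel (h n) (x - a')) \<partial>lborel) \<partial>lborel)"
        by (simp add: mult.left_commute)
      also have "\<dots> = (\<integral>x. v x * (\<integral>z. indicator (box a b) (x - h n *\<^sub>R z) * of_real (gaussian z) \<partial>lborel) \<partial>lborel)"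
        by (subst heat_kernel_smooth[OF _ h0]) auto
      finally show ?thesis .
    qed
    have "(\<lambda>n. \<integral>x. v x * (\<integral>z. indicator (box a b) (x - h n *\<^sub>R z) * of_real (gaussian z) \<partial>lborel) \<partial>lborel)
       \<longlonglongrightarrow> (\<integral>x. v x * indicator (box a b) x \<partial>lborel)"
    proof (rule integral_dominated_convergence[where w="\<lambda>x. norm (v x)"])
      show "AE x in lborel. (\<lambda>n. v x * (\<integral>z. indicator (box a b) (x - h n *\<^sub>R z) * of_real (gaussian z) \<partial>lborel)) \<longlonglongrightarrow> v x * indicator (box a b) x"
        using AE_not_in_box_frontier[of a b]
      proof (rule AE_mp, intro AE_I2 impI tendsto_intros)
        fix x :: 'a assume x: "x \<notin> cbox a b - box a b"
        have "(\<lambda>n. \<integral>z. indicator (box a b) (x - h n *\<^sub>R z) * complex_of_real (gaussian z) \<partial>lborel) \<longlonglongrightarrow> (\<integral>z. indicator (box a b) x * of_real (gaussian z) \<partial>(lborel :: 'a measure))"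
        proof (rule integral_dominated_convergence[where w="gaussian :: 'a \<Rightarrow> real"])
          show "AE z in lborel. (\<lambda>n. indicator (box a b) (x - h n *\<^sub>R z) * complex_of_real (gaussian z)) \<longlonglongrightarrow> indicator (box a b) x * of_real (gaussian z)"
          proof (intro AE_I2 tendsto_intros)
            fix z :: 'a
            have lim: "(\<lambda>n. x - h n *\<^sub>R z) \<longlonglongrightarrow> x"
              using tendsto_diff[OF tendsto_const tendsto_scaleR[OF h tendsto_const], of x z] by simp
            have "\<forall>\<^sub>F n in sequentially. (indicator (box a b) (x - h n *\<^sub>R z) :: complex) = indicator (box a b) x"
            proof (cases "x \<in> box a b")
              case True
              from topological_tendstoD[OF lim open_box this] show ?thesis
                by eventually_elim (use True in auto)
            next
              case False
              with x have x': "x \<in> - cbox a b" by auto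
              have "open (- cbox a b)" by (intro open_Compl closed_cbox)
              from topological_tendstoD[OF lim this x'] show ?thesis
                by eventually_elim (use False box_subset_cbox[of a b] in \<open>auto simp: indicator_def\<close>)
            qed
            then show "(\<lambda>n. indicator (box a b) (x - h n *\<^sub>R z) :: complex) \<longlonglongrightarrow> indicator (box a b) x"
              by (rule tendsto_eventually)
          qed
          show "AE z in lborel. norm (indicator (box a b) (x - h n *\<^sub>R z) * complex_of_real (gaussian z)) \<le> gaussian z" for n
            by (intro AE_I2) (auto simp: indicator_def gaussian_nonneg)
        qed (use gaussian_integrable in auto)
        then show "(\<lambda>n. \<integral>z. indicator (box a b) (x - h n *\<^sub>R z) * complex_of_real (gaussian z) \<partial>lborel) \<longlonglongrightarrow> indicator (box a b) x"
          unfolding integral_mult_right_zero Gc1 by simp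
      qed
      show "AE x in lborel. norm (v x * (\<integral>z. indicator (box a b) (x - h n *\<^sub>R z) * of_real (gaussian z) \<partial>lborel)) \<le> norm (v x)" for n
      proof (intro AE_I2)
        fix x :: 'a
        have "norm (\<integral>z. indicator (box a b) (x - h n *\<^sub>R z) * complex_of_real (gaussian z) \<partial>lborel) \<le> (\<integral>z. gaussian z \<partial>(lborel :: 'a measure))"
          by (rule Bochner_Integration.integral_norm_bound_integral)
             (auto simp: indicator_def norm_mult gaussian_nonneg gaussian_integrable
               intro!: Bochner_Integration.integrable_bound[OF gaussian_integrable])
        also have "\<dots> = 1" by (rule gaussian_integral)
        finally show "norm (v x * (\<integral>z. indicator (box a b) (x - h n *\<^sub>R z) * of_real (gaussian z) \<partial>lborel)) \<le> norm (v x)"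
          unfolding norm_mult by (rule mult_left_le) simp
      qed
    qed (use v in auto)
    then have "I \<longlonglongrightarrow> (\<integral>x. v x * indicator (box a b) x \<partial>lborel)"
      unfolding I_eq[THEN ext] .
    from LIMSEQ_unique[OF lim_I this]
    show ?thesis by (simp add: mult.commute)
  qed
  have gi: "integrable lborel (\<lambda>x. indicator (box a b) x * g x)" for a b :: 'a
  proof (rule Bochner_Integration.integrable_bound)
    show "integrable lborel (\<lambda>x. indicator (box a b) x * C)"
      using emeasure_lborel_box_finite[of a b] by (intro integrable_mult_left integrable_real_indicator) auto
  qed (use gC C in \<open>auto simp: indicator_def\<close>)
  have vi: "integrable lborel (\<lambda>x. indicator (box a b) x * v x)" for a b :: 'a
    by (rule Bochner_Integration.integrable_bound[OF v]) (auto simp: indicator_def)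
  have di: "integrable lborel (\<lambda>x. indicator (box a b) x * (v x - g x))" for a b :: 'a
    using vi gi by (simp add: right_diff_distrib)
  have d0: "(\<integral>x. indicator (box a b) x * (v x - g x) \<partial>lborel) = 0" for a b :: 'a
    using vi[of a b] gi[of a b] box[of a b] by (simp add: right_diff_distrib)
  have Re_ind: "Re (indicator (box a b) x * y) = indicator (box a b) x *\<^sub>R Re y"
    and Im_ind: "Im (indicator (box a b) x * y) = indicator (box a b) x *\<^sub>R Im y" for a b x :: 'a and y
    by (auto simp: indicator_def)
  have "AE x in lborel. Re (v x - g x) = 0"
  proof (rule AE_eq_0_if_box_integrals_0)
    fix a b :: 'a
    show "set_integrable lborel (box a b) (\<lambda>x. Re (v x - g x))"
      using integrable_Re[OF di[of a b]] unfolding set_integrable_def Re_ind .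
    show "(LINT x:box a b|lborel. Re (v x - g x)) = 0"
      using integral_Re[OF di[of a b]] unfolding set_lebesgue_integral_def Re_ind d0 by simp
  qed
  moreover have "AE x in lborel. Im (v x - g x) = 0"
  proof (rule AE_eq_0_if_box_integrals_0)
    fix a b :: 'a
    show "set_integrable lborel (box a b) (\<lambda>x. Im (v x - g x))"
      using integrable_Im[OF di[of a b]] unfolding set_integrable_def Im_ind .
    show "(LINT x:box a b|lborel. Im (v x - g x)) = 0"
      using integral_Im[OF di[of a b]] unfolding set_lebesgue_integral_def Im_ind d0 by simp
  qed
  ultimately show ?thesis
    by eventually_elim (simp add: g_def complex_eq_iff)
qed

section \<open>Chebyshev coefficients of Fourier transforms\<close>

text \<open>
The substitution \<open>t = r cos \<phi>\<close> absorbs the Chebyshev weight. It is carried out on the open interval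
\<open>(0, \<pi>)\<close>, where \<open>cos\<close> is injective and \<open>sin\<close> does not vanish; at the end points \<open>t = r\<close> and
\<open>t = - r\<close> the integrand is a quotient by zero and hence \<open>0\<close>.
\<close>
lemma arccos_substitution:
  fixes h :: "real \<Rightarrow> complex"
  assumes r: "r > 0" and h: "continuous_on {-r..r} h"
  shows "integrable (lebesgue_on {-r..r}) (\<lambda>t. h t / of_real (sqrt (r\<^sup>2 - t\<^sup>2)))"
    and "(\<integral>t. h t / of_real (sqrt (r\<^sup>2 - t\<^sup>2)) \<partial>(lebesgue_on {-r..r})) = integral {0..pi} (\<lambda>\<phi>. h (r * cos \<phi>))"
proof -
  let ?f = "\<lambda>t. h t / of_real (sqrt (r\<^sup>2 - t\<^sup>2))"
  let ?S = "{0<..<pi}"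
  have rc: "\<bar>r * cos \<phi>\<bar> \<le> r" for \<phi>
    using r mult_left_mono[OF abs_cos_le_one[of \<phi>], of r] by (simp add: abs_mult)
  have img: "(\<lambda>\<phi>. r * cos \<phi>) ` ?S = {-r<..<r}"
  proof (intro equalityI subsetI)
    fix t assume "t \<in> (\<lambda>\<phi>. r * cos \<phi>) ` ?S"
    then obtain \<phi> where \<phi>: "0 < \<phi>" "\<phi> < pi" "t = r * cos \<phi>" by auto
    have "cos \<phi> < cos 0" "cos pi < cos \<phi>" using \<phi> by (auto intro!: cos_monotone_0_pi simp del: cos_zero cos_pi)
    then have "- 1 < cos \<phi>" "cos \<phi> < 1" by auto
    then have "r * (- 1) < r * cos \<phi>" "r * cos \<phi> < r * 1"
      using r by (intro mult_strict_left_mono; simp)+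
    then show "t \<in> {-r<..<r}" by (simp add: \<phi>(3))
  next
    fix t assume t: "t \<in> {-r<..<r}"
    then have *: "- 1 < t / r" "t / r < 1" using r by (auto simp: field_simps)
    have "arccos (t / r) \<in> ?S" using arccos_lt_bounded[OF *] by simp
    moreover have "t = r * cos (arccos (t / r))" using * r by (simp add: cos_arccos)
    ultimately show "t \<in> (\<lambda>\<phi>. r * cos \<phi>) ` ?S" by blast
  qed
  have inj: "inj_on (\<lambda>\<phi>. r * cos \<phi>) ?S"
    using r by (auto simp: inj_on_def intro: cos_inj_pi)
  have der: "((\<lambda>\<phi>. r * cos \<phi>) has_field_derivative (- (r * sin \<phi>))) (at \<phi> within ?S)" for \<phi>
    by (auto intro!: derivative_eq_intros)
  have eq: "\<bar>- (r * sin \<phi>)\<bar> *\<^sub>R ?f (r * cos \<phi>) = h (r * cos \<phi>)" if "\<phi> \<in> ?S" for \<phi>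
  proof -
    have s: "sin \<phi> > 0" using that by (simp add: sin_gt_zero)
    have "r\<^sup>2 - (r * cos \<phi>)\<^sup>2 = (r * sin \<phi>)\<^sup>2"
      by (simp add: power_mult_distrib sin_squared_eq algebra_simps)
    then have "sqrt (r\<^sup>2 - (r * cos \<phi>)\<^sup>2) = r * sin \<phi>" using s r by simp
    then show ?thesis using s r by (simp add: scaleR_conv_of_real)
  qed
  have "continuous_on {0..pi} (\<lambda>\<phi>. h (r * cos \<phi>))"
    by (rule continuous_on_compose2[OF h]) (use rc in \<open>auto intro!: continuous_intros simp: abs_le_iff minus_le_iff\<close>)
  then have abs: "(\<lambda>\<phi>. h (r * cos \<phi>)) absolutely_integrable_on {0..pi}"
    by (rule absolutely_integrable_continuous_real)
  then have abs': "(\<lambda>\<phi>. h (r * cos \<phi>)) absolutely_integrable_on ?S"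
    by (rule set_integrable_subset) auto
  have "indicator ?S \<phi> *\<^sub>R (\<bar>- (r * sin \<phi>)\<bar> *\<^sub>R ?f (r * cos \<phi>)) = indicator ?S \<phi> *\<^sub>R h (r * cos \<phi>)" for \<phi>
    using eq[of \<phi>] by (cases "\<phi> \<in> ?S") (simp only:, simp only: indicator_simps scaleR_zero_left not_False_eq_True)
  then have "(\<lambda>\<phi>. \<bar>- (r * sin \<phi>)\<bar> *\<^sub>R ?f (r * cos \<phi>)) absolutely_integrable_on ?S"
    using abs' unfolding set_integrable_def by (simp only:)
  moreover have "integral ?S (\<lambda>\<phi>. \<bar>- (r * sin \<phi>)\<bar> *\<^sub>R ?f (r * cos \<phi>)) = integral ?S (\<lambda>\<phi>. h (r * cos \<phi>))"
    using eq by (intro integral_cong) auto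
  moreover have "integral ?S (\<lambda>\<phi>. h (r * cos \<phi>)) = integral {0..pi} (\<lambda>\<phi>. h (r * cos \<phi>))"
    by (rule integral_spike_set) (auto intro: negligible_subset[of "{0, pi}"])
  ultimately have *: "?f absolutely_integrable_on {-r<..<r} \<and>
      integral {-r<..<r} ?f = integral {0..pi} (\<lambda>\<phi>. h (r * cos \<phi>))"
    using has_absolute_integral_change_of_variables_real[OF _ der inj, of ?f "integral {0..pi} (\<lambda>\<phi>. h (r * cos \<phi>))"]
    unfolding img by (simp add: lmeasurable_iff_integrable)
  have ind: "indicator {-r..r} t *\<^sub>R ?f t = indicator {-r<..<r} t *\<^sub>R ?f t" for t
    by (auto simp: indicator_def less_le)
  show "integrable (lebesgue_on {-r..r}) ?f"
    using * by (subst integrable_restrict_space) (auto simp: ind set_integrable_def)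
  have "(\<integral>t. ?f t \<partial>(lebesgue_on {-r..r})) = set_lebesgue_integral lebesgue {-r<..<r} ?f"
    by (subst integral_restrict_space) (auto simp: ind set_lebesgue_integral_def)
  also have "\<dots> = integral {-r<..<r} ?f"
    using * by (intro set_lebesgue_integral_eq_integral) auto
  finally show "(\<integral>t. ?f t \<partial>(lebesgue_on {-r..r})) = integral {0..pi} (\<lambda>\<phi>. h (r * cos \<phi>))"
    using * by simp
qed

text \<open>
The Chebyshev weight has total mass \<open>\<pi>\<close>, as the substitution applied to a constant function shows.
\<close>
lemma cheb_weight_integral_bound:
  fixes g :: "real \<Rightarrow> complex"
  assumes r: "r > 0" and g: "g \<in> borel_measurable (lebesgue_on {-r..r})"
    and le: "\<And>t. t \<in> {-r..r} \<Longrightarrow> norm (g t) \<le> K"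
  shows "integrable (lebesgue_on {-r..r}) (\<lambda>t. g t / of_real (sqrt (r\<^sup>2 - t\<^sup>2)))"
    and "norm (\<integral>t. g t / of_real (sqrt (r\<^sup>2 - t\<^sup>2)) \<partial>(lebesgue_on {-r..r})) \<le> K * pi"
proof -
  have "norm (g 0) \<le> K" using le[of 0] r by simp
  then have K: "K \<ge> 0" using norm_ge_zero order_trans by blast
  have nn: "r\<^sup>2 - t\<^sup>2 \<ge> 0" if "t \<in> {-r..r}" for t
    using that by (auto simp: abs_le_square_iff[symmetric])
  have cK: "continuous_on {-r..r} (\<lambda>_. complex_of_real K)" by simp
  note K_int = arccos_substitution[OF r cK]
  have w: "integrable (lebesgue_on {-r..r}) (\<lambda>t. K / sqrt (r\<^sup>2 - t\<^sup>2))"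
    using K_int(1) unfolding of_real_divide[symmetric] complex_of_real_integrable_eq .
  have "complex_of_real (\<integral>t. K / sqrt (r\<^sup>2 - t\<^sup>2) \<partial>(lebesgue_on {-r..r})) = of_real (K * pi)"
    using K_int(2) unfolding of_real_divide[symmetric] integral_complex_of_real by (simp add: scaleR_conv_of_real mult.commute)
  then have wi: "(\<integral>t. K / sqrt (r\<^sup>2 - t\<^sup>2) \<partial>(lebesgue_on {-r..r})) = K * pi"
    by (simp only: of_real_eq_iff)
  have m: "(\<lambda>t. g t / complex_of_real (sqrt (r\<^sup>2 - t\<^sup>2))) \<in> borel_measurable (lebesgue_on {-r..r})"
  proof -
    have "(\<lambda>t. complex_of_real (sqrt (r\<^sup>2 - t\<^sup>2))) \<in> borel_measurable (lebesgue_on {-r..r})"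
      by (intro borel_measurable_continuous_onI measurable_restrict_space1 measurable_completion
            borel_measurable_of_real borel_measurable_sqrt) (auto intro!: continuous_intros)
    then show ?thesis using g by (intro borel_measurable_divide)
  qed
  have b: "norm (g t / complex_of_real (sqrt (r\<^sup>2 - t\<^sup>2))) \<le> K / sqrt (r\<^sup>2 - t\<^sup>2)" if "t \<in> {-r..r}" for t
    using le[OF that] nn[OF that] by (simp add: norm_divide divide_right_mono)
  show i: "integrable (lebesgue_on {-r..r}) (\<lambda>t. g t / of_real (sqrt (r\<^sup>2 - t\<^sup>2)))"
    by (rule Bochner_Integration.integrable_bound[OF w m])
       (use b in \<open>auto intro!: AE_I2 intro: order_trans[OF _ abs_ge_self] simp del: abs_divide\<close>)
  have "norm (\<integral>t. g t / of_real (sqrt (r\<^sup>2 - t\<^sup>2)) \<partial>(lebesgue_on {-r..r})) \<le> (\<integral>t. K / sqrt (r\<^sup>2 - t\<^sup>2) \<partial>(lebesgue_on {-r..r}))"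
    by (rule Bochner_Integration.integral_norm_bound_integral[OF i w]) (use b in auto)
  then show "norm (\<integral>t. g t / of_real (sqrt (r\<^sup>2 - t\<^sup>2)) \<partial>(lebesgue_on {-r..r})) \<le> K * pi"
    unfolding wi .
qed

lemma cheb_coeff_eq:
  "cheb_coeff r w k \<theta> = of_real (cheb_mult k / pi) *
     (\<integral>t. w (t *\<^sub>R \<theta>) * of_real (poly (chebyshev_poly k) (t / r)) / of_real (sqrt (r\<^sup>2 - t\<^sup>2)) \<partial>(lebesgue_on {-r..r}))"
  by (simp add: cheb_coeff_def cheb_mult_def chebyshev_0)

lemma cheb_coeff_stable:
  fixes w1 w2 :: "'a::euclidean_space \<Rightarrow> complex"
  assumes r: "r > 0" and [measurable]: "w1 \<in> borel_measurable borel" "w2 \<in> borel_measurable borel"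
    and bd: "\<And>x. norm (w1 x) \<le> K" "\<And>x. norm (w2 x) \<le> K"
    and le: "\<And>x. norm (w1 x - w2 x) \<le> \<delta>"
  shows "norm (cheb_coeff r w1 k \<theta> - cheb_coeff r w2 k \<theta>) \<le> cheb_mult k * \<delta>"
proof -
  let ?T = "\<lambda>t. complex_of_real (poly (chebyshev_poly k) (t / r))"
  have T: "norm (?T t) \<le> 1" if "t \<in> {-r..r}" for t
    using abs_chebyshev_le_1[of "t / r" k] that r by (auto simp: abs_le_iff field_simps)
  have Tm: "(\<lambda>t. ?T t) \<in> borel_measurable borel"
    by (intro borel_measurable_continuous_onI continuous_intros) (use r in auto)
  have m: "(\<lambda>t. w (t *\<^sub>R \<theta>) * ?T t) \<in> borel_measurable (lebesgue_on {-r..r})"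
    if [measurable]: "w \<in> borel_measurable borel" for w :: "'a \<Rightarrow> complex"
  proof -
    note Tm [measurable]
    have "(\<lambda>t. w (t *\<^sub>R \<theta>) * ?T t) \<in> borel_measurable lborel" by measurable
    then show ?thesis by (intro measurable_restrict_space1 measurable_completion)
  qed
  have K: "K \<ge> 0" "\<delta> \<ge> 0" using order_trans[OF norm_ge_zero bd(1)] order_trans[OF norm_ge_zero le] by auto
  have b: "norm (w (t *\<^sub>R \<theta>) * ?T t) \<le> C" if "\<And>x. norm (w x) \<le> C" "C \<ge> 0" "t \<in> {-r..r}" for w t C
    using mult_mono[OF that(1)[of "t *\<^sub>R \<theta>"] T[OF that(3)]] that(2) by (simp add: norm_mult)
  have int: "integrable (lebesgue_on {-r..r}) (\<lambda>t. w (t *\<^sub>R \<theta>) * ?T t / of_real (sqrt (r\<^sup>2 - t\<^sup>2)))"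
    if "w \<in> borel_measurable borel" "\<And>x. norm (w x) \<le> K" for w
    using b[OF that(2) K(1)] by (intro cheb_weight_integral_bound[OF r m[OF that(1)]])
  have "cheb_coeff r w1 k \<theta> - cheb_coeff r w2 k \<theta> = of_real (cheb_mult k / pi) *
     (\<integral>t. w1 (t *\<^sub>R \<theta>) * ?T t / of_real (sqrt (r\<^sup>2 - t\<^sup>2)) - w2 (t *\<^sub>R \<theta>) * ?T t / of_real (sqrt (r\<^sup>2 - t\<^sup>2)) \<partial>(lebesgue_on {-r..r}))"
    unfolding cheb_coeff_eq
    by (subst Bochner_Integration.integral_diff) (use int assms in \<open>auto simp: right_diff_distrib\<close>)
  also have "\<dots> = of_real (cheb_mult k / pi) *
     (\<integral>t. (\<lambda>x. w1 x - w2 x) (t *\<^sub>R \<theta>) * ?T t / of_real (sqrt (r\<^sup>2 - t\<^sup>2)) \<partial>(lebesgue_on {-r..r}))"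
    by (simp add: left_diff_distrib diff_divide_distrib)
  finally have eq: "norm (cheb_coeff r w1 k \<theta> - cheb_coeff r w2 k \<theta>) = cheb_mult k / pi *
     norm (\<integral>t. (\<lambda>x. w1 x - w2 x) (t *\<^sub>R \<theta>) * ?T t / of_real (sqrt (r\<^sup>2 - t\<^sup>2)) \<partial>(lebesgue_on {-r..r}))"
    by (simp add: norm_mult norm_divide cheb_mult_def)
  have "norm (\<integral>t. (\<lambda>x. w1 x - w2 x) (t *\<^sub>R \<theta>) * ?T t / of_real (sqrt (r\<^sup>2 - t\<^sup>2)) \<partial>(lebesgue_on {-r..r})) \<le> \<delta> * pi"
    by (intro cheb_weight_integral_bound[OF r m] b[OF le K(2)]) auto
  then have "cheb_mult k / pi * norm (\<integral>t. (\<lambda>x. w1 x - w2 x) (t *\<^sub>R \<theta>) * ?T t / of_real (sqrt (r\<^sup>2 - t\<^sup>2)) \<partial>(lebesgue_on {-r..r}))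
     \<le> cheb_mult k / pi * (\<delta> * pi)"
    by (intro mult_left_mono) (auto simp: cheb_mult_def)
  then show ?thesis unfolding eq by simp
qed

text \<open>
By Fubini, the coefficient of an average of plane waves is the average of their coefficients.
\<close>
lemma cheb_coeff_fourier:
  fixes v :: "'a::euclidean_space \<Rightarrow> complex"
  assumes r: "r > 0" and v: "integrable lborel v"
  shows "cheb_coeff r (fourier v) k \<theta>
    = of_real (1 / (2 * pi) ^ DIM('a)) * (\<integral>x. of_real (cheb_mult k) * bessel k (r * (\<theta> \<bullet> x)) * v x \<partial>lborel)"
proof -
  have [measurable]: "v \<in> borel_measurable borel" using v by auto
  let ?c = "complex_of_real (1 / (2 * pi) ^ DIM('a))"
  let ?e = "\<lambda>\<phi> x. exp (\<i> * of_real (r * (\<theta> \<bullet> x) * cos \<phi>)) * complex_of_real (cos (real k * \<phi>))"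
  let ?h = "\<lambda>t. fourier v (t *\<^sub>R \<theta>) * complex_of_real (poly (chebyshev_poly k) (t / r))"
  have cf: "continuous_on UNIV (\<lambda>t. fourier v (t *\<^sub>R \<theta>))"
    by (rule continuous_on_compose2[OF continuous_fourier[OF v]]) (auto intro!: continuous_intros)
  have ch: "continuous_on {-r..r} ?h"
    by (intro continuous_intros continuous_on_subset[OF cf]) (use r in auto)
  define H where "H \<phi> = fourier v ((r * cos \<phi>) *\<^sub>R \<theta>) * complex_of_real (cos (real k * \<phi>))" for \<phi>
  have cH: "continuous_on {0..pi} H"
    unfolding H_def
    by (intro continuous_intros continuous_on_compose2[OF continuous_fourier[OF v]]) auto
  have "cheb_coeff r (fourier v) k \<theta> = of_real (cheb_mult k / pi) * integral {0..pi} (\<lambda>\<phi>. ?h (r * cos \<phi>))"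
    unfolding cheb_coeff_eq arccos_substitution(2)[OF r ch] ..
  also have "integral {0..pi} (\<lambda>\<phi>. ?h (r * cos \<phi>)) = integral {0..pi} H"
    by (intro integral_cong) (use r in \<open>auto simp: chebyshev_cos H_def\<close>)
  also have "integral {0..pi} H = (\<integral>\<phi>. indicator {0..pi} \<phi> *\<^sub>R H \<phi> \<partial>lborel)"
  proof -
    have "set_integrable lborel {0..pi} H"
      using cH by (intro borel_integrable_atLeastAtMost') 
    from set_borel_integral_eq_integral(2)[OF this] show ?thesis by (simp add: set_lebesgue_integral_def)
  qed
  also have "\<dots> = (\<integral>\<phi>. (\<integral>x. ?c * (indicator {0..pi} \<phi> *\<^sub>R ?e \<phi> x * v x) \<partial>lborel) \<partial>lborel)"
  proof (intro Bochner_Integration.integral_cong refl)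
    fix \<phi> :: real
    have "(\<integral>x. ?c * (indicator {0..pi} \<phi> *\<^sub>R ?e \<phi> x * v x) \<partial>lborel)
       = (\<integral>x. (?c * indicator {0..pi} \<phi> * of_real (cos (real k * \<phi>))) * (exp (\<i> * of_real (((r * cos \<phi>) *\<^sub>R \<theta>) \<bullet> x)) * v x) \<partial>lborel)"
      by (intro Bochner_Integration.integral_cong refl) (auto simp: indicator_def mult_ac)
    also have "\<dots> = (?c * indicator {0..pi} \<phi> * of_real (cos (real k * \<phi>))) * (\<integral>x. exp (\<i> * of_real (((r * cos \<phi>) *\<^sub>R \<theta>) \<bullet> x)) * v x \<partial>lborel)"
      by (rule integral_mult_right_zero)
    also have "\<dots> = indicator {0..pi} \<phi> *\<^sub>R H \<phi>"
      unfolding H_def by (subst fourier_eq_lborel) (auto simp: indicator_def)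
    finally show "indicator {0..pi} \<phi> *\<^sub>R H \<phi> = (\<integral>x. ?c * (indicator {0..pi} \<phi> *\<^sub>R ?e \<phi> x * v x) \<partial>lborel)" ..
  qed
  also have "\<dots> = (\<integral>x. (\<integral>\<phi>. ?c * (indicator {0..pi} \<phi> *\<^sub>R ?e \<phi> x * v x) \<partial>lborel) \<partial>lborel)"
  proof (rule lborel_Fubini_dominated[where A="\<lambda>x. norm ?c * norm (v x)" and B="indicator {0..pi}"])
    fix \<phi> x
    have "norm (?e \<phi> x) \<le> 1" by (simp add: norm_mult)
    then have "norm (?e \<phi> x) * norm (v x) \<le> norm (v x)" by (intro mult_left_le_one_le) auto
    then show "norm (?c * (indicator {0..pi} \<phi> *\<^sub>R ?e \<phi> x * v x)) \<le> norm ?c * norm (v x) * indicator {0..pi} \<phi>"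
      unfolding norm_mult[of ?c] mult.assoc by (intro mult_left_mono) (auto simp: indicator_def norm_mult)
  qed (use v in \<open>auto intro!: integrable_real_indicator\<close>)
  also have "\<dots> = (\<integral>x. ?c * (of_real pi * bessel k (r * (\<theta> \<bullet> x)) * v x) \<partial>lborel)"
  proof (intro Bochner_Integration.integral_cong refl)
    fix x :: 'a
    have "set_integrable lborel {0..pi} (\<lambda>\<phi>. ?e \<phi> x)"
      by (intro borel_integrable_atLeastAtMost' continuous_intros)
    from set_borel_integral_eq_integral(2)[OF this]
    have "(\<integral>\<phi>. indicator {0..pi} \<phi> *\<^sub>R ?e \<phi> x \<partial>lborel) = of_real pi * bessel k (r * (\<theta> \<bullet> x))"
      by (simp add: set_lebesgue_integral_def bessel_def scaleR_conv_of_real)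
    then show "(\<integral>\<phi>. ?c * (indicator {0..pi} \<phi> *\<^sub>R ?e \<phi> x * v x) \<partial>lborel) = ?c * (of_real pi * bessel k (r * (\<theta> \<bullet> x)) * v x)"
      by (simp only: integral_mult_right_zero integral_mult_left_zero)
  qed
  also have "\<dots> = (?c * of_real pi) * (\<integral>x. bessel k (r * (\<theta> \<bullet> x)) * v x \<partial>lborel)"
    unfolding integral_mult_right_zero[symmetric] by (simp only: mult.assoc)
  finally show ?thesis
    by (simp only: mult.assoc integral_mult_right_zero) simp
qed

section \<open>Null sets along rays\<close>

lemma AE_lborel_scale:
  fixes P :: "'a::euclidean_space \<Rightarrow> bool"
  assumes [measurable]: "Measurable.pred borel P" and c: "c \<noteq> 0" and ae: "AE x in lborel. P x"
  shows "AE x in lborel. P (c *\<^sub>R x)"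
proof -
  have "AE x in density (distr lborel borel (\<lambda>x. 0 + c *\<^sub>R x)) (\<lambda>_. \<bar>c\<bar> ^ DIM('a)). P x"
    using ae by (subst (asm) lborel_affine[OF c, of 0])
  then have "AE x in distr lborel borel (\<lambda>x. 0 + c *\<^sub>R x). P x"
    using c by (subst (asm) AE_density) auto
  then show ?thesis by (subst (asm) AE_distr_iff) auto
qed

text \<open>
Fubini replaces polar coordinates: for each \<open>t \<noteq> 0\<close> the set of \<open>\<xi>\<close>
with \<open>t \<xi> \<in> E\<close> is a dilate of \<open>E\<close>, hence null. So for almost every \<open>\<xi>\<close> the set of \<open>t\<close> with \<open>t \<xi> \<in> E\<close>
is null, and it only remains to rescale \<open>t\<close> by \<open>\<bar>\<xi>\<bar>\<close>.
\<close>
lemma AE_rays: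
  fixes E :: "'a::euclidean_space set"
  assumes E: "E \<in> null_sets lborel"
  shows "AE \<xi> in lborel. AE t in lborel. t *\<^sub>R (\<xi> /\<^sub>R norm \<xi>) \<notin> E"
proof -
  have [measurable]: "E \<in> sets borel" using E by auto
  have ne: "AE t in lborel. t \<noteq> (0::real)" by (rule AE_lborel_singleton)
  have "AE \<xi> in lborel. t *\<^sub>R \<xi> \<notin> E" if "t \<noteq> 0" for t
    using AE_not_in[OF E] that by (intro AE_lborel_scale) auto
  with ne have "AE t in lborel. AE \<xi> in lborel. t *\<^sub>R \<xi> \<notin> E" by (auto elim: eventually_mono)
  then have "AE \<xi> in lborel. AE t in lborel. t *\<^sub>R \<xi> \<notin> E"
    by (subst lborel_pair.AE_commute) measurable
  then show ?thesis using AE_lborel_singleton[of "0::'a"]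
  proof eventually_elim
    case (elim \<xi>)
    have "AE t in lborel. (inverse (norm \<xi>) *\<^sub>R t) *\<^sub>R \<xi> \<notin> E"
      using elim by (intro AE_lborel_scale[where P="\<lambda>t. t *\<^sub>R \<xi> \<notin> E"]) auto
    then show ?case by (simp add: mult.commute)
  qed
qed

lemma borel_measurable_poly [measurable]: "poly p \<in> borel_measurable borel" for p :: "real poly"
  by (intro borel_measurable_continuous_onI continuous_intros)

lemma cheb_coeff_lborel:
  assumes [measurable]: "w \<in> borel_measurable borel"
  shows "cheb_coeff r w k \<theta> = of_real (cheb_mult k / pi) *
     (\<integral>t. indicator {-r..r} t *\<^sub>R (w (t *\<^sub>R \<theta>) * of_real (poly (chebyshev_poly k) (t / r)) / of_real (sqrt (r\<^sup>2 - t\<^sup>2))) \<partial>lborel)"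
  unfolding cheb_coeff_eq
  by (subst integral_restrict_space, simp, subst integral_completion) auto

lemma cheb_coeff_cong_AE:
  fixes w w' :: "'a::euclidean_space \<Rightarrow> complex"
  assumes [measurable]: "w \<in> borel_measurable borel"
    and ae: "AE t in lborel. \<bar>t\<bar> < r \<longrightarrow> w (t *\<^sub>R \<theta>) = w' (t *\<^sub>R \<theta>)"
  shows "cheb_coeff r w k \<theta> = cheb_coeff r w' k \<theta>"
proof -
  let ?F = "\<lambda>w t. indicator {-r..r} t *\<^sub>R (w (t *\<^sub>R \<theta>) * complex_of_real (poly (chebyshev_poly k) (t / r)) / of_real (sqrt (r\<^sup>2 - t\<^sup>2)))"
  have F: "?F w \<in> borel_measurable lebesgue" by (intro measurable_completion) measurable
  have "AE t in lborel. ?F w t = ?F w' t"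
    using ae
  proof eventually_elim
    case (elim t)
    \<comment> \<open>At the end points both integrands are \<open>0\<close>, being quotients by zero.\<close>
    consider "\<bar>t\<bar> < r" | "t\<^sup>2 = r\<^sup>2" | "t \<notin> {-r..r}" by (fastforce simp: abs_less_iff power2_eq_iff)
    then show ?case using elim by cases auto
  qed
  then have eq: "AE t in lebesgue. ?F w t = ?F w' t" by (rule AE_completion)
  then have F': "?F w' \<in> borel_measurable lebesgue" using F by (rule borel_measurable_AE[rotated])
  show ?thesis
    unfolding cheb_coeff_eq
    by (subst (1 2) integral_restrict_space, simp, simp) (use integral_cong_AE[OF F F' eq] in simp)
qed

lemma extrapolation_measurable:
  fixes w :: "'a::euclidean_space \<Rightarrow> complex"
  assumes [measurable]: "w \<in> borel_measurable borel"
  shows "extrapolation r R n w \<in> borel_measurable borel"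
proof -
  have [measurable]: "(\<lambda>\<xi>. cheb_coeff r w k (\<xi> /\<^sub>R norm \<xi>)) \<in> borel_measurable borel" for k
    unfolding cheb_coeff_lborel[OF assms] by measurable
  show ?thesis unfolding extrapolation_def[abs_def] mem_ball by measurable
qed

text \<open>
Only the rays that meet the exceptional set in a set of positive measure are affected by a change of the
data on a null set, and these rays form a null set.
\<close>
lemma extrapolation_cong_AE:
  fixes w w' :: "'a::euclidean_space \<Rightarrow> complex"
  assumes [measurable]: "w \<in> borel_measurable borel"
    and ae: "AE x in lborel. x \<in> ball 0 r \<longrightarrow> w x = w' x"
  shows "AE \<xi> in lborel. extrapolation r R n w \<xi> = extrapolation r R n w' \<xi>"
proof -
  obtain E where E: "E \<in> null_sets lborel" "{x. \<not> (x \<in> ball 0 r \<longrightarrow> w x = w' x)} \<subseteq> E"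
    using ae by (auto elim!: AE_E simp: null_sets_def)
  show ?thesis using AE_rays[OF E(1)] ae AE_lborel_singleton[of "0::'a"]
  proof eventually_elim
    case (elim \<xi>)
    let ?\<theta> = "\<xi> /\<^sub>R norm \<xi>"
    have "cheb_coeff r w k ?\<theta> = cheb_coeff r w' k ?\<theta>" for k
    proof (rule cheb_coeff_cong_AE)
      show "AE t in lborel. \<bar>t\<bar> < r \<longrightarrow> w (t *\<^sub>R ?\<theta>) = w' (t *\<^sub>R ?\<theta>)"
        using elim(1)
      proof eventually_elim
        case (elim t)
        have nt: "norm (t *\<^sub>R ?\<theta>) = \<bar>t\<bar>" using \<open>\<xi> \<noteq> 0\<close> by (simp add: abs_mult)
        show ?case
        proof
          assume "\<bar>t\<bar> < r"
          then have "t *\<^sub>R ?\<theta> \<in> ball 0 r" using nt by (simp only: mem_ball dist_0_norm)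
          then show "w (t *\<^sub>R ?\<theta>) = w' (t *\<^sub>R ?\<theta>)" using elim E(2) by blast
        qed
      qed
    qed simp
    then show ?case using elim(2) by (simp add: extrapolation_def)
  qed
qed

section \<open>Error of the extrapolation\<close>

text \<open>
The difference is the average over \<open>x\<close> of the remainders for the frequencies \<open>a x = r (\<theta> \<bullet> x)\<close>, which are
at most \<open>r \<bar>x\<bar>\<close> in modulus. The factor \<open>exp (\<bar>a x\<bar> \<rho> / 2)\<close> is then at most the weight of \<open>Q_fun\<close> at \<open>r \<rho> / 2\<close>.
\<close>
lemma fourier_chebyshev_remainder:
  fixes v :: "'a::euclidean_space \<Rightarrow> complex"
  assumes r: "r > 0" and \<rho>: "\<rho> \<ge> 1" and n: "n > 0" and v: "integrable lborel v"
    and \<xi>: "norm \<xi> \<ge> r"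
    and int: "integrable lborel (\<lambda>x. exp (r * \<rho> / 2 * norm x) * norm (v x))"
    and M: "1 / (2 * pi) ^ DIM('a) * (\<integral>x. exp (r * \<rho> / 2 * norm x) * norm (v x) \<partial>lborel) \<le> M"
  shows "norm (fourier v \<xi> - (\<Sum>k<n. cheb_coeff r (fourier v) k (\<xi> /\<^sub>R norm \<xi>) * of_real (poly (chebyshev_poly k) (norm \<xi> / r))))
     \<le> (2 * (norm \<xi> / r) / \<rho>) ^ n * M"
proof -
  have [measurable]: "v \<in> borel_measurable borel" using v by auto
  have [measurable]: "bessel k \<in> borel_measurable borel" for k
    using continuous_bessel by (rule borel_measurable_continuous_onI)
  define s where "s = norm \<xi> / r"
  define \<theta> where "\<theta> = \<xi> /\<^sub>R norm \<xi>"
  have s: "s \<ge> 1" using r \<xi> by (simp add: s_def)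
  have \<xi>0: "norm \<xi> > 0" using r \<xi> by linarith
  then have \<theta>: "norm \<theta> = 1" by (simp add: \<theta>_def)
  let ?c = "complex_of_real (1 / (2 * pi) ^ DIM('a))"
  define a where "a x = r * (\<theta> \<bullet> x)" for x
  have [measurable]: "a \<in> borel_measurable borel" unfolding a_def[abs_def] by measurable
  have ax: "\<bar>a x\<bar> \<le> r * norm x" for x
    using Cauchy_Schwarz_ineq2[of \<theta> x] r \<theta> by (simp add: a_def abs_mult)
  have as: "a x * s = \<xi> \<bullet> x" for x using r \<xi>0 by (simp add: a_def s_def \<theta>_def)
  let ?T = "\<lambda>k. complex_of_real (poly (chebyshev_poly k) s)"
  have bi: "integrable lborel (\<lambda>x. of_real (cheb_mult k) * bessel k (a x) * v x)" for k
  proof (rule Bochner_Integration.integrable_bound)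
    show "integrable lborel (\<lambda>x. 2 * norm (v x))" using v by simp
    show "AE x in lborel. norm (of_real (cheb_mult k) * bessel k (a x) * v x) \<le> norm (2 * norm (v x))"
    proof (intro AE_I2)
      fix x
      have "norm (of_real (cheb_mult k) * bessel k (a x)) \<le> 2 * 1"
        using norm_bessel_le_1[of k "a x"] unfolding norm_mult by (intro mult_mono) (auto simp: cheb_mult_def)
      from mult_right_mono[OF this norm_ge_zero[of "v x"]]
      show "norm (of_real (cheb_mult k) * bessel k (a x) * v x) \<le> norm (2 * norm (v x))"
        by (simp add: norm_mult)
    qed
  qed measurable
  have ei: "integrable lborel (\<lambda>x. exp (\<i> * of_real (\<xi> \<bullet> x)) * v x)"
    by (rule Bochner_Integration.integrable_bound[OF v]) (auto simp: norm_mult)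
  have ji: "integrable lborel (\<lambda>x. jacobi_anger n s (a x) * v x)"
    and js: "(\<integral>x. jacobi_anger n s (a x) * v x \<partial>lborel) = (\<Sum>k<n. (\<integral>x. of_real (cheb_mult k) * bessel k (a x) * v x \<partial>lborel) * ?T k)"
  proof -
    have eq: "(\<lambda>x. jacobi_anger n s (a x) * v x) = (\<lambda>x. \<Sum>k<n. of_real (cheb_mult k) * bessel k (a x) * v x * ?T k)"
      by (simp add: jacobi_anger_def sum_distrib_left sum_distrib_right mult_ac)
    show "integrable lborel (\<lambda>x. jacobi_anger n s (a x) * v x)"
      unfolding eq by (intro Bochner_Integration.integrable_sum integrable_mult_left bi)
    show "(\<integral>x. jacobi_anger n s (a x) * v x \<partial>lborel) = (\<Sum>k<n. (\<integral>x. of_real (cheb_mult k) * bessel k (a x) * v x \<partial>lborel) * ?T k)"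
      unfolding eq by (subst Bochner_Integration.integral_sum) (auto intro!: integrable_mult_left bi)
  qed
  have "(\<Sum>k<n. cheb_coeff r (fourier v) k \<theta> * ?T k) = ?c * (\<integral>x. jacobi_anger n s (a x) * v x \<partial>lborel)"
    unfolding js cheb_coeff_fourier[OF r v] a_def[symmetric] sum_distrib_left by (simp only: mult.assoc)
  then have "fourier v \<xi> - (\<Sum>k<n. cheb_coeff r (fourier v) k \<theta> * ?T k)
     = ?c * (\<integral>x. (exp (\<i> * of_real (a x * s)) - jacobi_anger n s (a x)) * v x \<partial>lborel)"
    unfolding as by (simp add: fourier_eq_lborel left_diff_distrib Bochner_Integration.integral_diff[OF ei ji] right_diff_distrib diff_divide_distrib)
  also have "norm \<dots> = 1 / (2 * pi) ^ DIM('a) * norm (\<integral>x. (exp (\<i> * of_real (a x * s)) - jacobi_anger n s (a x)) * v x \<partial>lborel)"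
    by (simp add: norm_mult norm_divide norm_power)
  also have "\<dots> \<le> 1 / (2 * pi) ^ DIM('a) * (\<integral>x. (2 * s / \<rho>) ^ n * (exp (r * \<rho> / 2 * norm x) * norm (v x)) \<partial>lborel)"
  proof (intro mult_left_mono Bochner_Integration.integral_norm_bound_integral)
    show "integrable lborel (\<lambda>x. (exp (\<i> * of_real (a x * s)) - jacobi_anger n s (a x)) * v x)"
      using Bochner_Integration.integrable_diff[OF ei ji] unfolding as left_diff_distrib .
    show "integrable lborel (\<lambda>x. (2 * s / \<rho>) ^ n * (exp (r * \<rho> / 2 * norm x) * norm (v x)))"
      using int by (rule integrable_mult_right)
    fix x
    have "\<bar>a x\<bar> * \<rho> / 2 \<le> r * \<rho> / 2 * norm x"
      using mult_right_mono[OF ax[of x], of "\<rho> / 2"] \<rho> by (simp add: mult_ac)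
    then have "norm (exp (\<i> * of_real (a x * s)) - jacobi_anger n s (a x)) \<le> (2 * s / \<rho>) ^ n * exp (r * \<rho> / 2 * norm x)"
      using s \<rho> by (intro order_trans[OF jacobi_anger_remainder[OF s \<rho> n]] mult_left_mono) auto
    from mult_right_mono[OF this norm_ge_zero]
    show "norm ((exp (\<i> * of_real (a x * s)) - jacobi_anger n s (a x)) * v x) \<le> (2 * s / \<rho>) ^ n * (exp (r * \<rho> / 2 * norm x) * norm (v x))"
      by (simp only: norm_mult mult.assoc)
  qed simp
  also have "\<dots> = (2 * s / \<rho>) ^ n * (1 / (2 * pi) ^ DIM('a) * (\<integral>x. exp (r * \<rho> / 2 * norm x) * norm (v x) \<partial>lborel))"
    by simp
  also have "\<dots> \<le> (2 * s / \<rho>) ^ n * M"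
    using s \<rho> M by (intro mult_left_mono) auto
  finally show ?thesis by (simp only: s_def \<theta>_def)
qed

lemma chebyshev_noise_sum:
  assumes s: "s \<ge> 1" and n: "n > 0"
  shows "(\<Sum>k<n. cheb_mult k * poly (chebyshev_poly k) s) \<le> (2 * s) ^ n"
proof -
  have "(\<Sum>k<Suc m. cheb_mult k * poly (chebyshev_poly k) s) \<le> (2 * s) ^ Suc m" for m
  proof (induction m)
    case 0
    then show ?case using s by (simp add: cheb_mult_def chebyshev_0)
  next
    case (Suc m)
    have "(\<Sum>k<Suc (Suc m). cheb_mult k * poly (chebyshev_poly k) s)
        = (\<Sum>k<Suc m. cheb_mult k * poly (chebyshev_poly k) s) + 2 * poly (chebyshev_poly (Suc m)) s"
      by (simp add: cheb_mult_def)
    also have "\<dots> \<le> 2 * (2 * s) ^ Suc m"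
      using Suc chebyshev_Suc_le[OF s, of m] by linarith
    also have "\<dots> \<le> (2 * s) * (2 * s) ^ Suc m"
      using s by (intro mult_right_mono) auto
    finally show ?case by simp
  qed
  then show ?thesis using n by (cases n) auto
qed

lemma extrapolation_error:
  fixes v w :: "'a::euclidean_space \<Rightarrow> complex"
  assumes r: "r > 0" and \<rho>: "\<rho> \<ge> 1" and n: "n > 0" and v: "integrable lborel v"
    and \<xi>: "norm \<xi> \<ge> r"
    and int: "integrable lborel (\<lambda>x. exp (r * \<rho> / 2 * norm x) * norm (v x))"
    and M: "1 / (2 * pi) ^ DIM('a) * (\<integral>x. exp (r * \<rho> / 2 * norm x) * norm (v x) \<partial>lborel) \<le> M"
    and w: "w \<in> borel_measurable borel" and le: "\<And>x. norm (w x - fourier v x) \<le> \<delta>"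
    and K: "\<And>x. norm (fourier v x) \<le> K"
  shows "norm (fourier v \<xi> - (\<Sum>k<n. cheb_coeff r w k (\<xi> /\<^sub>R norm \<xi>) * of_real (poly (chebyshev_poly k) (norm \<xi> / r))))
     \<le> (2 * (norm \<xi> / r) / \<rho>) ^ n * M + (2 * (norm \<xi> / r)) ^ n * \<delta>"
proof -
  let ?s = "norm \<xi> / r" and ?\<theta> = "\<xi> /\<^sub>R norm \<xi>"
  let ?T = "\<lambda>k. complex_of_real (poly (chebyshev_poly k) ?s)"
  have s: "?s \<ge> 1" using r \<xi> by simp
  have \<delta>: "\<delta> \<ge> 0" using order_trans[OF norm_ge_zero le] .
  have f: "fourier v \<in> borel_measurable borel"
    using continuous_fourier[OF v] by (rule borel_measurable_continuous_onI)
  have wK: "norm (w x) \<le> K + \<delta>" for x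
    using norm_triangle_ineq[of "fourier v x" "w x - fourier v x"] K[of x] le[of x] by simp
  have c: "norm (cheb_coeff r (fourier v) k ?\<theta> - cheb_coeff r w k ?\<theta>) \<le> cheb_mult k * \<delta>" for k
  proof (rule cheb_coeff_stable[OF r f w])
    show "norm (fourier v x) \<le> K + \<delta>" for x using K[of x] \<delta> by simp
    show "norm (fourier v x - w x) \<le> \<delta>" for x using le[of x] by (simp add: norm_minus_commute)
  qed (rule wK)
  have "norm ((\<Sum>k<n. cheb_coeff r (fourier v) k ?\<theta> * ?T k) - (\<Sum>k<n. cheb_coeff r w k ?\<theta> * ?T k))
     = norm (\<Sum>k<n. (cheb_coeff r (fourier v) k ?\<theta> - cheb_coeff r w k ?\<theta>) * ?T k)"
    by (simp add: sum_subtractf left_diff_distrib)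
  also have "\<dots> \<le> (\<Sum>k<n. cheb_mult k * poly (chebyshev_poly k) ?s * \<delta>)"
  proof (rule order_trans[OF norm_sum], rule sum_mono)
    fix k
    have "norm (?T k) = poly (chebyshev_poly k) ?s"
      using chebyshev_mono_index[OF s, of k] by simp
    then show "norm ((cheb_coeff r (fourier v) k ?\<theta> - cheb_coeff r w k ?\<theta>) * ?T k) \<le> cheb_mult k * poly (chebyshev_poly k) ?s * \<delta>"
      using mult_right_mono[OF c norm_ge_zero[of "?T k"], of k] by (simp add: norm_mult mult_ac)
  qed
  also have "\<dots> \<le> (2 * ?s) ^ n * \<delta>"
    unfolding sum_distrib_right[symmetric] by (intro mult_right_mono chebyshev_noise_sum[OF s n] \<delta>)
  finally have noise: "norm ((\<Sum>k<n. cheb_coeff r (fourier v) k ?\<theta> * ?T k) - (\<Sum>k<n. cheb_coeff r w k ?\<theta> * ?T k)) \<le> (2 * ?s) ^ n * \<delta>" .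
  show ?thesis
    using norm_triangle_le[OF add_mono[OF fourier_chebyshev_remainder[OF r \<rho> n v \<xi> int M] noise]] by simp
qed

section \<open>Integrals of radial powers\<close>

text \<open>
Layer-cake argument: \<open>\<bar>x\<bar>\<^sup>-\<^sup>m\<close> is the integral of \<open>g t = m t\<^sup>-\<^sup>m\<^sup>-\<^sup>1\<close> over \<open>t \<ge> \<bar>x\<bar>\<close>. After exchanging the
integrals, the inner one is the volume of a spherical shell, and the outer one has an explicit
antiderivative.
\<close>
lemma nn_integral_radial_tail:
  fixes R m :: real
  assumes R: "R > 0" and m: "m > real DIM('a::euclidean_space)"
  shows "(\<integral>\<^sup>+x. ennreal (norm x powr (- m)) * indicator {x. R \<le> norm x} x \<partial>(lborel :: 'a measure))
    = ennreal (sphere_area DIM('a) / (m - real DIM('a)) * R powr (real DIM('a) - m))"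
proof -
  let ?d = "DIM('a)" and ?V = "unit_ball_vol (real DIM('a))"
  define g where "g t = m * t powr (- m - 1)" for t :: real
  have [measurable]: "g \<in> borel_measurable borel" unfolding g_def[abs_def] by measurable
  have m0: "m > 0" using m by (rule le_less_trans[rotated]) simp
  have g0: "g t \<ge> 0" for t using m0 by (simp add: g_def)
  have layer: "ennreal (a powr (- m)) = (\<integral>\<^sup>+t. ennreal (g t) * indicator {a..} t \<partial>lborel)" if a: "a > 0" for a
  proof -
    have lim: "((\<lambda>t. - (t powr (- m))) \<longlongrightarrow> - 0) at_top"
      using m0 by (intro tendsto_minus tendsto_neg_powr filterlim_ident) auto
    have "(\<integral>\<^sup>+t. ennreal (g t) * indicator {a..} t \<partial>lborel) = ennreal (- 0 - (- (a powr (- m))))"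
      by (rule nn_integral_FTC_atLeast[OF _ _ g0 lim])
         (use a in \<open>auto simp: g_def intro!: derivative_eq_intros\<close>)
    then show ?thesis by simp
  qed
  have shell: "emeasure lborel {x::'a. R \<le> norm x \<and> norm x \<le> t} = ennreal (?V * (t ^ ?d - R ^ ?d))" if t: "t \<ge> R" for t
  proof -
    have "{x::'a. R \<le> norm x \<and> norm x \<le> t} = cball 0 t - ball 0 R" by auto
    moreover have "emeasure lborel (cball 0 t - ball (0::'a) R) = emeasure lborel (cball (0::'a) t) - emeasure lborel (ball (0::'a) R)"
      using t R by (intro emeasure_Diff) (auto simp: emeasure_ball)
    ultimately show ?thesis
      using t R by (simp add: emeasure_ball emeasure_cball ennreal_minus unit_ball_vol_nonneg right_diff_distrib)
  qed
  have "(\<integral>\<^sup>+x. ennreal (norm x powr (- m)) * indicator {x. R \<le> norm x} x \<partial>(lborel :: 'a measure))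
     = (\<integral>\<^sup>+x. (\<integral>\<^sup>+t. ennreal (g t) * indicator {norm x..} t * indicator {x. R \<le> norm x} x \<partial>lborel) \<partial>(lborel :: 'a measure))"
  proof (intro nn_integral_cong)
    fix x :: 'a
    show "ennreal (norm x powr (- m)) * indicator {x. R \<le> norm x} x
      = (\<integral>\<^sup>+t. ennreal (g t) * indicator {norm x..} t * indicator {x. R \<le> norm x} x \<partial>lborel)"
    proof (cases "R \<le> norm x")
      case True
      then have "norm x > 0" using R by linarith
      from layer[OF this] True show ?thesis by simp
    qed simp
  qed
  also have "\<dots> = (\<integral>\<^sup>+x. (\<integral>\<^sup>+t. ennreal (g t) * indicator {p. R \<le> norm (fst p) \<and> norm (fst p) \<le> snd p} (x, t) \<partial>lborel) \<partial>(lborel :: 'a measure))"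
    by (intro nn_integral_cong) (auto split: split_indicator)
  also have "\<dots> = (\<integral>\<^sup>+t. (\<integral>\<^sup>+x. ennreal (g t) * indicator {p. R \<le> norm (fst p) \<and> norm (fst p) \<le> snd p} (x, t) \<partial>(lborel :: 'a measure)) \<partial>lborel)"
  proof (rule lborel_pair.Fubini'[symmetric])
    have "{p \<in> space (lborel \<Otimes>\<^sub>M lborel). R \<le> norm (fst p :: 'a) \<and> norm (fst p) \<le> (snd p :: real)} \<in> sets (lborel \<Otimes>\<^sub>M lborel)"
      by measurable
    then have [measurable]: "{p. R \<le> norm (fst p :: 'a) \<and> norm (fst p) \<le> (snd p :: real)} \<in> sets (borel \<Otimes>\<^sub>M borel)"
      by (simp add: space_pair_measure)
    show "(\<lambda>(x :: 'a, t). ennreal (g t) * indicator {p. R \<le> norm (fst p) \<and> norm (fst p) \<le> snd p} (x, t))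
      \<in> borel_measurable (lborel \<Otimes>\<^sub>M lborel)"
      by measurable
  qed
  also have "\<dots> = (\<integral>\<^sup>+t. ennreal (g t) * emeasure lborel {x::'a. R \<le> norm x \<and> norm x \<le> t} \<partial>lborel)"
  proof (intro nn_integral_cong)
    fix t :: real
    have "(\<integral>\<^sup>+x. ennreal (g t) * indicator {p. R \<le> norm (fst p) \<and> norm (fst p) \<le> snd p} (x, t) \<partial>(lborel :: 'a measure))
      = (\<integral>\<^sup>+x. ennreal (g t) * indicator {x. R \<le> norm x \<and> norm x \<le> t} x \<partial>(lborel :: 'a measure))"
      by (intro nn_integral_cong) (auto split: split_indicator)
    then show "(\<integral>\<^sup>+x. ennreal (g t) * indicator {p. R \<le> norm (fst p) \<and> norm (fst p) \<le> snd p} (x, t) \<partial>(lborel :: 'a measure))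
      = ennreal (g t) * emeasure lborel {x::'a. R \<le> norm x \<and> norm x \<le> t}"
      by (simp add: nn_integral_cmult_indicator)
  qed
  also have "\<dots> = (\<integral>\<^sup>+t. ennreal (g t * (?V * (t ^ ?d - R ^ ?d))) * indicator {R..} t \<partial>lborel)"
  proof (intro nn_integral_cong)
    fix t :: real
    show "ennreal (g t) * emeasure lborel {x::'a. R \<le> norm x \<and> norm x \<le> t}
       = ennreal (g t * (?V * (t ^ ?d - R ^ ?d))) * indicator {R..} t"
    proof (cases "t \<ge> R")
      case True
      then show ?thesis
        using g0[of t] by (simp add: shell ennreal_mult')
    next
      case False
      then have e: "{x::'a. R \<le> norm x \<and> norm x \<le> t} = {}" by auto
      show ?thesis unfolding e using False by simp
    qed
  qed
  also have "\<dots> = ennreal (0 - ?V * (m / (?d - m) * R powr (?d - m) + R ^ ?d * R powr (- m)))"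
  proof (rule nn_integral_FTC_atLeast[where F="\<lambda>t. ?V * (m / (?d - m) * t powr (?d - m) + R ^ ?d * t powr (- m))"])
    have "((\<lambda>t. ?V * (m / (?d - m) * t powr (?d - m) + R ^ ?d * t powr (- m))) \<longlongrightarrow> ?V * (m / (?d - m) * 0 + R ^ ?d * 0)) at_top"
      using m m0 by (intro tendsto_intros tendsto_neg_powr filterlim_ident) auto
    then show "((\<lambda>t. ?V * (m / (?d - m) * t powr (?d - m) + R ^ ?d * t powr (- m))) \<longlongrightarrow> 0) at_top" by simp
    fix t assume t: "R \<le> t"
    then have t0: "t > 0" using R by simp
    show "0 \<le> g t * (?V * (t ^ ?d - R ^ ?d))"
      using g0[of t] t R by (intro mult_nonneg_nonneg unit_ball_vol_nonneg) (auto intro: power_mono)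
    have cancel: "m / (?d - m) * ((?d - m) * X) = m * X" for X using m by simp
    have "((\<lambda>t. ?V * (m / (?d - m) * t powr (?d - m) + R ^ ?d * t powr (- m))) has_real_derivative
        ?V * (m / (?d - m) * ((?d - m) * t powr (?d - m - 1)) + R ^ ?d * (- m * t powr (- m - 1)))) (at t)"
      using t0 by (intro derivative_eq_intros refl | simp)+
    also have "t powr (?d - m - 1) = t ^ ?d * t powr (- m - 1)"
      using t0 by (simp add: powr_realpow[symmetric] powr_add[symmetric] algebra_simps)
    finally show "((\<lambda>t. ?V * (m / (?d - m) * t powr (?d - m) + R ^ ?d * t powr (- m))) has_real_derivative g t * (?V * (t ^ ?d - R ^ ?d))) (at t)"
      unfolding cancel by (simp add: g_def algebra_simps)
  qed measurable
  also have "0 - ?V * (m / (?d - m) * R powr (?d - m) + R ^ ?d * R powr (- m)) = sphere_area ?d / (m - ?d) * R powr (?d - m)"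
  proof -
    have "R ^ ?d * R powr (- m) = R powr (?d - m)"
      using R by (simp add: powr_realpow[symmetric] powr_add[symmetric])
    moreover have "sphere_area ?d = ?d * ?V"
      by (simp add: sphere_area_def unit_ball_vol_def)
    moreover have "0 - V * (m / (k - m) * X + X) = k * V / (m - k) * X" if "m > k" for V X k :: real
      using that by (simp add: field_simps)
    ultimately show ?thesis using m by simp
  qed
  finally show ?thesis .
qed

section \<open>Choice of the parameters\<close>

lemma tau_alpha:
  fixes \<nu> \<alpha> \<tau> :: real
  assumes "\<nu> \<ge> 1" "0 \<le> \<alpha>" "\<alpha> \<le> 1" and \<tau>: "\<tau> = 1 - sqrt (1 - (1 - \<alpha>) / \<nu>)"
  shows "0 \<le> \<tau>" "\<tau> \<le> 1" "\<nu> * \<tau> * (2 - \<tau>) = 1 - \<alpha>"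
proof -
  define q where "q = sqrt (1 - (1 - \<alpha>) / \<nu>)"
  have "0 \<le> (1 - \<alpha>) / \<nu>" "(1 - \<alpha>) / \<nu> \<le> 1" using assms by (auto simp: field_simps)
  then have q: "0 \<le> q" "q \<le> 1" "q\<^sup>2 = 1 - (1 - \<alpha>) / \<nu>" by (auto simp: q_def)
  have t: "\<tau> = 1 - q" using \<tau> by (simp add: q_def)
  show "0 \<le> \<tau>" "\<tau> \<le> 1" using q t by auto
  have "\<nu> * \<tau> * (2 - \<tau>) = \<nu> * (1 - q\<^sup>2)" by (simp add: t power2_eq_square algebra_simps)
  also have "\<dots> = 1 - \<alpha>" using q(3) assms by simp
  finally show "\<nu> * \<tau> * (2 - \<tau>) = 1 - \<alpha>" .
qed

lemma L_par_ge_1: "L_par N \<sigma> r \<nu> \<tau> \<delta> \<ge> 1"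
  by (simp add: L_par_def)

text \<open>
With \<open>y = ln (N / \<delta>)\<close>, the parameter \<open>\<rho>\<close> is determined by \<open>\<sigma> (r \<rho> / 2)\<^sup>\<nu> = (1 - \<tau>) y\<close>, that is, the growth
factor \<open>exp (\<sigma> (r \<rho> / 2)\<^sup>\<nu>)\<close> equals \<open>(N / \<delta>)\<^sup>1\<^sup>-\<^sup>\<tau>\<close>. Since \<open>2 L > 2\<close> excludes that the maximum in
\<open>L_par\<close> is \<open>1\<close>, one has \<open>2 L = (\<rho> / 2)\<^sup>\<tau>\<^sup>\<nu>\<close>, and the denominator in \<open>n_par\<close> is precisely \<open>ln \<rho>\<close>. So
\<open>n\<close> is the least integer with \<open>\<rho>\<^sup>n \<ge> (N / \<delta>)\<^sup>2\<^sup>-\<^sup>\<tau>\<close>. This makes the truncation error no larger than the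
noise \<open>(2 L)\<^sup>n \<delta>\<close>. In turn \<open>2 L \<le> \<rho>\<^sup>\<tau>\<^sup>\<nu>\<close> bounds \<open>(2 L)\<^sup>n\<^sup>-\<^sup>1\<close> by \<open>(N / \<delta>)\<close> to the power \<open>\<tau> \<nu> (2 - \<tau>) = 1 - \<alpha>\<close>.
\<close>
lemma parameter_choice:
  fixes N \<sigma> r \<nu> \<tau> \<delta> \<alpha> :: real
  assumes \<delta>: "0 < \<delta>" "\<delta> < N" and \<sigma>: "\<sigma> > 0" and r: "r > 0" and \<nu>: "\<nu> \<ge> 1"
    and \<tau>: "0 \<le> \<tau>" "\<tau> \<le> 1" and \<alpha>: "\<nu> * \<tau> * (2 - \<tau>) = 1 - \<alpha>"
    and L: "L_par N \<sigma> r \<nu> \<tau> \<delta> > 1"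
  defines "L \<equiv> L_par N \<sigma> r \<nu> \<tau> \<delta>" and "n \<equiv> n_par N \<sigma> r \<nu> \<tau> \<delta>"
  obtains \<rho> where "\<rho> \<ge> 1" "n > 0" "(2 * L) ^ n * \<delta> \<le> 2 * L * N powr (1 - \<alpha>) * \<delta> powr \<alpha>"
    "(2 * L / \<rho>) ^ n * (N * exp (\<sigma> * (r * \<rho> / 2) powr \<nu>)) \<le> (2 * L) ^ n * \<delta>"
proof
  define y where "y = ln (N / \<delta>)"
  define Y where "Y = (1 - \<tau>) * y / (\<sigma> * r powr \<nu>)"
  define \<rho> where "\<rho> = 2 * Y powr (1 / \<nu>)"
  have y: "y > 0" using \<delta> by (simp add: y_def)
  have ey: "exp y = N / \<delta>" using \<delta> by (simp add: y_def)
  have Y0: "Y \<ge> 0" using y \<tau> \<sigma> r by (simp add: Y_def)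
  have L2: "2 * L = Y powr \<tau>" using L unfolding L_def L_par_def Y_def y_def by linarith
  have Yt: "Y powr \<tau> > 2" using L L2 by (simp add: L_def)
  have Y: "Y > 1"
  proof (rule ccontr)
    assume "\<not> Y > 1"
    then have "Y powr \<tau> \<le> 1" using powr_mono2[of \<tau> Y 1] \<tau> Y0 by simp
    with Yt show False by simp
  qed
  have \<tau>0: "\<tau> > 0" using Yt Y \<tau> by (cases "\<tau> = 0") auto
  have lnY: "ln Y > 0" using Y by simp
  have ln2L: "ln (2 * L) = \<tau> * ln Y" unfolding L2 using Y by (simp add: ln_powr)
  have ln\<rho>: "ln \<rho> = ln 2 + ln Y / \<nu>" unfolding \<rho>_def using Y \<nu> by (simp add: ln_mult ln_powr)
  have ln\<rho>0: "ln \<rho> > 0" unfolding ln\<rho> using lnY \<nu> by (intro add_pos_pos) auto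
  have "Y powr (1 / \<nu>) \<ge> 1" using Y \<nu> by (intro ge_one_powr_ge_zero) auto
  then show \<rho>1: "\<rho> \<ge> 1" unfolding \<rho>_def by simp
  define z where "z = (2 - \<tau>) * y / ln \<rho>"
  have z: "z > 0" using \<tau> y ln\<rho>0 by (simp add: z_def)
  have n: "n = nat \<lceil>z\<rceil>"
  proof -
    have "ln 2 + 1 / (\<tau> * \<nu>) * ln (2 * L) = ln \<rho>"
      unfolding ln\<rho> ln2L using \<tau>0 \<nu> by simp
    then show ?thesis using \<tau>0 unfolding n_def n_par_def z_def y_def L_def by simp
  qed
  show "n > 0" using z by (simp add: n)
  have nz: "z \<le> real n" "real n \<le> z + 1" using z unfolding n by linarith+
  have pw: "x ^ k = exp (real k * ln x)" if "x > 0" for x :: real and k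
    using that by (simp add: exp_of_nat_mult)
  have L0: "2 * L > 1" using L by (simp add: L_def)
  have "(2 * L) ^ n = exp (real n * ln (2 * L))" using L0 by (intro pw) simp
  also have "\<dots> \<le> exp ((z + 1) * ln (2 * L))" using nz L0 by (simp add: mult_right_mono)
  also have "\<dots> = 2 * L * exp (z * ln (2 * L))" using L0 by (simp add: distrib_right exp_add)
  also have "z * ln (2 * L) \<le> (1 - \<alpha>) * y"
  proof -
    have "ln Y \<le> \<nu> * ln \<rho>" unfolding ln\<rho> using \<nu> by (simp add: field_simps)
    then have "(2 - \<tau>) * y * \<tau> * ln Y \<le> (2 - \<tau>) * y * \<tau> * (\<nu> * ln \<rho>)"
      using \<tau> y by (intro mult_left_mono) auto
    then have "z * ln (2 * L) \<le> (\<nu> * \<tau> * (2 - \<tau>)) * y"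
      unfolding z_def ln2L using ln\<rho>0 by (simp add: field_simps)
    then show ?thesis unfolding \<alpha> .
  qed
  finally have "(2 * L) ^ n \<le> 2 * L * exp ((1 - \<alpha>) * y)" using L0 by simp
  then have le: "(2 * L) ^ n * \<delta> \<le> 2 * L * (exp ((1 - \<alpha>) * y) * \<delta>)"
    using \<delta> mult_right_mono by (fastforce simp: mult.assoc)
  have "exp ((1 - \<alpha>) * y) * \<delta> = N powr (1 - \<alpha>) * \<delta> powr \<alpha>"
  proof -
    have "exp ((1 - \<alpha>) * y) = (N / \<delta>) powr (1 - \<alpha>)" using \<delta> by (simp add: powr_def y_def)
    also have "\<dots> = N powr (1 - \<alpha>) / \<delta> powr (1 - \<alpha>)" using \<delta> by (simp add: powr_divide)
    also have "\<delta> powr (1 - \<alpha>) = \<delta> / \<delta> powr \<alpha>" using \<delta> by (simp add: powr_diff)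
    finally show ?thesis using \<delta> by simp
  qed
  with le show "(2 * L) ^ n * \<delta> \<le> 2 * L * N powr (1 - \<alpha>) * \<delta> powr \<alpha>" by (simp only: mult.assoc)
  have "\<sigma> * (r * \<rho> / 2) powr \<nu> = (1 - \<tau>) * y"
  proof -
    have "(r * \<rho> / 2) powr \<nu> = r powr \<nu> * Y"
      using r Y \<nu> by (simp add: \<rho>_def powr_mult powr_powr)
    then show ?thesis using \<sigma> r by (simp add: Y_def)
  qed
  moreover have "exp ((2 - \<tau>) * y) \<le> \<rho> ^ n"
  proof -
    have "(2 - \<tau>) * y = z * ln \<rho>" using ln\<rho>0 by (simp add: z_def)
    also have "\<dots> \<le> real n * ln \<rho>" using nz ln\<rho>0 by (intro mult_right_mono) auto
    finally show ?thesis using \<rho>1 by (subst pw) auto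
  qed
  then have "1 / \<rho> ^ n \<le> 1 / exp ((2 - \<tau>) * y)" by (intro frac_le) auto
  then have "1 / \<rho> ^ n \<le> exp (- ((2 - \<tau>) * y))" by (simp only: exp_minus inverse_eq_divide)
  ultimately have "1 / \<rho> ^ n * (N * exp (\<sigma> * (r * \<rho> / 2) powr \<nu>)) \<le> exp (- ((2 - \<tau>) * y)) * (N * exp ((1 - \<tau>) * y))"
    using \<delta> by (simp only:) (intro mult_right_mono, auto)
  also have "\<dots> = N * exp (- y)" by (simp add: exp_add[symmetric] algebra_simps)
  also have "\<dots> = \<delta>" using \<delta> by (simp add: exp_minus ey)
  finally have "(2 * L) ^ n * (1 / \<rho> ^ n * (N * exp (\<sigma> * (r * \<rho> / 2) powr \<nu>))) \<le> (2 * L) ^ n * \<delta>"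
    using L0 by (intro mult_left_mono) auto
  then show "(2 * L / \<rho>) ^ n * (N * exp (\<sigma> * (r * \<rho> / 2) powr \<nu>)) \<le> (2 * L) ^ n * \<delta>"
    by (simp add: power_divide)
qed

text \<open>
With \<open>y = ln (N / \<delta>)\<close> and \<open>x = ln (3 + 1 / \<delta>)\<close> one has \<open>x \<le> K + y\<close>. The second summand is controlled by
\<open>L \<ge> b x\<^sup>\<tau>\<close>, which holds for different reasons if \<open>y \<ge> K\<close> (where \<open>x \<le> 2 y\<close>) and if \<open>y < K\<close> (where
\<open>x \<le> 2 K\<close> and \<open>L \<ge> 1\<close>); this accounts for the two entries of the minimum \<open>b\<close>. In the first summand
\<open>\<delta>\<^sup>\<alpha>\<close> is a multiple of \<open>exp (- \<alpha> y)\<close>, which beats \<open>(1 + y)\<^sup>P\<close>, the joint growth of \<open>L\<^sup>p\<close> and \<open>x\<^sup>\<tau>\<^sup>q\<close>.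
\<close>
lemma log_rate:
  fixes N \<sigma> r \<nu> \<tau> \<alpha> A B q :: real and p :: nat
  assumes N: "N > 0" and \<sigma>: "\<sigma> > 0" and r: "r > 0" and \<nu>: "\<nu> \<ge> 1"
    and \<tau>: "0 < \<tau>" "\<tau> < 1" and \<alpha>: "0 < \<alpha>" and q: "q > 0" and A: "A \<ge> 0" and B: "B \<ge> 0"
  obtains c where "c > 0" "\<And>\<delta>. 0 < \<delta> \<Longrightarrow> \<delta> < N \<Longrightarrow>
     A * (N powr (1 - \<alpha>) * \<delta> powr \<alpha>) * L_par N \<sigma> r \<nu> \<tau> \<delta> ^ p + B * L_par N \<sigma> r \<nu> \<tau> \<delta> powr (- q)
      \<le> c * ln (3 + 1 / \<delta>) powr (- (\<tau> * q))"
proof -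
  define \<kappa> where "\<kappa> = (1 - \<tau>) / (\<sigma> * r powr \<nu>)"
  define K where "K = ln (3 + 1 / N)"
  define b where "b = min (1 / 2 * (\<kappa> / 2) powr \<tau>) ((2 * K) powr (- \<tau>))"
  define P where "P = real p + \<tau> * q"
  define C1 where "C1 = A * N * (1 + \<kappa>) ^ p * (1 + K) powr (\<tau> * q) * ((P / \<alpha>) powr P * exp \<alpha>)"
  define C2 where "C2 = B * b powr (- q)"
  have \<kappa>: "\<kappa> > 0" using \<tau> \<sigma> r by (simp add: \<kappa>_def)
  have K: "K > 0" using N by (simp add: K_def add_pos_pos)
  have b: "b > 0" using \<kappa> K by (simp add: b_def)
  have \<tau>q: "\<tau> * q > 0" using \<tau> q by simp
  have P: "P > 0" using \<tau>q by (simp add: P_def)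
  show ?thesis
  proof (rule that[of "C1 + C2 + 1"])
    have "C1 \<ge> 0" using A N \<kappa> by (simp add: C1_def)
    moreover have "C2 \<ge> 0" using B by (simp add: C2_def)
    ultimately show "C1 + C2 + 1 > 0" by simp
    fix \<delta> assume \<delta>: "0 < \<delta>" "\<delta> < N"
    define y where "y = ln (N / \<delta>)"
    define x where "x = ln (3 + 1 / \<delta>)"
    define L where "L = L_par N \<sigma> r \<nu> \<tau> \<delta>"
    have y: "y > 0" using \<delta> by (simp add: y_def)
    have x: "x > 0" using \<delta> by (simp add: x_def add_pos_pos)
    have xK: "x \<le> K + y"
    proof -
      have "3 + 1 / \<delta> \<le> (3 + 1 / N) * (N / \<delta>)" using \<delta> by (simp add: field_simps)
      then have "x \<le> ln ((3 + 1 / N) * (N / \<delta>))" unfolding x_def using \<delta> by (simp add: add_pos_pos)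
      also have "\<dots> = K + y" unfolding K_def y_def using \<delta> N by (intro ln_mult_pos) (auto simp: add_pos_pos)
      finally show ?thesis .
    qed
    have Leq: "L = max 1 (1 / 2 * (\<kappa> * y) powr \<tau>)" by (simp add: L_def L_par_def \<kappa>_def y_def)
    have L1: "L \<ge> 1" by (simp add: Leq)
    have Lb: "L \<ge> b * x powr \<tau>"
    proof -
      have xt: "x powr \<tau> \<le> (K + y) powr \<tau>" using xK x \<tau> by (intro powr_mono2) auto
      have "b * (K + y) powr \<tau> \<le> L"
      proof (cases "y \<ge> K")
        case True
        have "b * (K + y) powr \<tau> \<le> (1 / 2 * (\<kappa> / 2) powr \<tau>) * (2 * y) powr \<tau>"
          using True K y \<tau> by (intro mult_mono powr_mono2) (auto simp: b_def)
        also have "\<dots> = 1 / 2 * (\<kappa> * y) powr \<tau>"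
          using \<kappa> y by (simp add: powr_mult[symmetric])
        finally show ?thesis by (simp add: Leq)
      next
        case False
        have "b * (K + y) powr \<tau> \<le> (2 * K) powr (- \<tau>) * (2 * K) powr \<tau>"
          using False K y \<tau> by (intro mult_mono powr_mono2) (auto simp: b_def)
        also have "\<dots> = 1" using K by (simp add: powr_add[symmetric])
        finally show ?thesis using L1 by simp
      qed
      then show ?thesis using b by (intro order_trans[OF mult_left_mono[OF xt]]) auto
    qed
    have second: "B * L powr (- q) \<le> C2 * x powr (- (\<tau> * q))"
    proof -
      have "L powr (- q) \<le> (b * x powr \<tau>) powr (- q)"
        using Lb b x q by (intro powr_mono2') auto
      also have "\<dots> = b powr (- q) * x powr (- (\<tau> * q))"
        using b x by (simp add: powr_mult powr_powr)
      finally show ?thesis using B by (simp add: C2_def mult.assoc mult_left_mono)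
    qed
    have Lu: "L \<le> (1 + \<kappa>) * (1 + y)"
    proof -
      have "(\<kappa> * y) powr \<tau> \<le> (1 + \<kappa> * y) powr \<tau>"
        using \<kappa> y \<tau> by (intro powr_mono2) auto
      also have "\<dots> \<le> (1 + \<kappa> * y) powr 1"
        using \<kappa> y \<tau> by (intro powr_mono) auto
      finally have "(\<kappa> * y) powr \<tau> \<le> 1 + \<kappa> * y" using \<kappa> y by simp
      moreover have "0 \<le> \<kappa> * y" using \<kappa> y by simp
      moreover have "(1 + \<kappa>) * (1 + y) = 1 + \<kappa> * y + \<kappa> + y" by (simp add: algebra_simps)
      ultimately show ?thesis using \<kappa> y unfolding Leq by linarith
    qed
    have decay: "N powr (1 - \<alpha>) * \<delta> powr \<alpha> = N * exp (- \<alpha> * y)"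
    proof -
      have "exp (- \<alpha> * y) = (N / \<delta>) powr (- \<alpha>)" using \<delta> by (simp add: powr_def y_def)
      also have "\<dots> = \<delta> powr \<alpha> / N powr \<alpha>" using \<delta> N by (simp add: powr_divide powr_minus field_simps)
      finally show ?thesis using N by (simp add: powr_diff)
    qed
    \<comment> \<open>From \<open>u \<le> exp u\<close> with \<open>u = \<alpha> (1 + y) / P\<close>, raised to the power \<open>P\<close>.\<close>
    have growth: "(1 + y) powr P \<le> (P / \<alpha>) powr P * exp \<alpha> * exp (\<alpha> * y)"
    proof -
      have "\<alpha> / P * (1 + y) \<le> exp (\<alpha> / P * (1 + y))" using exp_ge_add_one_self[of "\<alpha> / P * (1 + y)"] by linarith
      then have "(\<alpha> / P * (1 + y)) powr P \<le> exp (\<alpha> / P * (1 + y)) powr P"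
        using \<alpha> P y by (intro powr_mono2) auto
      also have "\<dots> = exp (\<alpha> * (1 + y))" using P by (simp add: powr_def)
      also have "\<dots> = exp \<alpha> * exp (\<alpha> * y)" by (simp add: distrib_left exp_add)
      finally have le: "(\<alpha> / P * (1 + y)) powr P \<le> exp \<alpha> * exp (\<alpha> * y)" .
      have "(1 + y) powr P = (P / \<alpha> * (\<alpha> / P * (1 + y))) powr P" using P \<alpha> by simp
      also have "\<dots> = (P / \<alpha>) powr P * (\<alpha> / P * (1 + y)) powr P"
        using P \<alpha> y by (simp only: powr_mult)
      also have "\<dots> \<le> (P / \<alpha>) powr P * (exp \<alpha> * exp (\<alpha> * y))"
        using le by (intro mult_left_mono) auto
      finally show ?thesis by (simp only: mult.assoc)
    qed
    have first: "A * (N powr (1 - \<alpha>) * \<delta> powr \<alpha>) * L ^ p \<le> C1 * x powr (- (\<tau> * q))"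
    proof -
      have xq: "x powr (\<tau> * q) \<le> ((1 + K) * (1 + y)) powr (\<tau> * q)"
      proof (rule powr_mono2)
        have "0 \<le> K * y" using K y by simp
        then show "x \<le> (1 + K) * (1 + y)" using xK by (simp add: algebra_simps)
      qed (use x \<tau>q in auto)
      have "L ^ p * x powr (\<tau> * q) \<le> ((1 + \<kappa>) * (1 + y)) ^ p * ((1 + K) * (1 + y)) powr (\<tau> * q)"
        using Lu L1 xq by (intro mult_mono power_mono) auto
      also have "\<dots> = (1 + \<kappa>) ^ p * (1 + K) powr (\<tau> * q) * ((1 + y) ^ p * (1 + y) powr (\<tau> * q))"
        using K y by (simp add: power_mult_distrib powr_mult)
      also have "(1 + y) ^ p * (1 + y) powr (\<tau> * q) = (1 + y) powr P"
        using y by (simp add: P_def powr_add powr_realpow)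
      also have "(1 + \<kappa>) ^ p * (1 + K) powr (\<tau> * q) * (1 + y) powr P
          \<le> (1 + \<kappa>) ^ p * (1 + K) powr (\<tau> * q) * ((P / \<alpha>) powr P * exp \<alpha> * exp (\<alpha> * y))"
        using growth \<kappa> by (intro mult_left_mono) auto
      finally have "A * (N * exp (- \<alpha> * y)) * (L ^ p * x powr (\<tau> * q))
         \<le> A * (N * exp (- \<alpha> * y)) * ((1 + \<kappa>) ^ p * (1 + K) powr (\<tau> * q) * ((P / \<alpha>) powr P * exp \<alpha> * exp (\<alpha> * y)))"
        using A N by (intro mult_left_mono) auto
      also have "\<dots> = C1 * (exp (- \<alpha> * y) * exp (\<alpha> * y))" by (simp only: C1_def mult_ac)
      also have "\<dots> = C1" by (simp add: exp_add[symmetric])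
      finally show ?thesis unfolding decay using x by (simp add: powr_minus field_simps)
    qed
    have "0 \<le> x powr (- (\<tau> * q))" by simp
    with first second show "A * (N powr (1 - \<alpha>) * \<delta> powr \<alpha>) * L_par N \<sigma> r \<nu> \<tau> \<delta> ^ p + B * L_par N \<sigma> r \<nu> \<tau> \<delta> powr (- q)
      \<le> (C1 + C2 + 1) * ln (3 + 1 / \<delta>) powr (- (\<tau> * q))"
      unfolding L_def[symmetric] x_def[symmetric] distrib_right by linarith
  qed
qed

section \<open>Error of the reconstruction\<close>

lemma radial_tail:
  fixes R m :: real
  assumes R: "R > 0" and m: "m > real DIM('a::euclidean_space)"
  shows "has_bochner_integral (lborel :: 'a measure) (\<lambda>x. norm x powr (- m) * indicator {x. R \<le> norm x} x)
     (sphere_area DIM('a) / (m - real DIM('a)) * R powr (real DIM('a) - m))"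
proof (rule has_bochner_integral_nn_integral)
  have "sphere_area DIM('a) \<ge> 0"
    by (simp add: sphere_area_eq_measure_ball)
  then show "0 \<le> sphere_area DIM('a) / (m - real DIM('a)) * R powr (real DIM('a) - m)"
    using m by simp
  show "(\<integral>\<^sup>+x. ennreal (norm x powr (- m) * indicator {x. R \<le> norm x} x) \<partial>(lborel :: 'a measure))
      = ennreal (sphere_area DIM('a) / (m - real DIM('a)) * R powr (real DIM('a) - m))"
    unfolding nn_integral_radial_tail[OF R m, symmetric]
    by (intro nn_integral_cong) (auto split: split_indicator)
qed auto

lemma lebesgue_measurable_ex_borel:
  fixes f :: "'a::euclidean_space \<Rightarrow> complex"
  assumes f: "f \<in> borel_measurable lebesgue"
  obtains g where "g \<in> borel_measurable borel" "AE x in lborel. f x = g x"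
proof -
  have "(\<lambda>x. Re (f x)) \<in> borel_measurable lebesgue" "(\<lambda>x. Im (f x)) \<in> borel_measurable lebesgue"
    using f by measurable
  from this[THEN completion_ex_borel_measurable_real]
  obtain a b where ab: "a \<in> borel_measurable lborel" "AE x in lborel. Re (f x) = a x"
    "b \<in> borel_measurable lborel" "AE x in lborel. Im (f x) = b x" by auto
  show ?thesis
  proof
    have [measurable]: "a \<in> borel_measurable borel" "b \<in> borel_measurable borel" using ab by auto
    show "(\<lambda>x. Complex (a x) (b x)) \<in> borel_measurable borel" unfolding Complex_eq by measurable
    show "AE x in lborel. f x = Complex (a x) (b x)"
      using ab(2,4) by eventually_elim (simp add: complex_eq_iff)
  qed
qed

lemma AE_le_linfty_norm:
  assumes le: "linfty_norm S f \<le> ereal C" and S: "S \<in> sets lebesgue"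
  shows "AE x in lborel. x \<in> S \<longrightarrow> norm (f x) \<le> C"
proof -
  have "AE x in lebesgue_on S. ereal (norm (f x)) \<le> ereal C"
    using esssup_AE[where M="lebesgue_on S" and f="\<lambda>x. ereal (norm (f x))"]
    by (rule eventually_mono) (rule order_trans[OF _ le[unfolded linfty_norm_def]])
  then have "AE x in lebesgue. x \<in> S \<longrightarrow> norm (f x) \<le> C"
    using S by (subst (asm) AE_restrict_space_iff) auto
  then show ?thesis by (simp add: AE_completion_iff)
qed

lemma linfty_norm_UNIV_le:
  assumes f: "f \<in> borel_measurable lebesgue" and le: "AE x in lborel. norm (f x) \<le> C"
  shows "linfty_norm UNIV f \<le> ereal C"
proof -
  have "AE x in lebesgue. ereal (norm (f x)) \<le> ereal C"
    using le by (auto intro!: AE_completion)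
  then show ?thesis
    unfolding linfty_norm_def lebesgue_on_UNIV_eq using f by (intro esssup_I) auto
qed

lemma fourier_cong_AE:
  fixes v v' :: "'a::euclidean_space \<Rightarrow> complex"
  assumes [measurable]: "v \<in> borel_measurable lebesgue" "v' \<in> borel_measurable lebesgue"
    and ae: "AE x in lborel. v x = v' x"
  shows "fourier v = fourier v'"
proof
  fix \<xi> :: 'a
  have e: "(\<lambda>x. exp (\<i> * complex_of_real (\<xi> \<bullet> x))) \<in> borel_measurable lebesgue"
    by (intro measurable_completion) measurable
  show "fourier v \<xi> = fourier v' \<xi>"
    unfolding fourier_def
    by (intro arg_cong2[where f="(*)"] refl integral_cong_AE borel_measurable_times e assms(1,2))
       (use ae in \<open>auto dest!: AE_completion elim!: eventually_mono\<close>)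
qed

lemma inv_fourier_cong_AE:
  fixes u u' :: "'a::euclidean_space \<Rightarrow> complex"
  assumes u: "u \<in> borel_measurable lebesgue" and ae: "AE x in lborel. u x = u' x"
  shows "inv_fourier u = inv_fourier u'"
proof
  fix x :: 'a
  have ae': "AE x in lebesgue. u x = u' x" using ae by (rule AE_completion)
  have u': "u' \<in> borel_measurable lebesgue" using u ae' by (rule borel_measurable_AE)
  have e: "(\<lambda>\<xi>. exp (- \<i> * complex_of_real (\<xi> \<bullet> x))) \<in> borel_measurable lebesgue"
    by (intro measurable_completion) measurable
  show "inv_fourier u x = inv_fourier u' x"
    unfolding inv_fourier_def
    by (intro integral_cong_AE borel_measurable_times e u u') (use ae' in \<open>auto elim!: eventually_mono\<close>)
qed

lemma Q_fun_bound:
  fixes v :: "'a::euclidean_space \<Rightarrow> complex"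
  assumes [measurable]: "v \<in> borel_measurable borel" and Q: "Q_fun v l \<le> ennreal M" and M: "M \<ge> 0"
  shows "integrable lborel (\<lambda>x. exp (l * norm x) * norm (v x))"
    and "1 / (2 * pi) ^ DIM('a) * (\<integral>x. exp (l * norm x) * norm (v x) \<partial>lborel) \<le> M"
proof -
  let ?c = "1 / (2 * pi) ^ DIM('a)"
  have c: "?c > 0" by simp
  let ?I = "\<integral>\<^sup>+x. ennreal (exp (l * norm x) * norm (v x)) \<partial>lborel"
  have cI: "ennreal ?c * ?I \<le> ennreal M"
    using Q unfolding Q_fun_def by (subst (asm) nn_integral_completion) auto
  have "?I < \<infinity>"
  proof (rule ccontr)
    assume "\<not> ?I < \<infinity>"
    then have "?I = \<infinity>" by (simp add: less_top[symmetric])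
    then have "ennreal ?c * ?I = \<infinity>" using c by (simp add: ennreal_mult_top)
    with cI show False by (simp add: top_unique)
  qed
  then show int: "integrable lborel (\<lambda>x. exp (l * norm x) * norm (v x))"
    by (intro integrableI_bounded) auto
  have "?I = ennreal (\<integral>x. exp (l * norm x) * norm (v x) \<partial>lborel)"
    by (rule nn_integral_eq_integral[OF int]) auto
  then have "ennreal (?c * (\<integral>x. exp (l * norm x) * norm (v x) \<partial>lborel)) \<le> ennreal M"
    using cI c by (simp only: ennreal_mult' less_imp_le)
  then show "?c * (\<integral>x. exp (l * norm x) * norm (v x) \<partial>lborel) \<le> M"
    using M by (simp only: ennreal_le_iff)
qed

lemma Q_fun_cong_AE:
  fixes v v' :: "'a::euclidean_space \<Rightarrow> complex"
  assumes ae: "AE x in lborel. v x = v' x"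
  shows "Q_fun v l = Q_fun v' l"
proof -
  have "AE x in lebesgue. v x = v' x" using ae by (rule AE_completion)
  then show ?thesis
    unfolding Q_fun_def by (intro arg_cong2[where f="(*)"] refl nn_integral_cong_AE) (auto elim!: eventually_mono)
qed

text \<open>
Inside the ball of radius \<open>r\<close> the error is the noise \<open>\<delta> \<le> N\<^sup>1\<^sup>-\<^sup>\<alpha> \<delta>\<^sup>\<alpha>\<close>. Outside, the annulus is empty unless
\<open>L > 1\<close>, and in this case the choice of \<open>n\<close> is effective.
\<close>
lemma extrapolation_error_parameters:
  fixes v w :: "'a::euclidean_space \<Rightarrow> complex"
  assumes \<delta>: "0 < \<delta>" "\<delta> < N" and \<sigma>: "\<sigma> > 0" and r: "r > 0" and \<nu>: "\<nu> \<ge> 1"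
    and \<alpha>01: "0 \<le> \<alpha>" "\<alpha> \<le> 1"
    and \<tau>: "0 \<le> \<tau>" "\<tau> \<le> 1" and \<alpha>: "\<nu> * \<tau> * (2 - \<tau>) = 1 - \<alpha>"
    and v: "integrable lborel v" and Q: "\<forall>l\<ge>0. Q_fun v l \<le> ennreal (N * exp (\<sigma> * l powr \<nu>))"
    and w: "w \<in> borel_measurable borel" and le: "\<And>x. norm (w x - fourier v x) \<le> \<delta>"
    and K: "\<And>x. norm (fourier v x) \<le> K"
    and \<xi>: "norm \<xi> < R_par N \<sigma> r \<nu> \<tau> \<delta>"
  shows "norm (fourier v \<xi> - C_star N \<sigma> r \<nu> \<tau> \<delta> w \<xi>)
     \<le> 8 * L_par N \<sigma> r \<nu> \<tau> \<delta> * (N powr (1 - \<alpha>) * \<delta> powr \<alpha>)"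
proof -
  define L where "L = L_par N \<sigma> r \<nu> \<tau> \<delta>"
  define H where "H = N powr (1 - \<alpha>) * \<delta> powr \<alpha>"
  have [measurable]: "v \<in> borel_measurable borel" using v by auto
  have L1: "L \<ge> 1" unfolding L_def by (rule L_par_ge_1)
  have \<delta>H: "\<delta> \<le> H"
  proof -
    have "\<delta> = \<delta> powr (1 - \<alpha>) * \<delta> powr \<alpha>" using \<delta> by (simp add: powr_add[symmetric])
    also have "\<dots> \<le> H" unfolding H_def using \<delta> \<alpha>01 by (intro mult_right_mono powr_mono2) auto
    finally show ?thesis .
  qed
  show ?thesis
  proof (cases "norm \<xi> < r")
    case True
    then have "C_star N \<sigma> r \<nu> \<tau> \<delta> w \<xi> = w \<xi>" by (simp add: C_star_def extrapolation_def)
    then have "norm (fourier v \<xi> - C_star N \<sigma> r \<nu> \<tau> \<delta> w \<xi>) \<le> \<delta>"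
      using le[of \<xi>] by (simp add: norm_minus_commute)
    also have "\<dots> \<le> H" by (rule \<delta>H)
    also have "\<dots> \<le> 8 * L * H" using L1 \<delta>H \<delta> mult_right_mono[of 1 "8 * L" H] by simp
    finally show ?thesis by (simp only: L_def H_def)
  next
    case False
    let ?s = "norm \<xi> / r"
    have sL: "1 \<le> ?s" "?s \<le> L" using False \<xi> r by (auto simp: R_par_def L_def field_simps)
    have "L > 1"
    proof (rule ccontr)
      assume "\<not> L > 1"
      then show False using \<xi> False r L1 by (simp add: R_par_def L_def)
    qed
    define n where "n = n_par N \<sigma> r \<nu> \<tau> \<delta>"
    obtain \<rho> where \<rho>: "\<rho> \<ge> 1" and n: "n > 0" and noise: "(2 * L) ^ n * \<delta> \<le> 2 * L * N powr (1 - \<alpha>) * \<delta> powr \<alpha>"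
      and trunc: "(2 * L / \<rho>) ^ n * (N * exp (\<sigma> * (r * \<rho> / 2) powr \<nu>)) \<le> (2 * L) ^ n * \<delta>"
      using parameter_choice[OF \<delta> \<sigma> r \<nu> \<tau> \<alpha>] \<open>L > 1\<close> unfolding L_def n_def by blast
    define M where "M = N * exp (\<sigma> * (r * \<rho> / 2) powr \<nu>)"
    have M: "M \<ge> 0" using \<delta> by (simp add: M_def)
    have rho0: "r * \<rho> / 2 \<ge> 0" using r \<rho> by simp
    have "C_star N \<sigma> r \<nu> \<tau> \<delta> w \<xi>
       = (\<Sum>k<n. cheb_coeff r w k (\<xi> /\<^sub>R norm \<xi>) * of_real (poly (chebyshev_poly k) ?s))"
      using False \<xi> by (simp add: C_star_def extrapolation_def n_def)
    then have "norm (fourier v \<xi> - C_star N \<sigma> r \<nu> \<tau> \<delta> w \<xi>) \<le> (2 * ?s / \<rho>) ^ n * M + (2 * ?s) ^ n * \<delta>"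
      using extrapolation_error[OF r \<rho> n v _ Q_fun_bound[OF _ Q[rule_format, OF rho0, folded M_def] M] w le K] False
      by simp
    also have "\<dots> \<le> (2 * L / \<rho>) ^ n * M + (2 * L) ^ n * \<delta>"
      using sL \<rho> M \<delta> r by (intro add_mono mult_right_mono power_mono divide_right_mono) auto
    also have "\<dots> \<le> 4 * L * H" using noise trunc unfolding M_def H_def by (simp add: mult.assoc)
    also have "\<dots> \<le> 8 * L * H" using L1 \<delta>H \<delta> by (intro mult_right_mono) auto
    finally show ?thesis by (simp only: L_def H_def)
  qed
qed

text \<open>
The two summands are the integrals of the error of the transform over the ball of radius \<open>r L\<close>, where
it is at most \<open>E\<close>, and over its complement, where it is \<open>fourier v\<close> and thus controlled by the smoothness
of \<open>v\<close>. The second conclusion provides the measurability of the reconstruction.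
\<close>
lemma synthesis_error:
  fixes v w :: "'a::euclidean_space \<Rightarrow> complex"
  assumes m: "m > real DIM('a)"
    and \<delta>: "0 < \<delta>" "\<delta> < N" and \<sigma>: "\<sigma> > 0" and r: "r > 0" and \<nu>: "\<nu> \<ge> 1"
    and \<alpha>01: "0 \<le> \<alpha>" "\<alpha> \<le> 1"
    and \<tau>: "0 \<le> \<tau>" "\<tau> \<le> 1" and \<alpha>: "\<nu> * \<tau> * (2 - \<tau>) = 1 - \<alpha>"
    and v: "integrable lborel v" and Q: "\<forall>l\<ge>0. Q_fun v l \<le> ennreal (N * exp (\<sigma> * l powr \<nu>))"
    and w: "w \<in> borel_measurable borel" and le: "\<And>x. norm (w x - fourier v x) \<le> \<delta>"
    and \<gamma>: "AE \<xi> in lborel. (1 + (norm \<xi>)\<^sup>2) powr (m / 2) * norm (fourier v \<xi>) \<le> \<gamma>"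
  shows "AE x in lborel. norm (v x - inv_fourier (C_star N \<sigma> r \<nu> \<tau> \<delta> w) x)
     \<le> 8 * sphere_area DIM('a) / real DIM('a) * N powr (1 - \<alpha>) * r ^ DIM('a)
                    * L_par N \<sigma> r \<nu> \<tau> \<delta> ^ (DIM('a) + 1) * \<delta> powr \<alpha>
                  + sphere_area DIM('a) / (m - real DIM('a)) * \<gamma>
                    * r powr (- m + real DIM('a)) * L_par N \<sigma> r \<nu> \<tau> \<delta> powr (- m + real DIM('a))"
    and "continuous_on UNIV (inv_fourier (C_star N \<sigma> r \<nu> \<tau> \<delta> w))"
proof -
  define f where "f = fourier v"
  define C where "C = C_star N \<sigma> r \<nu> \<tau> \<delta> w"
  define L where "L = L_par N \<sigma> r \<nu> \<tau> \<delta>"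
  define R where "R = R_par N \<sigma> r \<nu> \<tau> \<delta>"
  define E where "E = 8 * L * (N powr (1 - \<alpha>) * \<delta> powr \<alpha>)"
  have [measurable]: "v \<in> borel_measurable borel" using v by auto
  have [measurable]: "f \<in> borel_measurable borel"
    unfolding f_def using continuous_fourier[OF v] by (rule borel_measurable_continuous_onI)
  have [measurable]: "C \<in> borel_measurable borel"
    unfolding C_def C_star_def using w by (rule extrapolation_measurable)
  have L1: "L \<ge> 1" unfolding L_def by (rule L_par_ge_1)
  have R: "R = r * L" "R > 0" using L1 r by (auto simp: R_def R_par_def L_def)
  have E0: "E \<ge> 0" using L1 by (simp add: E_def)
  have K: "norm (f \<xi>) \<le> N" for \<xi>
  proof -
    have "1 / (2 * pi) ^ DIM('a) * (\<integral>x. exp (0 * norm x) * norm (v x) \<partial>lborel) \<le> N"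
      using Q[rule_format, of 0] \<delta> by (intro Q_fun_bound) auto
    moreover have "norm (\<integral>x. exp (\<i> * of_real (\<xi> \<bullet> x)) * v x \<partial>lborel) \<le> (\<integral>x. norm (v x) \<partial>lborel)"
      using integral_norm_bound[where M=lborel and f="\<lambda>x. exp (\<i> * of_real (\<xi> \<bullet> x)) * v x"] by (simp add: norm_mult)
    then have "norm (f \<xi>) \<le> 1 / (2 * pi) ^ DIM('a) * (\<integral>x. norm (v x) \<partial>lborel)"
      unfolding f_def fourier_eq_lborel[OF \<open>v \<in> borel_measurable borel\<close>]
      by (simp add: norm_mult norm_divide norm_power divide_right_mono)
    ultimately show ?thesis by simp
  qed
  have near: "norm (f \<xi> - C \<xi>) \<le> E" if "norm \<xi> < R" for \<xi>
    using extrapolation_error_parameters[OF \<delta> \<sigma> r \<nu> \<alpha>01 \<tau> \<alpha> v Q w le K[unfolded f_def] that[unfolded R_def]]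
    unfolding f_def C_def E_def L_def .
  have decay: "AE \<xi> in lborel. norm (f \<xi>) \<le> \<gamma> * norm \<xi> powr (- m)"
    using \<gamma> AE_lborel_singleton[of "0::'a"]
  proof eventually_elim
    case (elim \<xi>)
    have m0: "m > 0" using m by (rule le_less_trans[rotated]) simp
    have "norm \<xi> powr m = ((norm \<xi>)\<^sup>2) powr (m / 2)"
    proof -
      have "norm \<xi> powr 2 = (norm \<xi>)\<^sup>2" using elim by (intro powr_numeral) simp
      then have "((norm \<xi>)\<^sup>2) powr (m / 2) = (norm \<xi> powr 2) powr (m / 2)" by (simp only:)
      then show ?thesis by (simp only: powr_powr) simp
    qed
    also have "\<dots> \<le> (1 + (norm \<xi>)\<^sup>2) powr (m / 2)"
      using m0 by (intro powr_mono2) auto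
    finally have "norm \<xi> powr m * norm (f \<xi>) \<le> \<gamma>"
      using elim(1) mult_right_mono[OF _ norm_ge_zero[of "f \<xi>"]] unfolding f_def by (blast intro: order_trans)
    then show ?case using elim(2) by (simp add: powr_minus divide_simps mult.commute)
  qed
  have far: "f \<xi> - C \<xi> = f \<xi>" if "\<not> norm \<xi> < R" for \<xi>
  proof -
    have "r \<le> R" using R L1 r by simp
    then show ?thesis using that by (simp add: C_def C_star_def extrapolation_def R_def)
  qed
  define T where "T \<rho> \<xi> = norm \<xi> powr (- m) * indicator {\<xi>. \<rho> \<le> norm \<xi>} \<xi>" for \<rho> and \<xi> :: 'a
  have T: "has_bochner_integral lborel (T \<rho>) (sphere_area DIM('a) / (m - real DIM('a)) * \<rho> powr (real DIM('a) - m))"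
    if "\<rho> > 0" for \<rho>
    using radial_tail[OF that m] unfolding T_def .
  have ball: "has_bochner_integral lborel (indicator (ball (0::'a) \<rho>) :: 'a \<Rightarrow> real) (unit_ball_vol (real DIM('a)) * \<rho> ^ DIM('a))"
    if "\<rho> > 0" for \<rho>
    using has_bochner_integral_real_indicator[of "ball (0::'a) \<rho>" lborel] that
    by (simp add: emeasure_ball content_ball measure_def unit_ball_vol_nonneg)
  have dominate: "has_bochner_integral lborel (\<lambda>\<xi>::'a. a * indicator (ball 0 \<rho>) \<xi> + \<gamma> * T \<rho> \<xi>)
     (a * (unit_ball_vol (real DIM('a)) * \<rho> ^ DIM('a)) + \<gamma> * (sphere_area DIM('a) / (m - real DIM('a)) * \<rho> powr (real DIM('a) - m)))"
    if "\<rho> > 0" for \<rho> a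
    by (intro has_bochner_integral_add has_bochner_integral_mult_right ball T that)
  have fi: "integrable lborel f"
  proof (rule Bochner_Integration.integrable_bound)
    show "integrable lborel (\<lambda>\<xi>::'a. N * indicator (ball 0 R) \<xi> + \<gamma> * T R \<xi>)"
      using dominate[OF R(2), of N] by (rule integrable.intros)
    show "AE \<xi> in lborel. norm (f \<xi>) \<le> norm (N * indicator (ball 0 R) \<xi> + \<gamma> * T R \<xi>)"
      using decay
    proof eventually_elim
      case (elim \<xi>)
      then show ?case
        using K[of \<xi>] by (cases "norm \<xi> < R") (auto simp: T_def indicator_def intro: order_trans[OF _ abs_ge_self])
    qed
  qed measurable
  have diff: "AE \<xi> in lborel. norm (f \<xi> - C \<xi>) \<le> E * indicator (ball 0 R) \<xi> + \<gamma> * T R \<xi>"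
    using decay
  proof eventually_elim
    case (elim \<xi>)
    then show ?case
      using near[of \<xi>] far[of \<xi>] by (cases "norm \<xi> < R") (auto simp: T_def indicator_def)
  qed
  note D = dominate[OF R(2), of E]
  have di: "integrable lborel (\<lambda>\<xi>. f \<xi> - C \<xi>)"
  proof (rule Bochner_Integration.integrable_bound)
    show "integrable lborel (\<lambda>\<xi>::'a. E * indicator (ball 0 R) \<xi> + \<gamma> * T R \<xi>)"
      using D by (rule integrable.intros)
    show "AE \<xi> in lborel. norm (f \<xi> - C \<xi>) \<le> norm (E * indicator (ball 0 R) \<xi> + \<gamma> * T R \<xi>)"
      using diff by eventually_elim (auto intro: order_trans[OF _ abs_ge_self])
  qed measurable
  have Ci: "integrable lborel C"
    using Bochner_Integration.integrable_diff[OF fi di] by simp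
  show "continuous_on UNIV (inv_fourier (C_star N \<sigma> r \<nu> \<tau> \<delta> w))"
    using continuous_inv_fourier[OF Ci] unfolding C_def .
  have bound: "norm (inv_fourier f x - inv_fourier C x)
      \<le> E * (unit_ball_vol (real DIM('a)) * R ^ DIM('a)) + \<gamma> * (sphere_area DIM('a) / (m - real DIM('a)) * R powr (real DIM('a) - m))" for x
  proof -
    have e: "integrable lborel (\<lambda>\<xi>. u \<xi> * exp (- \<i> * of_real (\<xi> \<bullet> x)))" if "integrable lborel u" for u :: "'a \<Rightarrow> complex"
    proof -
      have [measurable]: "u \<in> borel_measurable borel" using that by auto
      show ?thesis by (rule Bochner_Integration.integrable_bound[OF that]) (auto simp: norm_mult)
    qed
    have "inv_fourier f x - inv_fourier C x = inv_fourier (\<lambda>\<xi>. f \<xi> - C \<xi>) x"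
      using Bochner_Integration.integral_diff[OF e[OF fi] e[OF Ci]]
      by (simp add: inv_fourier_eq_lborel left_diff_distrib)
    also have "norm \<dots> \<le> (\<integral>\<xi>. norm (f \<xi> - C \<xi>) \<partial>lborel)"
      by (rule inv_fourier_bound[OF di])
    also have "\<dots> \<le> (\<integral>\<xi>. E * indicator (ball 0 R) \<xi> + \<gamma> * T R \<xi> \<partial>lborel)"
      using di diff integrable.intros[OF D] by (intro integral_mono_AE) auto
    finally show ?thesis unfolding has_bochner_integral_integral_eq[OF D] .
  qed
  have "E * (unit_ball_vol (real DIM('a)) * R ^ DIM('a)) + \<gamma> * (sphere_area DIM('a) / (m - real DIM('a)) * R powr (real DIM('a) - m))
    = 8 * sphere_area DIM('a) / real DIM('a) * N powr (1 - \<alpha>) * r ^ DIM('a) * L ^ (DIM('a) + 1) * \<delta> powr \<alpha>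
                  + sphere_area DIM('a) / (m - real DIM('a)) * \<gamma> * r powr (- m + real DIM('a)) * L powr (- m + real DIM('a))"
  proof -
    have "sphere_area DIM('a) / real DIM('a) = unit_ball_vol (real DIM('a))"
      by (simp add: sphere_area_def unit_ball_vol_def)
    then have "8 * sphere_area DIM('a) / real DIM('a) = 8 * unit_ball_vol (real DIM('a))" by simp
    moreover have "R powr (real DIM('a) - m) = r powr (- m + real DIM('a)) * L powr (- m + real DIM('a))"
      using r L1 by (simp add: R(1) powr_mult)
    ultimately show ?thesis by (simp add: E_def R(1) power_mult_distrib)
  qed
  then show "AE x in lborel. norm (v x - inv_fourier (C_star N \<sigma> r \<nu> \<tau> \<delta> w) x)
     \<le> 8 * sphere_area DIM('a) / real DIM('a) * N powr (1 - \<alpha>) * r ^ DIM('a)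
                    * L_par N \<sigma> r \<nu> \<tau> \<delta> ^ (DIM('a) + 1) * \<delta> powr \<alpha>
                  + sphere_area DIM('a) / (m - real DIM('a)) * \<gamma>
                    * r powr (- m + real DIM('a)) * L_par N \<sigma> r \<nu> \<tau> \<delta> powr (- m + real DIM('a))"
    using fourier_inversion[OF v fi[unfolded f_def]] bound unfolding f_def C_def L_def
    by (auto elim!: eventually_mono)
qed

text \<open>
The function \<open>v\<close> and the data \<open>w\<close> are replaced by Borel functions that agree with them almost everywhere,
the latter on the ball of radius \<open>r\<close>. The transforms, \<open>Q_fun\<close> and, by \<open>extrapolation_cong_AE\<close>, the
reconstruction do not see the difference.
\<close>
lemma holder_stability:
  fixes v w :: "'a::euclidean_space \<Rightarrow> complex"
  assumes m: "m > real DIM('a)"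
    and \<delta>: "0 < \<delta>" "\<delta> < N" and \<sigma>: "\<sigma> > 0" and r: "r > 0" and \<nu>: "\<nu> \<ge> 1"
    and \<alpha>01: "0 \<le> \<alpha>" "\<alpha> \<le> 1"
    and \<tau>: "0 \<le> \<tau>" "\<tau> \<le> 1" and \<alpha>: "\<nu> * \<tau> * (2 - \<tau>) = 1 - \<alpha>"
    and v: "integrable lebesgue v" and Q: "\<forall>l\<ge>0. Q_fun v l \<le> ennreal (N * exp (\<sigma> * l powr \<nu>))"
    and w: "w \<in> borel_measurable (lebesgue_on (ball 0 r))"
    and le: "linfty_norm (ball 0 r) (\<lambda>\<xi>. w \<xi> - fourier v \<xi>) \<le> ereal \<delta>"
    and \<gamma>: "W_norm m v \<le> ereal \<gamma>"
  shows "linfty_norm UNIV (\<lambda>x. v x - inv_fourier (C_star N \<sigma> r \<nu> \<tau> \<delta> w) x)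
     \<le> ereal (8 * sphere_area DIM('a) / real DIM('a) * N powr (1 - \<alpha>) * r ^ DIM('a)
                    * L_par N \<sigma> r \<nu> \<tau> \<delta> ^ (DIM('a) + 1) * \<delta> powr \<alpha>
                  + sphere_area DIM('a) / (m - real DIM('a)) * \<gamma>
                    * r powr (- m + real DIM('a)) * L_par N \<sigma> r \<nu> \<tau> \<delta> powr (- m + real DIM('a)))"
proof -
  have vm: "v \<in> borel_measurable lebesgue" using v by auto
  obtain v' where v'm: "v' \<in> borel_measurable borel" and vv': "AE x in lborel. v x = v' x"
    using lebesgue_measurable_ex_borel[OF vm] .
  have v'l: "v' \<in> borel_measurable lebesgue" using v'm by (intro measurable_completion) simp
  have F: "fourier v = fourier v'" by (rule fourier_cong_AE[OF vm v'l vv'])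
  have "integrable lebesgue v'"
    using v v'l AE_completion[OF vv'] by (rule Bochner_Integration.integrable_cong_AE_imp) 
  then have v'i: "integrable lborel v'" using v'm by (subst (asm) integrable_completion) auto
  have fm [measurable]: "fourier v' \<in> borel_measurable borel"
    using continuous_fourier[OF v'i] by (rule borel_measurable_continuous_onI)
  let ?w0 = "\<lambda>x. indicator (ball 0 r) x *\<^sub>R w x"
  have "?w0 \<in> borel_measurable lebesgue"
    using w by (subst (asm) borel_measurable_restrict_space_iff) auto
  then obtain w1 where w1 [measurable]: "w1 \<in> borel_measurable borel" and ww1: "AE x in lborel. ?w0 x = w1 x"
    by (rule lebesgue_measurable_ex_borel)
  \<comment> \<open>Besides being a Borel function, \<open>w2\<close> satisfies the noise bound at every point,
    so that it can be used along every ray.\<close>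
  define w2 where "w2 x = (if norm x < r \<and> norm (w1 x - fourier v' x) \<le> \<delta> then w1 x else fourier v' x)" for x
  have w2 [measurable]: "w2 \<in> borel_measurable borel" unfolding w2_def by measurable
  have w2le: "norm (w2 x - fourier v' x) \<le> \<delta>" for x using \<delta> by (simp add: w2_def)
  have "AE x in lborel. x \<in> ball 0 r \<longrightarrow> norm (w x - fourier v' x) \<le> \<delta>"
    using AE_le_linfty_norm[OF le] unfolding F by simp
  with ww1 have w2w: "AE x in lborel. x \<in> ball 0 r \<longrightarrow> w2 x = w x"
    by eventually_elim (auto simp: w2_def)
  let ?C = "C_star N \<sigma> r \<nu> \<tau> \<delta>"
  have Cae: "AE \<xi> in lborel. ?C w2 \<xi> = ?C w \<xi>"
    unfolding C_star_def by (rule extrapolation_cong_AE[OF w2 w2w])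
  have C: "inv_fourier (?C w2) = inv_fourier (?C w)"
  proof (rule inv_fourier_cong_AE[OF _ Cae])
    show "?C w2 \<in> borel_measurable lebesgue"
      unfolding C_star_def using extrapolation_measurable[OF w2] by (intro measurable_completion) simp
  qed
  have "AE \<xi> in lborel. \<xi> \<in> UNIV \<longrightarrow> norm (of_real ((1 + (norm \<xi>)\<^sup>2) powr (m / 2)) * fourier v' \<xi>) \<le> \<gamma>"
    using \<gamma> unfolding W_norm_def F by (rule AE_le_linfty_norm) simp
  then have dec: "AE \<xi> in lborel. (1 + (norm \<xi>)\<^sup>2) powr (m / 2) * norm (fourier v' \<xi>) \<le> \<gamma>"
    by (simp add: norm_mult)
  have Q': "\<forall>l\<ge>0. Q_fun v' l \<le> ennreal (N * exp (\<sigma> * l powr \<nu>))"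
    using Q Q_fun_cong_AE[OF vv'] by simp
  note err = synthesis_error[OF m \<delta> \<sigma> r \<nu> \<alpha>01 \<tau> \<alpha> v'i Q' w2 w2le dec]
  show ?thesis
  proof (rule linfty_norm_UNIV_le)
    have "inv_fourier (?C w) \<in> borel_measurable lebesgue"
      using borel_measurable_continuous_onI[OF err(2)] unfolding C by (intro measurable_completion) simp
    then show "(\<lambda>x. v x - inv_fourier (?C w) x) \<in> borel_measurable lebesgue"
      using vm by (intro borel_measurable_diff)
    show "AE x in lborel. norm (v x - inv_fourier (?C w) x)
     \<le> 8 * sphere_area DIM('a) / real DIM('a) * N powr (1 - \<alpha>) * r ^ DIM('a)
                    * L_par N \<sigma> r \<nu> \<tau> \<delta> ^ (DIM('a) + 1) * \<delta> powr \<alpha>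
                  + sphere_area DIM('a) / (m - real DIM('a)) * \<gamma>
                    * r powr (- m + real DIM('a)) * L_par N \<sigma> r \<nu> \<tau> \<delta> powr (- m + real DIM('a))"
      using err(1)[unfolded C] vv' by eventually_elim (simp only:)
  qed
qed

theorem theorem3p1:
  fixes N \<sigma> r \<nu> m \<gamma>1 :: real
  assumes "N > 0" and "\<sigma> > 0" and "r > 0" and "\<nu> \<ge> 1"
    and "m > real DIM('a::euclidean_space)"
  shows
    "(\<forall>\<delta> (v :: 'a \<Rightarrow> complex) (w :: 'a \<Rightarrow> complex) \<alpha> \<tau>.
        0 < \<delta> \<and> \<delta> < N \<and>
        integrable lebesgue v \<and>
        (\<forall>l\<ge>0. Q_fun v l \<le> ennreal (N * exp (\<sigma> * l powr \<nu>))) \<and>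
        w \<in> borel_measurable (lebesgue_on (ball 0 r)) \<and>
        linfty_norm (ball 0 r) (\<lambda>\<xi>. w \<xi> - fourier v \<xi>) \<le> ereal \<delta> \<and>
        v \<in> W_space m \<and> W_norm m v \<le> ereal \<gamma>1 \<and>
        0 \<le> \<alpha> \<and> \<alpha> \<le> 1 \<and> \<tau> = 1 - sqrt (1 - (1 - \<alpha>) / \<nu>)
        \<longrightarrow>
        linfty_norm UNIV (\<lambda>x. v x - inv_fourier (C_star N \<sigma> r \<nu> \<tau> \<delta> w) x)
          \<le> ereal (8 * sphere_area DIM('a) / real DIM('a) * N powr (1 - \<alpha>) * r ^ DIM('a)
                    * L_par N \<sigma> r \<nu> \<tau> \<delta> ^ (DIM('a) + 1) * \<delta> powr \<alpha>
                  + sphere_area DIM('a) / (m - real DIM('a)) * \<gamma>1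
                    * r powr (- m + real DIM('a)) * L_par N \<sigma> r \<nu> \<tau> \<delta> powr (- m + real DIM('a))))
     \<and>
     (\<forall>\<beta>1 \<tau>.
        0 < \<beta>1 / (m - real DIM('a)) \<and> \<beta>1 / (m - real DIM('a)) < 1 - sqrt (1 - 1 / \<nu>) \<and>
        \<tau> = \<beta>1 / (m - real DIM('a))
        \<longrightarrow>
        (\<exists>c1>0. \<forall>\<delta> (v :: 'a \<Rightarrow> complex) (w :: 'a \<Rightarrow> complex).
           0 < \<delta> \<and> \<delta> < N \<and>
           integrable lebesgue v \<and>
           (\<forall>l\<ge>0. Q_fun v l \<le> ennreal (N * exp (\<sigma> * l powr \<nu>))) \<and>
           w \<in> borel_measurable (lebesgue_on (ball 0 r)) \<and>
           linfty_norm (ball 0 r) (\<lambda>\<xi>. w \<xi> - fourier v \<xi>) \<le> ereal \<delta> \<and>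
           v \<in> W_space m \<and> W_norm m v \<le> ereal \<gamma>1
           \<longrightarrow>
           linfty_norm UNIV (\<lambda>x. v x - inv_fourier (C_star N \<sigma> r \<nu> \<tau> \<delta> w) x)
             \<le> ereal (c1 * ln (3 + 1 / \<delta>) powr (- \<beta>1))))"
proof (intro conjI allI impI; elim conjE)
  fix \<delta> \<alpha> \<tau> :: real and v w :: "'a \<Rightarrow> complex"
  assume h: "0 < \<delta>" "\<delta> < N" "integrable lebesgue v"
    "\<forall>l\<ge>0. Q_fun v l \<le> ennreal (N * exp (\<sigma> * l powr \<nu>))"
    "w \<in> borel_measurable (lebesgue_on (ball 0 r))"
    "linfty_norm (ball 0 r) (\<lambda>\<xi>. w \<xi> - fourier v \<xi>) \<le> ereal \<delta>" "W_norm m v \<le> ereal \<gamma>1"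
    and \<alpha>: "0 \<le> \<alpha>" "\<alpha> \<le> 1" and \<tau>: "\<tau> = 1 - sqrt (1 - (1 - \<alpha>) / \<nu>)"
  show "linfty_norm UNIV (\<lambda>x. v x - inv_fourier (C_star N \<sigma> r \<nu> \<tau> \<delta> w) x)
      \<le> ereal (8 * sphere_area DIM('a) / real DIM('a) * N powr (1 - \<alpha>) * r ^ DIM('a)
                    * L_par N \<sigma> r \<nu> \<tau> \<delta> ^ (DIM('a) + 1) * \<delta> powr \<alpha>
                  + sphere_area DIM('a) / (m - real DIM('a)) * \<gamma>1
                    * r powr (- m + real DIM('a)) * L_par N \<sigma> r \<nu> \<tau> \<delta> powr (- m + real DIM('a)))"
    using tau_alpha[OF assms(4) \<alpha> \<tau>] by (intro holder_stability[OF assms(5) h(1,2) assms(2-4) \<alpha> _ _ _ h(3-7)])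
next
  fix \<beta>1 \<tau> :: real
  let ?d = "DIM('a)"
  assume \<beta>: "0 < \<beta>1 / (m - real ?d)" "\<beta>1 / (m - real ?d) < 1 - sqrt (1 - 1 / \<nu>)" and \<tau>: "\<tau> = \<beta>1 / (m - real ?d)"
  have q: "m - real ?d > 0" using assms(5) by simp
  have \<beta>1: "\<tau> * (m - real ?d) = \<beta>1" using q by (simp add: \<tau>)
  \<comment> \<open>The Hoelder exponent that corresponds to the given \<open>\<tau>\<close>; the bound on \<open>\<tau>\<close> makes it positive.\<close>
  define \<alpha> where "\<alpha> = 1 - \<nu> * \<tau> * (2 - \<tau>)"
  have \<tau>01: "0 < \<tau>" "\<tau> < 1 - sqrt (1 - 1 / \<nu>)" using \<beta> by (simp_all add: \<tau>)
  have sq: "0 \<le> 1 - 1 / \<nu>" using assms(4) by simp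
  then have \<tau>1: "\<tau> < 1" using \<tau>01 real_sqrt_ge_zero[OF sq] by linarith
  have "(sqrt (1 - 1 / \<nu>))\<^sup>2 < (1 - \<tau>)\<^sup>2"
    using \<tau>01 sq by (intro power_strict_mono) auto
  then have "\<nu> * (1 - 1 / \<nu>) < \<nu> * (1 - \<tau>)\<^sup>2" using sq assms(4) by (intro mult_strict_left_mono) auto
  moreover have "\<nu> * (1 - 1 / \<nu>) = \<nu> - 1" using assms(4) by (simp add: field_simps)
  moreover have "\<alpha> = \<nu> * (1 - \<tau>)\<^sup>2 - (\<nu> - 1)" by (simp add: \<alpha>_def power2_eq_square algebra_simps)
  ultimately have \<alpha>0: "\<alpha> > 0" by simp
  have \<alpha>1: "\<alpha> \<le> 1" using \<tau>01 \<tau>1 assms(4) by (simp add: \<alpha>_def)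
  have \<alpha>\<tau>: "\<nu> * \<tau> * (2 - \<tau>) = 1 - \<alpha>" by (simp add: \<alpha>_def)
  define A where "A = 8 * sphere_area ?d / real ?d * r ^ ?d"
  define B where "B = sphere_area ?d / (m - real ?d) * \<bar>\<gamma>1\<bar> * r powr (- m + real ?d)"
  have S: "sphere_area ?d \<ge> 0" by (simp add: sphere_area_eq_measure_ball)
  have A: "A \<ge> 0" using S assms(3) by (simp add: A_def)
  have B: "B \<ge> 0" using S q by (simp add: B_def)
  obtain c where c: "c > 0" "\<And>\<delta>. 0 < \<delta> \<Longrightarrow> \<delta> < N \<Longrightarrow>
     A * (N powr (1 - \<alpha>) * \<delta> powr \<alpha>) * L_par N \<sigma> r \<nu> \<tau> \<delta> ^ (?d + 1) + B * L_par N \<sigma> r \<nu> \<tau> \<delta> powr (- (m - real ?d))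
      \<le> c * ln (3 + 1 / \<delta>) powr (- (\<tau> * (m - real ?d)))"
    using log_rate[OF assms(1-4) \<tau>01(1) \<tau>1 \<alpha>0 q A B] by blast
  show "\<exists>c1>0. \<forall>\<delta> (v :: 'a \<Rightarrow> complex) (w :: 'a \<Rightarrow> complex).
           0 < \<delta> \<and> \<delta> < N \<and>
           integrable lebesgue v \<and>
           (\<forall>l\<ge>0. Q_fun v l \<le> ennreal (N * exp (\<sigma> * l powr \<nu>))) \<and>
           w \<in> borel_measurable (lebesgue_on (ball 0 r)) \<and>
           linfty_norm (ball 0 r) (\<lambda>\<xi>. w \<xi> - fourier v \<xi>) \<le> ereal \<delta> \<and>
           v \<in> W_space m \<and> W_norm m v \<le> ereal \<gamma>1
           \<longrightarrow>
           linfty_norm UNIV (\<lambda>x. v x - inv_fourier (C_star N \<sigma> r \<nu> \<tau> \<delta> w) x)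
             \<le> ereal (c1 * ln (3 + 1 / \<delta>) powr (- \<beta>1))"
  proof (intro exI[of _ c] conjI allI impI; (elim conjE)?)
    fix \<delta> :: real and v w :: "'a \<Rightarrow> complex"
    assume h: "0 < \<delta>" "\<delta> < N" "integrable lebesgue v"
      "\<forall>l\<ge>0. Q_fun v l \<le> ennreal (N * exp (\<sigma> * l powr \<nu>))"
      "w \<in> borel_measurable (lebesgue_on (ball 0 r))"
      "linfty_norm (ball 0 r) (\<lambda>\<xi>. w \<xi> - fourier v \<xi>) \<le> ereal \<delta>" "W_norm m v \<le> ereal \<gamma>1"
    let ?L = "L_par N \<sigma> r \<nu> \<tau> \<delta>"
    have "linfty_norm UNIV (\<lambda>x. v x - inv_fourier (C_star N \<sigma> r \<nu> \<tau> \<delta> w) x)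
      \<le> ereal (8 * sphere_area ?d / real ?d * N powr (1 - \<alpha>) * r ^ ?d * ?L ^ (?d + 1) * \<delta> powr \<alpha>
                  + sphere_area ?d / (m - real ?d) * \<gamma>1 * r powr (- m + real ?d) * ?L powr (- m + real ?d))"
      using \<tau>01 \<tau>1 \<alpha>0 \<alpha>1 by (intro holder_stability[OF assms(5) h(1,2) assms(2-4) _ _ _ _ \<alpha>\<tau> h(3-7)]) auto
    also have "\<dots> \<le> ereal (c * ln (3 + 1 / \<delta>) powr (- \<beta>1))"
    proof -
      have "sphere_area ?d / (m - real ?d) * \<gamma>1 * r powr (- m + real ?d) \<le> B"
        unfolding B_def using S q by (intro mult_right_mono mult_left_mono) auto
      moreover have "- m + real ?d = - (m - real ?d)" by simp
      ultimately have "sphere_area ?d / (m - real ?d) * \<gamma>1 * r powr (- m + real ?d) * ?L powr (- m + real ?d)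
          \<le> B * ?L powr (- (m - real ?d))"
        by (simp only: mult_right_mono powr_ge_zero)
      moreover have "8 * sphere_area ?d / real ?d * N powr (1 - \<alpha>) * r ^ ?d * ?L ^ (?d + 1) * \<delta> powr \<alpha>
          = A * (N powr (1 - \<alpha>) * \<delta> powr \<alpha>) * ?L ^ (?d + 1)"
        by (simp add: A_def)
      ultimately show ?thesis using c(2)[OF h(1,2)] unfolding \<beta>1 ereal_less_eq by linarith
    qed
    finally show "linfty_norm UNIV (\<lambda>x. v x - inv_fourier (C_star N \<sigma> r \<nu> \<tau> \<delta> w) x)
      \<le> ereal (c * ln (3 + 1 / \<delta>) powr (- \<beta>1))" .
  qed (rule c(1))
qed

end
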